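(* Let $N>2$ be an integer, $1<p<2$, $0\le b<\frac{N-p}{p}$ and $a=\frac{Nb}{N-p}$. There is a universal constant $C(N,p,b)>0$ (depending only on $N,p,b$) such that for each $u\in\mathcal{C}_0^\infty(\mathbb{R}^N\setminus\{\mathbf{0}\})\setminus\{0\}$, $$\left(\int_{\mathbb{R}^N}\frac{|\nabla u|^p}{|x|^{pb}}\,\mathrm{d}x\right)^{\frac1p}\left(\int_{\mathbb{R}^N}\frac{|u|^p}{|x|^{pa}}\,\mathrm{d}x\right)^{\frac{p-1}{p}}-\frac{N-(p-1)a-b-1}{p}\int_{\mathbb{R}^N}\frac{|u|^p}{|x|^{(p-1)a+b+1}}\,\mathrm{d}x$$ $$\ge C(N,p,b)\left(\frac{\int_{\mathbb{R}^N}\frac{|\nabla u|^p}{|x|^{pb}}\,\mathrm{d}x}{\int_{\mathbb{R}^N}\frac{|u|^p}{|x|^{pa}}\,\mathrm{d}x}\right)^{\frac1p}\inf_{c\in\mathbb{R},\,\lambda>0}\int_{\mathbb{R}^N}\frac{\left||u|^{\frac{p-2}{2}}u-|c|^{\frac{p-2}{2}}c\,e^{-\frac{\frac p2|x|^{b-a+1}}{(b-a+1)\lambda^{b-a+1}}}\right|^2}{|x|^{pa}}\,\mathrm{d}x,$$ equivalently, $$1-\frac{\frac{N-(p-1)a-b-1}{p}\int_{\mathbb{R}^N}\frac{|u|^p}{|x|^{(p-1)a+b+1}}\,\mathrm{d}x}{\left(\int_{\mathbb{R}^N}\frac{|\nabla u|^p}{|x|^{pb}}\,\mathrm{d}x\right)^{\frac1p}\left(\int_{\mathbb{R}^N}\frac{|u|^p}{|x|^{pa}}\,\mathrm{d}x\right)^{\frac{p-1}{p}}}\ge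 C(N,p,b)\inf_{v\in\mathcal{M}_{a,b}}\left(\frac{\int_{\mathbb{R}^N}\frac{\left||u|^{\frac{p-2}{2}}u-|v|^{\frac{p-2}{2}}v\right|^2}{|x|^{pa}}\,\mathrm{d}x}{\int_{\mathbb{R}^N}\frac{|u|^p}{|x|^{pa}}\,\mathrm{d}x}\right).$$
   Context: $\mathcal{C}_0^\infty(\mathbb{R}^N\setminus\{\mathbf{0}\})$ is the set of real-valued smooth functions compactly supported in $\mathbb{R}^N\setminus\{\mathbf{0}\}$. The set $\mathcal{M}_{a,b}$ is $$\mathcal{M}_{a,b}:=\left\{\alpha e^{\frac{\beta}{b-a+1}|x|^{b-a+1}}:\ \alpha\in\mathbb{R},\ \frac{\beta}{b-a+1}<0\right\},$$ where $\beta\in\mathbb{R}$. The expression $|s|^{\frac{p-2}{2}}s$ is understood to be $0$ when $s=0$. *)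

theory Defs
  imports "HOL-Analysis.Analysis"
begin

(* Only meant for open S, where a map is C^k iff all its iterated directional derivatives
   of order at most k exist and are continuous. *)
primrec Ck_on ::
  "nat \<Rightarrow> ('a::real_normed_vector \<Rightarrow> 'b::real_normed_vector) \<Rightarrow> 'a set \<Rightarrow> bool"
where
  "Ck_on 0 f S \<longleftrightarrow> continuous_on S f"
| "Ck_on (Suc k) f S \<longleftrightarrow>
     (\<forall>x\<in>S. f differentiable (at x)) \<and>
     (\<forall>v. Ck_on k (\<lambda>x. frechet_derivative f (at x) v) S)"

definition smooth_on ::
  "('a::real_normed_vector \<Rightarrow> 'b::real_normed_vector) \<Rightarrow> 'a set \<Rightarrow> bool" where
  "smooth_on f S \<longleftrightarrow> (\<forall>k. Ck_on k f S)"

(* Elements are total functions: they vanish outside S. The closure of the support is taken in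
   the whole space, so for S = - {0} they vanish in a neighbourhood of the origin. *)
definition C0_infty :: "'a::real_normed_vector set \<Rightarrow> ('a \<Rightarrow> real) set" where
  "C0_infty S =
     {u. smooth_on u S \<and> compact (closure (support_on UNIV u)) \<and>
         closure (support_on UNIV u) \<subseteq> S}"

definition grad :: "(real ^ 'n \<Rightarrow> real) \<Rightarrow> real ^ 'n \<Rightarrow> real ^ 'n" where
  "grad u x = (\<chi> i. frechet_derivative u (at x) (axis i 1))"

definition M_set :: "real \<Rightarrow> real \<Rightarrow> (real ^ 'n \<Rightarrow> real) set" where
  "M_set a b =
     {(\<lambda>x. \<alpha> * exp (\<beta> / (b - a + 1) * norm x powr (b - a + 1))) | \<alpha> \<beta>.
        \<beta> / (b - a + 1) < 0}"

end

theory Submission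
  imports Defs
begin

text \<open>Put \<open>\<sigma> = b - a + 1\<close>, let \<open>\<kappa>\<close> be the \<open>p\<close>-th root of the quotient of the gradient integral
  by the integral of \<open>|u| powr p / |x| powr (p * a)\<close>, and let \<open>f = u * exp (\<kappa> * |x| powr \<sigma> / \<sigma>)\<close>.
  By a radial integration by parts, \<open>\<kappa> powr (p - 1)\<close> times the deficit is the integral of the
  remainder in Young's inequality for \<open>X = |x| powr (-b) *\<^sub>R \<nabla>u\<close> and a radial vector \<open>Y\<close> of length
  \<open>\<kappa> * |u| * |x| powr (-a)\<close>; uniform convexity bounds the remainder below by a multiple of
  \<open>(|X| + |Y|) powr (p - 2) * |X + Y|\<^sup>2\<close>, and \<open>X + Y\<close> is a multiple of \<open>\<nabla>f\<close>. It remains to control the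
  distance from \<open>f\<close> to a constant \<open>m\<close> for the weight \<open>|x| powr (-p * a) * exp (-p * \<kappa> * |x| powr \<sigma> / \<sigma>)\<close>.
  Since \<open>p < 2\<close>, the lower bound is too weak for an \<open>L\<^sup>2\<close> Poincare inequality where \<open>\<nabla>f\<close> is large.
  Instead, an \<open>L\<^sup>1\<close> Poincare inequality is applied to the Bregman divergence of \<open>|t| powr p / p\<close> from
  \<open>m\<close> to \<open>f\<close>, with \<open>m\<close> a median of \<open>f\<close> on a ball; its gradient can be absorbed pointwise. The
  \<open>L\<^sup>1\<close> inequality follows from the unweighted one on the ball and the divergence of one radial
  vector field, because \<open>N - p * a = N * \<sigma>\<close>.\<close>

section \<open>Young's inequality and the Bregman divergence\<close>

text \<open>The value of \<kappa> is forced. With \<open>A\<close> the gradient integral and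
  \<open>B\<close> the other one, \<open>A / p + (p - 1) / p * \<kappa> powr p * B\<close>, divided
  by \<open>\<kappa> powr (p - 1)\<close>, is smallest at \<open>\<kappa> powr p = A / B\<close>,
  and the minimum is \<open>A powr (1 / p) * B powr ((p - 1) / p)\<close>. The obstacle is
  uniformity: the final constant must not depend on \<kappa>, hence not on \<open>u\<close>. Taking
  the radius of the ball proportional to \<open>\<kappa> powr (- (1 / \<sigma>))\<close> makes the
  powers of \<kappa> cancel, up to a factor 1/\<kappa> in the Poincare constant. A median is
  preferred to a mean because the divergence vanishes wherever \<open>f = m\<close>: every segment
  from f \<le> m to f \<ge> m meets a zero of it, so no average of the divergence has to be
  subtracted. The absorption splits the gradient of the divergence into a small multiple of the
  divergence, which is moved to the other side, and a multiple of the Young remainder.\<close>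

lemma signed_powr_diff_le:
  fixes t m e :: real
  assumes e: "0 < e" "e \<le> 1"
  shows "\<bar>\<bar>t\<bar> powr (e - 1) * t - \<bar>m\<bar> powr (e - 1) * m\<bar> \<le> 2 * \<bar>t - m\<bar> * (\<bar>t\<bar> + \<bar>m\<bar>) powr (e - 1)"
proof -
  define P where "P t m \<longleftrightarrow> \<bar>\<bar>t\<bar> powr (e - 1) * t - \<bar>m\<bar> powr (e - 1) * m\<bar>
      \<le> 2 * \<bar>t - m\<bar> * (\<bar>t\<bar> + \<bar>m\<bar>) powr (e - 1)" for t m :: real
  have S: "P t m \<longleftrightarrow> P m t" for t m
    unfolding P_def by (simp add: abs_minus_commute add.commute)
  have ng: "P t m \<longleftrightarrow> P (- t) (- m)" for t m
  proof -
    have "\<bar>\<bar>t\<bar> powr (e - 1) * t - \<bar>m\<bar> powr (e - 1) * m\<bar> = \<bar>\<bar>- t\<bar> powr (e - 1) * (- t) - \<bar>- m\<bar> powr (e - 1) * (- m)\<bar>"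
      by simp
    moreover have "\<bar>t - m\<bar> = \<bar>- t - - m\<bar>" by simp
    ultimately show ?thesis unfolding P_def by simp
  qed
  have pw: "x powr (e - 1) * x = x powr e" if "0 \<le> x" for x :: real
    using that by (cases "x = 0") (auto simp: powr_diff)
  \<comment> \<open>For equal signs the difference is at most
    \<open>t powr (e - 1) * (t - m)\<close>, because \<open>powr (e - 1)\<close> is nonincreasing.
    Passing from \<open>t\<close> to \<open>t + m \<le> 2 * t\<close> in that power costs at most
    \<open>2 powr (1 - e) \<le> 2\<close>. For opposite signs \<open>\<bar>t - m\<bar>\<close>
    equals \<open>\<bar>t\<bar> + \<bar>m\<bar>\<close> and no cancellation is involved.\<close>
  have same: "P t m" if "0 \<le> m" "m \<le> t" "0 < t" for t m
  proof -
    have "t powr (e - 1) * m \<le> m powr e"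
    proof (cases "m = 0")
      case False
      then have "t powr (e - 1) \<le> m powr (e - 1)"
        using that e by (intro powr_mono2') auto
      then have "t powr (e - 1) * m \<le> m powr (e - 1) * m"
        using that by (intro mult_right_mono) auto
      then show ?thesis using pw[of m] that by simp
    qed simp
    then have "t powr e - m powr e \<le> t powr (e - 1) * (t - m)"
      using pw[of t] that by (simp add: right_diff_distrib)
    also have "\<dots> \<le> (2 * (t + m) powr (e - 1)) * (t - m)"
    proof (rule mult_right_mono)
      have "(2 * t) powr (e - 1) \<le> (t + m) powr (e - 1)"
        using that e by (intro powr_mono2') auto
      moreover have "(2 * t) powr (e - 1) = 2 powr (e - 1) * t powr (e - 1)"
        using that by (simp add: powr_mult)
      moreover have "2 powr (- 1) * t powr (e - 1) \<le> 2 powr (e - 1) * t powr (e - 1)"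
        using e by (intro mult_right_mono powr_mono) auto
      ultimately have "2 powr (- 1) * t powr (e - 1) \<le> (t + m) powr (e - 1)" by linarith
      then show "t powr (e - 1) \<le> 2 * (t + m) powr (e - 1)"
        by (simp add: powr_minus)
    qed (use that in auto)
    also have "\<dots> = 2 * (t - m) * (t + m) powr (e - 1)"
      by (simp only: mult_ac)
    finally have *: "t powr e - m powr e \<le> 2 * (t - m) * (t + m) powr (e - 1)" .
    have "m powr e \<le> t powr e" using that e by (intro powr_mono2) auto
    with * that show ?thesis unfolding P_def by (simp add: pw)
  qed
  have opp: "P t (- m)" if "0 \<le> m" "0 \<le> t" for t m
  proof -
    have "t powr e \<le> (t + m) powr e" "m powr e \<le> (t + m) powr e"
      using that e by (auto intro!: powr_mono2)
    then have "t powr e + m powr e \<le> 2 * ((t + m) powr (e - 1) * (t + m))"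
      using pw[of "t + m"] that by simp
    also have "\<dots> = 2 * (t + m) * (t + m) powr (e - 1)"
      by (simp only: mult_ac)
    finally show ?thesis unfolding P_def using that by (simp add: pw)
  qed
  have z: "P 0 0" by (simp add: P_def)
  have "P t m"
  proof -
    consider "0 \<le> m" "m \<le> t" "0 < t" | "0 \<le> t" "t \<le> m" "0 < m" | "t = 0" "m = 0"
      | "0 \<le> t" "m \<le> 0" | "t \<le> 0" "0 \<le> m" | "t \<le> m" "m \<le> 0" "t < 0" | "m \<le> t" "t \<le> 0" "m < 0"
      by linarith
    then show ?thesis
    proof cases
      case 1 then show ?thesis by (rule same)
    next
      case 2 then show ?thesis using same[of t m] S by simp
    next
      case 3 then show ?thesis using z by simp
    next
      case 4 then show ?thesis using opp[of "- m" t] by simp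
    next
      case 5 then show ?thesis using opp[of m "- t"] ng[of t m] by simp
    next
      case 6 then show ?thesis using same[of "- m" "- t"] ng[of t m] by simp
    next
      case 7 then show ?thesis using same[of "- t" "- m"] ng[of t m] S[of "- m" "- t"] by simp
    qed
  qed
  then show ?thesis by (simp add: P_def)
qed

text \<open>Second-order Taylor expansion of \<open>x powr p / p\<close> at \<open>y\<close> with
  Lagrange remainder: the second derivative \<open>(p - 1) * t powr (p - 2)\<close> is decreasing
  and the intermediate point satisfies \<open>t < x + y\<close>. The case \<open>x = 0\<close>,
  where the second derivative blows up, and the case \<open>x = y\<close>, where there is no open
  interval, are settled directly.\<close>

lemma powr_taylor_remainder:
  fixes x y p :: real
  assumes p: "1 < p" "p < 2" and x: "0 \<le> x" and y: "0 < y"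
  shows "x powr p / p + (p - 1) / p * y powr p - y powr (p - 1) * x
         \<ge> (p - 1) / 2 * (x + y) powr (p - 2) * (x - y)\<^sup>2"
proof (cases "x = 0 \<or> x = y")
  case True
  have yp: "y powr (p - 2) * y\<^sup>2 = y powr p" "y powr (p - 1) * y = y powr p"
    using y by (simp_all add: powr_diff powr_realpow flip: powr_numeral)
  show ?thesis
  proof (cases "x = 0")
    case True
    have "(p - 1) / 2 * y powr p \<le> (p - 1) / p * y powr p"
      using p by (intro mult_right_mono divide_left_mono) auto
    then show ?thesis using True yp by (simp add: mult.assoc)
  next
    case False
    with True have [simp]: "x = y" by simp
    have "y powr p / p + (p - 1) / p * y powr p - y powr (p - 1) * y = 0"
      unfolding yp using p by (simp add: field_simps)
    then show ?thesis by simp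
  qed
next
  case False
  then have x0: "0 < x" "x \<noteq> y" using x by auto
  define D :: "nat \<Rightarrow> real \<Rightarrow> real" where
    "D n = (if n = 0 then (\<lambda>t. t powr p / p) else if n = 1 then (\<lambda>t. t powr (p - 1)) else (\<lambda>t. (p - 1) * t powr (p - 2)))" for n
  have der: "DERIV (D n) t :> D (Suc n) t" if "n < 2" "0 < t" for n t
  proof -
    have "n = 0 \<or> n = 1" using that by auto
    then show ?thesis
    proof
      assume "n = 0"
      then show ?thesis using that p unfolding D_def by (auto intro!: derivative_eq_intros)
    next
      assume "n = 1"
      then show ?thesis using that p unfolding D_def by (auto intro!: derivative_eq_intros)
    qed
  qed
  have "\<exists>t. (if x < y then x < t \<and> t < y else y < t \<and> t < x) \<and>
    x powr p / p = (\<Sum>m<2. D m y / fact m * (x - y) ^ m) + D 2 t / fact 2 * (x - y)\<^sup>2"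
  proof (rule Taylor[where a = "min x y" and b = "max x y"])
    show "D 0 = (\<lambda>t. t powr p / p)" by (simp add: D_def)
    show "\<forall>m t. m < 2 \<and> min x y \<le> t \<and> t \<le> max x y \<longrightarrow> DERIV (D m) t :> D (Suc m) t"
      using der x0 y by (metis (full_types) less_le_trans min_less_iff_conj min_def)
  qed (use x0 y in auto)
  then obtain t where t': "if x < y then x < t \<and> t < y else y < t \<and> t < x" and
    eq: "x powr p / p = (\<Sum>m<2. D m y / fact m * (x - y) ^ m) + D 2 t / fact 2 * (x - y)\<^sup>2"
    by blast
  have t: "0 < t" "t < x + y" using t' x0 y by (auto split: if_splits)
  have "(x + y) powr (p - 2) \<le> t powr (p - 2)"
    using t p by (intro powr_mono2') auto
  then have "(p - 1) / 2 * (x + y) powr (p - 2) * (x - y)\<^sup>2 \<le> (p - 1) / 2 * t powr (p - 2) * (x - y)\<^sup>2"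
    using p by (intro mult_right_mono mult_left_mono) auto
  also have "\<dots> = x powr p / p - y powr p / p - y powr (p - 1) * (x - y)"
    using eq by (simp add: D_def eval_nat_numeral)
  also have "\<dots> = x powr p / p + (p - 1) / p * y powr p - y powr (p - 1) * x"
    using y p by (simp add: field_simps powr_diff)
  finally show ?thesis .
qed

text \<open>Strict convexity behind Young's inequality, with the sign of \<open>Y\<close> reversed
  so that equality means \<open>X = - Y\<close>. For antiparallel vectors it reduces to the Taylor
  bound. For parallel ones the crude estimate
  \<open>(x + y) powr p \<le> 4 * (x powr p + y powr p)\<close> is enough, and it dictates the
  factor 1/8.\<close>

lemma young_remainder_lower_bound:
  fixes X Y :: "'a :: real_inner" and p :: real
  assumes p: "1 < p" "p < 2"
  shows "norm X powr p / p + (p - 1) / p * norm Y powr p + norm Y powr (p - 2) * (Y \<bullet> X)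
         \<ge> (p - 1) / 8 * (norm X + norm Y) powr (p - 2) * (norm (X + Y))\<^sup>2"
proof -
  have "1 / 2 \<le> 1 / p" using p by (intro divide_left_mono) auto
  moreover have "(p - 1) / 8 \<le> 1 / 2" "(p - 1) / 2 \<le> 1 / 2" using p by simp_all
  ultimately have p1: "(p - 1) / 8 \<le> 1 / p" "(p - 1) / 2 \<le> 1 / p" by (blast intro: order.trans)+
  have p2: "(p - 1) / 2 \<le> (p - 1) / p" using p by (intro divide_left_mono) auto
  show ?thesis
  proof (cases "Y = 0")
    case True
    have "norm X powr (p - 2) * (norm X)\<^sup>2 = norm X powr p"
      by (cases "X = 0") (auto simp: powr_diff powr_realpow simp flip: powr_numeral)
    moreover have "(p - 1) / 8 * norm X powr p \<le> 1 / p * norm X powr p"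
      using p1 by (intro mult_right_mono) auto
    ultimately show ?thesis using True by (simp add: mult.assoc)
  next
    case False
    define x y s where "x = norm X" and "y = norm Y" and "s = Y \<bullet> X"
    have xy: "0 \<le> x" "0 < y" using False by (auto simp: x_def y_def)
    have s: "\<bar>s\<bar> \<le> x * y" using Cauchy_Schwarz_ineq2[of Y X] by (simp add: s_def x_def y_def mult.commute)
    define K where "K = (p - 1) / 8 * (x + y) powr (p - 2)"
    define c where "c = y powr (p - 2)"
    define a where "a = x powr p / p + (p - 1) / p * y powr p"
    have n: "(norm (X + Y))\<^sup>2 = x\<^sup>2 + y\<^sup>2 + 2 * s"
      by (simp add: power2_norm_eq_inner x_def y_def s_def inner_add inner_commute)
    have cy: "c * y = y powr (p - 1)" using xy by (simp add: c_def powr_diff power2_eq_square)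
    have yp: "c * y\<^sup>2 = y powr p" using xy by (simp add: c_def powr_diff powr_realpow flip: powr_numeral)
    have neg: "K * (x - y)\<^sup>2 \<le> a - c * (x * y)"
    proof -
      have "K * (x - y)\<^sup>2 \<le> (p - 1) / 2 * (x + y) powr (p - 2) * (x - y)\<^sup>2"
        unfolding K_def using p by (intro mult_right_mono) auto
      also have "\<dots> \<le> a - y powr (p - 1) * x"
        unfolding a_def by (rule powr_taylor_remainder) (use p xy in auto)
      also have "y powr (p - 1) * x = c * (x * y)" by (simp flip: cy)
      finally show ?thesis .
    qed
    have pos: "K * (x + y)\<^sup>2 \<le> a + c * (x * y)"
    proof -
      have "(x + y) powr (p - 2) * (x + y)\<^sup>2 = (x + y) powr p"
        using xy by (simp add: powr_diff powr_realpow flip: powr_numeral)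
      then have "K * (x + y)\<^sup>2 = (p - 1) / 8 * (x + y) powr p" by (simp add: K_def mult.assoc)
      also have "\<dots> \<le> (p - 1) / 8 * (4 * (x powr p + y powr p))"
      proof (rule mult_left_mono)
        have "(x + y) powr p \<le> (2 * max x y) powr p" using xy p by (intro powr_mono2) auto
        also have "\<dots> = 2 powr p * max x y powr p" using xy by (simp add: powr_mult)
        also have "\<dots> \<le> 4 * max x y powr p"
        proof (rule mult_right_mono)
          have "2 powr p \<le> 2 powr (2::real)" using p by (intro powr_mono) auto
          then show "2 powr p \<le> (4::real)" by simp
        qed simp
        also have "max x y powr p \<le> x powr p + y powr p" by (auto simp: max_def)
        finally show "(x + y) powr p \<le> 4 * (x powr p + y powr p)" by simp
      qed (use p in simp)
      also have "\<dots> = (p - 1) / 2 * x powr p + (p - 1) / 2 * y powr p"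
        by (simp add: field_simps)
      also have "(p - 1) / 2 * y powr p \<le> (p - 1) / p * y powr p"
        using p2 by (intro mult_right_mono) auto
      also have "(p - 1) / 2 * x powr p \<le> 1 / p * x powr p"
        using p1 by (intro mult_right_mono) auto
      finally have "K * (x + y)\<^sup>2 \<le> a" by (simp add: a_def)
      moreover have "0 \<le> c * (x * y)" using xy by (simp add: c_def)
      ultimately show ?thesis by simp
    qed
    text \<open>For fixed norms both sides are affine in the inner product, so its extreme values suffice.\<close>
    have "K * (x\<^sup>2 + y\<^sup>2 + 2 * s) \<le> a + c * s"
    proof -
      have n1: "a - c * (x * y) - K * (x\<^sup>2 + y\<^sup>2 - 2 * (x * y)) \<ge> 0"
        using neg by (simp add: power2_diff algebra_simps)
      have n2: "a + c * (x * y) - K * (x\<^sup>2 + y\<^sup>2 + 2 * (x * y)) \<ge> 0"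
        using pos by (simp add: power2_sum algebra_simps)
      show ?thesis
      proof (cases "c - 2 * K \<ge> 0")
        case True
        have "(c - 2 * K) * s \<ge> (c - 2 * K) * (- (x * y))"
          using True s by (intro mult_left_mono) auto
        with n1 show ?thesis by (simp add: algebra_simps)
      next
        case False
        have "(c - 2 * K) * s \<ge> (c - 2 * K) * (x * y)"
          using False s by (intro mult_left_mono_neg) auto
        with n2 show ?thesis by (simp add: algebra_simps)
      qed
    qed
    then show ?thesis
      unfolding n K_def a_def c_def by (simp add: x_def y_def s_def)
  qed
qed

section \<open>The Bregman divergence of |t|^p / p and its comparison with signed powers\<close>

lemma has_real_derivative_abs_powr:
  fixes p t :: real
  assumes p: "1 < p"
  shows "((\<lambda>t. \<bar>t\<bar> powr p) has_real_derivative p * (\<bar>t\<bar> powr (p - 2) * t)) (at t)"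
proof -
  consider "t > 0" | "t < 0" | "t = 0" by linarith
  then show ?thesis
  proof cases
    case 1
    have "((\<lambda>t. t powr p) has_real_derivative p * (t powr (p - 2) * t)) (at t)"
      using 1 by (auto intro!: derivative_eq_intros simp: powr_diff power2_eq_square)
    moreover have "\<forall>\<^sub>F s in nhds t. \<bar>s\<bar> powr p = s powr p"
      using eventually_nhds_in_open[of "{0<..}" t] 1 by (auto elim: eventually_mono)
    ultimately show ?thesis using 1 DERIV_cong_ev by fastforce
  next
    case 2
    have "((\<lambda>t. (- t) powr p) has_real_derivative p * ((- t) powr (p - 2) * t)) (at t)"
      using 2 by (auto intro!: derivative_eq_intros simp: powr_diff power2_eq_square)
    moreover have "\<forall>\<^sub>F s in nhds t. \<bar>s\<bar> powr p = (- s) powr p"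
      using eventually_nhds_in_open[of "{..<0}" t] 2 by (auto elim: eventually_mono)
    ultimately show ?thesis using 2 DERIV_cong_ev by fastforce
  next
    case 3
    \<comment> \<open>At the origin the claimed derivative is 0, since the factor \<open>t\<close>
      cancels whatever value \<open>0 powr (p - 2)\<close> has; the difference quotient has size
      \<open>\<bar>h\<bar> powr (p - 1)\<close>, which tends to 0 because p > 1.\<close>
    have "((\<lambda>h::real. \<bar>h\<bar> powr (p - 1)) \<longlongrightarrow> 0) (at 0)"
      using p by (auto intro!: tendsto_eq_intros)
    then have "((\<lambda>h::real. \<bar>h\<bar> powr p / h) \<longlongrightarrow> 0) (at 0)"
    proof (rule Lim_null_comparison[rotated])
      show "\<forall>\<^sub>F h::real in at 0. norm (\<bar>h\<bar> powr p / h) \<le> \<bar>h\<bar> powr (p - 1)"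
        by (auto simp: eventually_at_filter powr_diff)
    qed
    then show ?thesis using 3 by (simp add: has_field_derivative_iff)
  qed
qed

definition bregman :: "real \<Rightarrow> real \<Rightarrow> real \<Rightarrow> real" where
  "bregman p t m = \<bar>t\<bar> powr p / p - \<bar>m\<bar> powr p / p - \<bar>m\<bar> powr (p - 2) * m * (t - m)"

lemma bregman_self [simp]: "bregman p m m = 0"
  by (simp add: bregman_def)

lemma has_real_derivative_bregman:
  assumes "1 < p"
  shows "((\<lambda>t. bregman p t m) has_real_derivative \<bar>t\<bar> powr (p - 2) * t - \<bar>m\<bar> powr (p - 2) * m) (at t)"
  unfolding bregman_def
  by (rule DERIV_cong, (rule DERIV_diff DERIV_cdivide has_real_derivative_abs_powr assms
        DERIV_const DERIV_cmult DERIV_ident)+) (use assms in simp)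

text \<open>One-dimensional case of the Young remainder, for the vectors \<open>- t\<close> and
  \<open>m\<close>: the tangent term changes the coefficient of \<open>\<bar>m\<bar> powr p\<close>
  from -1/p to 1 - 1/p, and the sum of the two vectors has length
  \<open>\<bar>t - m\<bar>\<close>.\<close>

lemma bregman_ge:
  assumes p: "1 < p" "p < 2"
  shows "(p - 1) / 8 * ((\<bar>t\<bar> + \<bar>m\<bar>) powr (p - 2) * (t - m)\<^sup>2) \<le> bregman p t m"
proof -
  have "\<bar>m\<bar> powr (p - 2) * m * m = \<bar>m\<bar> powr p"
    by (cases "m = 0") (simp_all add: powr_diff power2_eq_square mult.assoc)
  then have eq: "bregman p t m = \<bar>t\<bar> powr p / p + (p - 1) / p * \<bar>m\<bar> powr p - \<bar>m\<bar> powr (p - 2) * (m * t)"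
    using p by (simp add: bregman_def field_simps)
  show ?thesis
    using young_remainder_lower_bound[OF p, of "- t" m] unfolding eq
    by (simp add: power2_commute mult.assoc)
qed

lemma bregman_nonneg:
  assumes "1 < p" "p < 2"
  shows "0 \<le> bregman p t m"
  using assms by (intro order.trans[OF _ bregman_ge]) auto

text \<open>For the exponent \<open>p / 2\<close> the square of the bound on signed powers is four
  times \<open>(\<bar>t\<bar> + \<bar>m\<bar>) powr (p - 2) * (t - m)\<^sup>2\<close>, the very
  expression that bounds the divergence from below; hence 32 = 4 * 8. This is where the nonlinear
  distance of the theorem comes from.\<close>

lemma signed_powr_diff_le_bregman:
  assumes p: "1 < p" "p < 2"
  shows "(p - 1) / 32 * (\<bar>t\<bar> powr ((p - 2) / 2) * t - \<bar>m\<bar> powr ((p - 2) / 2) * m)\<^sup>2 \<le> bregman p t m"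
proof -
  let ?d = "\<bar>t\<bar> powr ((p - 2) / 2) * t - \<bar>m\<bar> powr ((p - 2) / 2) * m"
  have "\<bar>?d\<bar> \<le> 2 * \<bar>t - m\<bar> * (\<bar>t\<bar> + \<bar>m\<bar>) powr ((p - 2) / 2)"
    using signed_powr_diff_le[of "p / 2" t m] p by (simp add: diff_divide_distrib)
  then have "?d\<^sup>2 \<le> (2 * \<bar>t - m\<bar> * (\<bar>t\<bar> + \<bar>m\<bar>) powr ((p - 2) / 2))\<^sup>2"
    by (metis abs_ge_zero power2_abs power_mono)
  also have "\<dots> = 4 * ((\<bar>t\<bar> + \<bar>m\<bar>) powr (p - 2) * (t - m)\<^sup>2)"
    by (simp add: power_mult_distrib power2_eq_square[of "_ powr _"] flip: powr_add)
  finally have "(p - 1) / 32 * ?d\<^sup>2 \<le> (p - 1) / 32 * (4 * ((\<bar>t\<bar> + \<bar>m\<bar>) powr (p - 2) * (t - m)\<^sup>2))"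
    using p by (intro mult_left_mono) auto
  also have "\<dots> = (p - 1) / 8 * ((\<bar>t\<bar> + \<bar>m\<bar>) powr (p - 2) * (t - m)\<^sup>2)" by simp
  also have "\<dots> \<le> bregman p t m" by (rule bregman_ge[OF p])
  finally show ?thesis .
qed

text \<open>If \<open>g \<le> |t| + |m|\<close> this is the arithmetic-geometric mean inequality, otherwise the left-hand side
  is already dominated by \<open>g powr p\<close>.\<close>
lemma bregman_absorption:
  fixes t m g e :: real
  assumes p: "1 < p" "p < 2" and g: "0 \<le> g" and e: "0 < e"
  shows "\<bar>\<bar>t\<bar> powr (p - 2) * t - \<bar>m\<bar> powr (p - 2) * m\<bar> * g
    \<le> e * bregman p t m + (2 + 32 / (e * (p - 1))) * 4 * ((g + \<bar>t\<bar>) powr (p - 2) * g\<^sup>2)"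
proof (cases "\<bar>t\<bar> + \<bar>m\<bar> = 0")
  case True
  then have "t = 0" "m = 0" by auto
  moreover have "0 < 32 / (e * (p - 1))" using e p by simp
  ultimately show ?thesis by simp
next
  case False
  define S where "S = \<bar>t\<bar> + \<bar>m\<bar>"
  define d where "d = \<bar>t - m\<bar>"
  have S: "0 < S" using False by (simp add: S_def)
  have d: "0 \<le> d" "d \<le> S" by (auto simp: d_def S_def)
  have two: "2 powr (p - 2) \<ge> (1 / 4 :: real)"
    using powr_mono[of "-2" "p - 2" "2::real"] p by (simp add: powr_minus)
  \<comment> \<open>A power with exponent \<open>p - 2\<close> grows by a factor of at most 4 when
    its argument is halved. This is applied with \<open>z = S\<close> if \<open>g \<le> S\<close>,
    and otherwise with \<open>z = g\<close>, where \<open>\<bar>t\<bar> \<le> S < g\<close>.\<close>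
  have half: "z powr (p - 2) \<le> 4 * (g + \<bar>t\<bar>) powr (p - 2)" if "g + \<bar>t\<bar> \<le> 2 * z" "0 < z" "0 < g + \<bar>t\<bar>" for z
  proof -
    have "1 / 4 * z powr (p - 2) \<le> 2 powr (p - 2) * z powr (p - 2)"
      using two by (intro mult_right_mono) auto
    also have "\<dots> = (2 * z) powr (p - 2)" using that by (simp add: powr_mult)
    also have "\<dots> \<le> (g + \<bar>t\<bar>) powr (p - 2)" using that p by (intro powr_mono2') auto
    finally show ?thesis by simp
  qed
  \<comment> \<open>The summand 2 serves the case \<open>g > S\<close>; the summand
    \<open>32 / (e * (p - 1))\<close> is the factor \<open>4 / c\<close> from the
    arithmetic-geometric mean. The separate factor 4 in the goal comes from
    \<open>half\<close>.\<close>
  let ?K = "2 + 32 / (e * (p - 1))"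
  let ?Q = "(g + \<bar>t\<bar>) powr (p - 2) * g\<^sup>2"
  have main: "d * S powr (p - 2) * g * 2 \<le> e * bregman p t m + ?K * 4 * ?Q"
  proof (cases "g = 0")
    case True
    then show ?thesis using bregman_nonneg[OF p] e by simp
  next
    case g0: False
    show ?thesis
    proof (cases "g \<le> S")
      case True
      \<comment> \<open>The weight for which the \<open>d\<^sup>2\<close> term, multiplied by
        \<open>S powr (p - 2)\<close>, is exactly \<open>e\<close> times the lower bound in
        \<open>bregman_ge\<close>.\<close>
      define c where "c = e * (p - 1) / 8"
      have c: "0 < c" using e p by (simp add: c_def)
      have "2 * d * g \<le> c * d\<^sup>2 + 4 / c * g\<^sup>2"
      proof -
        have "0 \<le> (c * d - 2 * g)\<^sup>2 + 2 * c * d * g" using c d g by simp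
        then have "c * (2 * d * g) \<le> c * (c * d\<^sup>2 + 4 / c * g\<^sup>2)"
          using c by (simp add: power2_eq_square algebra_simps)
        then show ?thesis using c by simp
      qed
      then have "S powr (p - 2) * (2 * d * g) \<le> S powr (p - 2) * (c * d\<^sup>2 + 4 / c * g\<^sup>2)"
        by (intro mult_left_mono) auto
      also have "\<dots> = e * ((p - 1) / 8 * (S powr (p - 2) * d\<^sup>2)) + 4 / c * (S powr (p - 2) * g\<^sup>2)"
        by (simp add: c_def algebra_simps)
      also have "\<dots> \<le> e * bregman p t m + 4 / c * (4 * ?Q)"
      proof (intro add_mono mult_left_mono)
        show "(p - 1) / 8 * (S powr (p - 2) * d\<^sup>2) \<le> bregman p t m"
          using bregman_ge[OF p, of t m] by (simp add: S_def d_def)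
        show "S powr (p - 2) * g\<^sup>2 \<le> 4 * ?Q"
          using mult_right_mono[OF half[of S], of "g\<^sup>2"] True S g g0 by (simp add: S_def mult.assoc)
      qed (use e c in auto)
      also have "4 / c * (4 * ?Q) \<le> ?K * 4 * ?Q"
      proof -
        have "4 / c = 32 / (e * (p - 1))" by (simp add: c_def field_simps)
        then show ?thesis by (simp add: distrib_right)
      qed
      finally show ?thesis by (simp add: mult_ac)
    next
      case False
      have "d * S powr (p - 2) * g * 2 \<le> S * S powr (p - 2) * g * 2"
        using d g by (intro mult_right_mono) auto
      also have "S * S powr (p - 2) = S powr (p - 1)"
        using S by (simp add: powr_diff power2_eq_square)
      also have "S powr (p - 1) * g * 2 \<le> g powr (p - 1) * g * 2"
        using False S p g by (intro mult_right_mono powr_mono2) auto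
      also have "\<dots> = 2 * (g powr (p - 2) * g\<^sup>2)"
        using g g0 by (simp add: powr_diff power2_eq_square)
      also have "\<dots> \<le> 2 * (4 * ?Q)"
        using mult_right_mono[OF half[of g], of "g\<^sup>2"] False S g g0 by (simp add: S_def mult.assoc)
      also have "\<dots> \<le> ?K * 4 * ?Q"
        using e p by (simp add: distrib_right)
      finally show ?thesis using bregman_nonneg[OF p, of t m] e by (simp add: add_increasing)
    qed
  qed
  have "\<bar>\<bar>t\<bar> powr (p - 2) * t - \<bar>m\<bar> powr (p - 2) * m\<bar> \<le> 2 * d * S powr (p - 2)"
    using signed_powr_diff_le[of "p - 1" t m] p by (simp add: d_def S_def)
  then have "\<bar>\<bar>t\<bar> powr (p - 2) * t - \<bar>m\<bar> powr (p - 2) * m\<bar> * g \<le> 2 * d * S powr (p - 2) * g"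
    using g by (intro mult_right_mono) auto
  with main show ?thesis by (simp add: mult_ac)
qed

section \<open>Radial integration by parts, radial weights and medians\<close>

lemma nn_integral_lborel_affine:
  fixes f :: "'a::euclidean_space \<Rightarrow> ennreal"
  assumes [measurable]: "f \<in> borel_measurable borel" and c: "c \<noteq> 0"
  shows "(\<integral>\<^sup>+x. f x \<partial>lborel) = ennreal (\<bar>c\<bar> ^ DIM('a)) * (\<integral>\<^sup>+x. f (t + c *\<^sub>R x) \<partial>lborel)"
  by (subst lborel_affine[OF c, of t])
     (simp add: nn_integral_density nn_integral_distr nn_integral_cmult)

lemma integrable_lborel_scaleR:
  fixes f :: "'a::euclidean_space \<Rightarrow> real"
  assumes f: "integrable lborel f" and c: "c \<noteq> 0"
  shows "integrable lborel (\<lambda>x. f (c *\<^sub>R x))"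
proof -
  have [measurable]: "f \<in> borel_measurable borel" using f by auto
  have "(\<integral>\<^sup>+x. ennreal (norm (f x)) \<partial>lborel)
      = ennreal (\<bar>c\<bar> ^ DIM('a)) * (\<integral>\<^sup>+x. ennreal (norm (f (0 + c *\<^sub>R x))) \<partial>lborel)"
    by (rule nn_integral_lborel_affine) (use c in auto)
  moreover have "(\<integral>\<^sup>+x. ennreal (norm (f x)) \<partial>lborel) < \<infinity>"
    using f by (simp add: integrable_iff_bounded)
  ultimately show ?thesis
    using c by (auto simp: integrable_iff_bounded ennreal_mult_less_top)
qed

lemma integral_lborel_scaleR:
  fixes f :: "'a::euclidean_space \<Rightarrow> real"
  assumes f: "integrable lborel f" and c: "c \<noteq> 0"
  shows "(\<integral>x. f x \<partial>lborel) = \<bar>c\<bar> ^ DIM('a) * (\<integral>x. f (c *\<^sub>R x) \<partial>lborel)"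
proof -
  have [measurable]: "f \<in> borel_measurable borel" using f by auto
  show ?thesis
    by (subst lborel_affine[OF c, of 0])
       (simp add: integral_density integral_distr)
qed

text \<open>The dilations \<open>x \<mapsto> t x\<close> preserve \<open>t ^ N \<integral> F (t x) dx\<close>; integrating its \<open>t\<close>-derivative
  over \<open>[1, 2]\<close> avoids any boundary term at the origin and at infinity.\<close>
lemma integral_radial_divergence_eq_0:
  fixes F :: "'a::euclidean_space \<Rightarrow> real" and F' :: "'a \<Rightarrow> 'a"
  assumes der: "\<And>x. x \<noteq> 0 \<Longrightarrow> GDERIV F x :> F' x"
    and cont: "continuous_on (- {0}) F'"
    and F: "integrable lborel F"
    and g: "integrable lborel (\<lambda>x. DIM('a) * F x + x \<bullet> F' x)"
  shows "(\<integral>x. DIM('a) * F x + x \<bullet> F' x \<partial>lborel) = 0"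
proof -
  define N where "N = DIM('a)"
  have N: "N \<noteq> 0" by (simp add: N_def)
  define g where "g x = N * F x + x \<bullet> F' x" for x
  define I where "I = (\<integral>x. g x \<partial>lborel)"
  have ig: "integrable lborel g" using g by (simp add: g_def[abs_def] N_def)
  have [measurable]: "g \<in> borel_measurable borel" using ig by auto
  \<comment> \<open>The t-derivative of \<open>t ^ N * F (t *\<^sub>R x)\<close>, cut off to [1, 2].
    Integrated over \<open>x\<close> it gives \<open>I / t\<close>; integrated over \<open>t\<close>
    it gives \<open>2 ^ N * F (2 *\<^sub>R x) - F x\<close>, whose integral over \<open>x\<close> is
    0 by scaling. Fubini then yields \<open>I * ln 2 = 0\<close>.\<close>
  define P where "P t x = t ^ (N - 1) * g (t *\<^sub>R x) * indicator {1..2} t" for t :: real and x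
  have Pm [measurable]: "(\<lambda>(t, x). P t x) \<in> borel_measurable (lborel \<Otimes>\<^sub>M lborel)"
    unfolding P_def by measurable
  have tN: "t ^ (N - 1) / t ^ N = 1 / t" if "t \<noteq> 0" for t :: real
    using that N by (cases N) auto
  have scale: "(\<integral>x. h (t *\<^sub>R x) \<partial>lborel) = (\<integral>x. h x \<partial>lborel) / t ^ N"
    if "integrable lborel h" "t > 0" for h :: "'a \<Rightarrow> real" and t
    using integral_lborel_scaleR[OF that(1), of t] that(2) by (simp add: N_def)
  have in_x: "integrable lborel (P t)" for t
    unfolding P_def using integrable_lborel_scaleR[OF ig, of t]
    by (cases "t = 0") auto
  have int_x: "(\<integral>x. P t x \<partial>lborel) = 1 / t * indicator {1..2} t * I" for t
  proof (cases "t \<in> {1..2}")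
    case True
    then have "(\<integral>x. P t x \<partial>lborel) = t ^ (N - 1) / t ^ N * I"
      by (simp only: P_def) (simp add: scale[OF ig] I_def)
    with True tN[of t] show ?thesis by (simp add: divide_inverse)
  qed (simp add: P_def)
  have norm_int_x: "(\<integral>x. norm (P t x) \<partial>lborel) = 1 / t * indicator {1..2} t * (\<integral>x. \<bar>g x\<bar> \<partial>lborel)" for t
  proof (cases "t \<in> {1..2}")
    case True
    have "(\<integral>x. \<bar>g (t *\<^sub>R x)\<bar> \<partial>lborel) = (\<integral>x. \<bar>g x\<bar> \<partial>lborel) / t ^ N"
      using scale[of "\<lambda>x. \<bar>g x\<bar>" t] ig True by simp
    with True have "(\<integral>x. norm (P t x) \<partial>lborel) = t ^ (N - 1) / t ^ N * (\<integral>x. \<bar>g x\<bar> \<partial>lborel)"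
      by (simp add: P_def abs_mult)
    with True tN[of t] show ?thesis by (simp add: divide_inverse)
  qed (simp add: P_def)
  have inv: "(\<integral>t. 1 / t * indicator {1..2} t \<partial>lborel) = ln 2 - ln (1::real)"
    by (rule integral_FTC_Icc_real) (auto intro!: derivative_eq_intros continuous_intros)
  have inv_int: "integrable lborel (\<lambda>t::real. 1 / t * indicator {1..2} t)"
  proof -
    have "integrable lborel (\<lambda>t::real. indicator {1..2} t *\<^sub>R (1 / t))"
      by (rule borel_integrable_compact) (auto intro!: continuous_intros)
    then show ?thesis by (simp add: mult.commute)
  qed
  have Pint: "integrable (lborel \<Otimes>\<^sub>M lborel) (\<lambda>(t, x). P t x)"
  proof (rule lborel_pair.Fubini_integrable)
    show "integrable lborel (\<lambda>t. \<integral>x. norm (case (t, x) of (t, x) \<Rightarrow> P t x) \<partial>lborel)"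
      using integrable_mult_left[OF inv_int, of "\<integral>x. \<bar>g x\<bar> \<partial>lborel"]
      by (simp only: prod.case norm_int_x)
  qed (use in_x in auto)
  have int_t: "(\<integral>t. P t x \<partial>lborel) = 2 ^ N * F (2 *\<^sub>R x) - F x" if x: "x \<noteq> 0" for x
  proof -
    have "(\<integral>t. (t ^ (N - 1) * g (t *\<^sub>R x)) * indicator {1..2} t \<partial>lborel)
        = 2 ^ N * F (2 *\<^sub>R x) - 1 ^ N * F (1 *\<^sub>R x)"
    proof (rule integral_FTC_Icc_real[where F = "\<lambda>t. t ^ N * F (t *\<^sub>R x)"])
      fix t :: real
      assume "1 \<le> t"
      then have tx: "t *\<^sub>R x \<noteq> 0" and t0: "t \<noteq> 0" using x by auto
      have 1: "((\<lambda>t. F (t *\<^sub>R x)) has_real_derivative (x \<bullet> F' (t *\<^sub>R x))) (at t)"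
      proof -
        have "((\<lambda>t. t *\<^sub>R x) has_derivative (\<lambda>h. h *\<^sub>R x)) (at t)"
          by (auto intro!: derivative_eq_intros)
        moreover have "(F has_derivative (\<lambda>h. h \<bullet> F' (t *\<^sub>R x))) (at (t *\<^sub>R x))"
          using der[OF tx] by (simp add: gderiv_def)
        ultimately have "((\<lambda>t. F (t *\<^sub>R x)) has_derivative (\<lambda>h. (h *\<^sub>R x) \<bullet> F' (t *\<^sub>R x))) (at t)"
          by (rule has_derivative_compose)
        then show ?thesis by (simp add: has_field_derivative_def mult.commute[of _ "x \<bullet> _"] fun_eq_iff)
      qed
      have "t ^ N = t * t ^ (N - 1)" using N by (cases N) auto
      then show "((\<lambda>t. t ^ N * F (t *\<^sub>R x)) has_real_derivative t ^ (N - 1) * g (t *\<^sub>R x)) (at t)"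
        by (auto intro!: derivative_eq_intros 1 simp: g_def algebra_simps)
      have c1: "isCont F (t *\<^sub>R x)"
        using der[OF tx] unfolding gderiv_def by (rule has_derivative_continuous)
      have c2: "isCont F' (t *\<^sub>R x)"
        using cont tx continuous_on_eq_continuous_at[of "- {0 :: 'a}" F'] by (auto simp: open_Compl)
      have m: "isCont (\<lambda>t. t *\<^sub>R x) t" by (intro continuous_intros)
      have "isCont (\<lambda>t. F (t *\<^sub>R x)) t" "isCont (\<lambda>t. F' (t *\<^sub>R x)) t"
        using isCont_o2[OF m c1] isCont_o2[OF m c2] .
      then show "isCont (\<lambda>t. t ^ (N - 1) * g (t *\<^sub>R x)) t"
        unfolding g_def by (intro continuous_intros)
    qed auto
    then show ?thesis by (simp add: P_def)
  qed
  have "I * ln 2 = (\<integral>t. (\<integral>x. P t x \<partial>lborel) \<partial>lborel)"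
    unfolding int_x integral_mult_left_zero inv by simp
  also have "\<dots> = (\<integral>x. (\<integral>t. P t x \<partial>lborel) \<partial>lborel)"
    using lborel_pair.Fubini_integral[OF Pint] by simp
  also have "\<dots> = (\<integral>x. 2 ^ N * F (2 *\<^sub>R x) - F x \<partial>lborel)"
  proof (rule integral_cong_AE)
    have "AE x in lborel. x \<noteq> (0 :: 'a)" by (rule AE_lborel_singleton)
    then show "AE x in lborel. (\<integral>t. P t x \<partial>lborel) = 2 ^ N * F (2 *\<^sub>R x) - F x"
      by eventually_elim (rule int_t)
    have [measurable]: "F \<in> borel_measurable borel" using F by auto
    show "(\<lambda>x. 2 ^ N * F (2 *\<^sub>R x) - F x) \<in> borel_measurable lborel" by measurable
    show "(\<lambda>x. \<integral>t. P t x \<partial>lborel) \<in> borel_measurable lborel" by measurable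
  qed
  also have "\<dots> = 0"
    using integrable_lborel_scaleR[OF F, of 2] F by (simp add: scale)
  finally show ?thesis by (simp add: I_def g_def[abs_def] N_def)
qed

section \<open>Integrability of powers of the norm near 0 and near infinity, and of powers times
  decaying exponentials\<close>

lemma nn_integral_norm_powr_near_0:
  fixes \<alpha> :: real
  assumes \<alpha>: "0 \<le> \<alpha>" "\<alpha> < DIM('a::euclidean_space)"
  shows "(\<integral>\<^sup>+(x::'a). ennreal (norm x powr (- \<alpha>)) * indicator (ball 0 1) x \<partial>lborel) < \<infinity>"
proof -
  define N where "N = DIM('a)"
  \<comment> \<open>Dyadic decomposition: term \<open>n\<close> majorises the integrand on the shell
    \<open>(1 / 2) ^ (n + 1) \<le> norm x < (1 / 2) ^ n\<close>, and the radius
    \<open>2 * (1 / 2) ^ (n + 1)\<close> is just \<open>(1 / 2) ^ n\<close>. Using whole balls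
    instead of shells is harmless: the series is geometric with ratio
    \<open>2 powr (\<alpha> - N)\<close>.\<close>
  let ?f = "\<lambda>n x. ennreal (2 powr ((n + 1) * \<alpha>)) * indicator (ball (0::'a) (2 * (1 / 2) ^ (n + 1))) x"
  have "ennreal (norm x powr (- \<alpha>)) * indicator (ball 0 1) x \<le> (\<Sum>n. ?f n x)" for x :: 'a
  proof (cases "x \<noteq> 0 \<and> norm x < 1")
    case True
    then obtain n where n: "(1 / 2) ^ n \<le> norm x" "\<And>m. m < n \<Longrightarrow> norm x < (1 / 2) ^ m"
    proof -
      have "\<exists>n. (1 / 2) ^ n < norm x" using True by (intro real_arch_pow_inv) auto
      then have "\<exists>n. (1 / 2) ^ n \<le> norm x" by (auto intro: less_imp_le)
      then show ?thesis
        using that[of "LEAST n. (1 / 2) ^ n \<le> norm x"] LeastI_ex not_less_Least not_le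
        by (metis (mono_tags, lifting))
    qed
    then have "n \<noteq> 0" using True by (metis not_less power_0)
    then obtain m where m: "n = Suc m" using not0_implies_Suc by blast
    have "norm x powr (- \<alpha>) \<le> ((1 / 2) ^ n) powr (- \<alpha>)"
      using n \<alpha> by (intro powr_mono2') auto
    also have "\<dots> = 2 powr ((m + 1) * \<alpha>)"
    proof -
      have "(1 / 2 :: real) ^ n = 2 powr (- (m + 1))"
        by (simp add: m powr_minus_divide power_one_over powr_diff powr_realpow)
      then show ?thesis by (simp add: powr_powr algebra_simps)
    qed
    finally have "ennreal (norm x powr (- \<alpha>)) * indicator (ball 0 1) x \<le> ?f m x"
      using n(2)[of m] m by (auto simp: indicator_def add.commute intro!: ennreal_leI)
    also have "\<dots> \<le> (\<Sum>n. ?f n x)" using sum_le_suminf[of "\<lambda>n. ?f n x" "{m}"] by (simp del: sum_mult_indicator)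
    finally show ?thesis .
  qed auto
  then have "(\<integral>\<^sup>+(x::'a). ennreal (norm x powr (- \<alpha>)) * indicator (ball 0 1) x \<partial>lborel)
      \<le> (\<integral>\<^sup>+x. (\<Sum>n. ?f n x) \<partial>lborel)"
    by (intro nn_integral_mono) auto
  also have "\<dots> = (\<Sum>n. \<integral>\<^sup>+x. ?f n x \<partial>lborel)"
    by (intro nn_integral_suminf borel_measurable_times_ennreal borel_measurable_const
        borel_measurable_indicator) simp
  also have "\<dots> = (\<Sum>n. ennreal (unit_ball_vol N * 2 powr \<alpha> * (2 powr (\<alpha> - N)) ^ n))"
  proof (intro suminf_cong)
    fix n
    have "(\<integral>\<^sup>+x. ?f n x \<partial>lborel) = ennreal (2 powr ((n + 1) * \<alpha>)) * ennreal (unit_ball_vol N * ((1 / 2) ^ n) ^ N)"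
      by (subst nn_integral_cmult_indicator) (simp_all add: emeasure_ball N_def)
    also have "\<dots> = ennreal (unit_ball_vol N * (2 powr ((n + 1) * \<alpha>) * ((1 / 2) ^ n) ^ N))"
      by (simp add: mult_ac add_ac flip: ennreal_mult)
    also have "2 powr ((n + 1) * \<alpha>) * ((1 / 2) ^ n) ^ N = 2 powr \<alpha> * (2 powr (\<alpha> - N)) ^ n"
    proof -
      have "((1 / 2 :: real) ^ n) ^ N = 2 powr (- (real n * N))"
      proof -
        have "((1 / 2 :: real) ^ n) ^ N = 1 / 2 powr real (n * N)"
          by (simp only: power_mult[symmetric] powr_realpow zero_less_numeral power_one_over)
        then show ?thesis by (simp add: powr_minus_divide)
      qed
      moreover have "(2 powr (\<alpha> - N)) ^ n = 2 powr ((\<alpha> - N) * n)"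
        by (simp add: powr_powr flip: powr_realpow)
      ultimately show ?thesis
        by (simp only: powr_add[symmetric]) (simp add: algebra_simps)
    qed
    finally show "(\<integral>\<^sup>+x. ?f n x \<partial>lborel) = ennreal (unit_ball_vol N * 2 powr \<alpha> * (2 powr (\<alpha> - N)) ^ n)"
      by (simp add: mult.assoc)
  qed
  also have "\<dots> < \<infinity>"
  proof -
    have "2 powr (\<alpha> - N) < 2 powr 0" using \<alpha> by (intro powr_less_mono) (auto simp: N_def)
    then have "summable (\<lambda>n. unit_ball_vol N * 2 powr \<alpha> * (2 powr (\<alpha> - N)) ^ n)"
      by (intro summable_mult summable_geometric) auto
    then show ?thesis
      by (subst suminf_ennreal2) auto
  qed
  finally show ?thesis .
qed

lemma nn_integral_norm_powr_near_infinity: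
  fixes \<beta> :: real
  assumes \<beta>: "\<beta> > DIM('a::euclidean_space)"
  shows "(\<integral>\<^sup>+(x::'a). ennreal (norm x powr (- \<beta>)) * indicator (- ball 0 1) x \<partial>lborel) < \<infinity>"
proof -
  define N where "N = DIM('a)"
  \<comment> \<open>The same decomposition outwards, with shells
    \<open>2 ^ n \<le> norm x < 2 ^ (n + 1)\<close> and ratio
    \<open>2 powr (N - \<beta>)\<close>.\<close>
  let ?f = "\<lambda>n x. ennreal (2 powr (- n * \<beta>)) * indicator (ball (0::'a) (2 ^ (n + 1))) x"
  have \<beta>0: "0 < \<beta>" using \<beta> by (meson le_less_trans of_nat_0_le_iff)
  have "ennreal (norm x powr (- \<beta>)) * indicator (- ball 0 1) x \<le> (\<Sum>n. ?f n x)" for x :: 'a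
  proof (cases "1 \<le> norm x")
    case True
    obtain n where n: "norm x < 2 ^ n" "\<And>m. m < n \<Longrightarrow> 2 ^ m \<le> norm x"
    proof -
      have "\<exists>n. norm x < 2 ^ n" by (intro real_arch_pow) auto
      then show ?thesis
        using that[of "LEAST n. norm x < 2 ^ n"] LeastI_ex not_less_Least not_le
        by (metis (mono_tags, lifting))
    qed
    then have "n \<noteq> 0" using True by (metis not_less power_0)
    then obtain m where m: "n = Suc m" using not0_implies_Suc by blast
    have "norm x powr (- \<beta>) \<le> (2 ^ m) powr (- \<beta>)"
      using n(2)[of m] m \<beta>0 by (intro powr_mono2') auto
    also have "\<dots> = 2 powr (- m * \<beta>)"
      by (simp add: powr_powr flip: powr_realpow)
    finally have "ennreal (norm x powr (- \<beta>)) * indicator (- ball 0 1) x \<le> ?f m x"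
      using n(1) m by (auto simp: indicator_def intro!: ennreal_leI)
    also have "\<dots> \<le> (\<Sum>n. ?f n x)" using sum_le_suminf[of "\<lambda>n. ?f n x" "{m}"] by (simp del: sum_mult_indicator)
    finally show ?thesis .
  qed auto
  then have "(\<integral>\<^sup>+(x::'a). ennreal (norm x powr (- \<beta>)) * indicator (- ball 0 1) x \<partial>lborel)
      \<le> (\<integral>\<^sup>+x. (\<Sum>n. ?f n x) \<partial>lborel)"
    by (intro nn_integral_mono) auto
  also have "\<dots> = (\<Sum>n. \<integral>\<^sup>+x. ?f n x \<partial>lborel)"
    by (intro nn_integral_suminf borel_measurable_times_ennreal borel_measurable_const
        borel_measurable_indicator) simp
  also have "\<dots> = (\<Sum>n. ennreal (unit_ball_vol N * 2 ^ N * (2 powr (N - \<beta>)) ^ n))"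
  proof (intro suminf_cong)
    fix n
    have "(\<integral>\<^sup>+x. ?f n x \<partial>lborel) = ennreal (2 powr (- n * \<beta>)) * ennreal (unit_ball_vol N * (2 ^ (n + 1)) ^ N)"
      by (subst nn_integral_cmult_indicator) (simp_all add: emeasure_ball N_def)
    also have "\<dots> = ennreal (unit_ball_vol N * (2 powr (- n * \<beta>) * (2 ^ (n + 1)) ^ N))"
      by (simp add: mult_ac flip: ennreal_mult)
    also have "2 powr (- n * \<beta>) * (2 ^ (n + 1)) ^ N = 2 ^ N * (2 powr (N - \<beta>)) ^ n"
    proof -
      have "((2 :: real) ^ (n + 1)) ^ N = 2 powr ((real n + 1) * N)"
      proof -
        have "((2 :: real) ^ (n + 1)) ^ N = 2 powr real ((n + 1) * N)"
          by (simp only: power_mult[symmetric] powr_realpow zero_less_numeral)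
        then show ?thesis by (simp add: algebra_simps)
      qed
      moreover have "(2 powr (N - \<beta>)) ^ n = 2 powr ((N - \<beta>) * n)" "(2 :: real) ^ N = 2 powr N"
        by (simp_all add: powr_powr flip: powr_realpow)
      ultimately show ?thesis
        by (simp only: powr_add[symmetric]) (simp add: algebra_simps)
    qed
    finally show "(\<integral>\<^sup>+x. ?f n x \<partial>lborel) = ennreal (unit_ball_vol N * 2 ^ N * (2 powr (N - \<beta>)) ^ n)"
      by (simp add: mult.assoc)
  qed
  also have "\<dots> < \<infinity>"
  proof -
    have "2 powr (N - \<beta>) < 2 powr 0" using \<beta> by (intro powr_less_mono) (auto simp: N_def)
    then have "summable (\<lambda>n. unit_ball_vol N * 2 ^ N * (2 powr (N - \<beta>)) ^ n)"
      by (intro summable_mult summable_geometric) auto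
    then show ?thesis
      by (subst suminf_ennreal2) auto
  qed
  finally show ?thesis .
qed

lemma power_div_fact_le_exp:
  fixes x :: real
  assumes "0 \<le> x"
  shows "x ^ m / fact m \<le> exp x"
  using sum_le_suminf[OF summable_exp_generic[of x], of "{m}"] assms
  by (simp add: exp_def divide_inverse mult.commute)

text \<open>A single term of the exponential series, \<open>(k * r powr s) ^ m / fact m\<close>,
  already beats the power once \<open>B \<le> s * m\<close>; the constant is
  \<open>fact m / k ^ m\<close>.\<close>

lemma exp_minus_powr_le_powr:
  fixes k s B :: real
  assumes "0 < k" "0 < s"
  obtains C where "0 < C" "\<And>r. 1 \<le> r \<Longrightarrow> exp (- (k * r powr s)) \<le> C * r powr (- B)"
proof -
  obtain m :: nat where m: "B / s \<le> m" using real_arch_simple by blast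
  define C where "C = fact m / k ^ m"
  have "exp (- (k * r powr s)) \<le> C * r powr (- B)" if r: "1 \<le> r" for r
  proof -
    have "B \<le> s * m" using m assms by (simp add: field_simps)
    then have "r powr B \<le> r powr (s * m)" using r by (intro powr_mono) auto
    also have "\<dots> = (r powr s) ^ m" using r by (simp add: powr_powr flip: powr_realpow)
    also have "\<dots> = (k * r powr s) ^ m / fact m * C" using assms by (simp add: C_def power_mult_distrib)
    also have "\<dots> \<le> exp (k * r powr s) * C"
      using assms r power_div_fact_le_exp[of "k * r powr s" m]
      by (intro mult_right_mono) (auto simp: C_def)
    finally show ?thesis using r by (simp add: exp_minus powr_minus field_simps)
  qed
  moreover have "0 < C" using assms by (simp add: C_def)
  ultimately show ?thesis using that by blast
qed

text \<open>Inside the unit ball the exponential is at most 1; outside it the power is at most 1 and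
  the exponential is compared with \<open>norm x powr (- real (DIM('a) + 1))\<close>, whose exponent
  is the first integer one that is integrable at infinity.\<close>

lemma integrable_norm_powr_exp:
  fixes \<eta> k s :: real
  assumes \<eta>: "0 \<le> \<eta>" "\<eta> < DIM('a::euclidean_space)" and k: "0 < k" "0 < s"
  shows "integrable lborel (\<lambda>x::'a. norm x powr (- \<eta>) * exp (- (k * norm x powr s)))"
proof -
  obtain C where C: "0 < C" "\<And>r. 1 \<le> r \<Longrightarrow> exp (- (k * r powr s)) \<le> C * r powr (- real (DIM('a) + 1))"
    using exp_minus_powr_le_powr[OF k] by blast
  have "(\<integral>\<^sup>+(x::'a). ennreal (norm x powr (- \<eta>) * exp (- (k * norm x powr s))) \<partial>lborel)
     \<le> (\<integral>\<^sup>+(x::'a). ennreal (norm x powr (- \<eta>)) * indicator (ball 0 1) x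
          + ennreal C * (ennreal (norm x powr (- real (DIM('a) + 1))) * indicator (- ball 0 1) x) \<partial>lborel)"
  proof (rule nn_integral_mono)
    fix x :: 'a
    show "ennreal (norm x powr (- \<eta>) * exp (- (k * norm x powr s)))
       \<le> ennreal (norm x powr (- \<eta>)) * indicator (ball 0 1) x
          + ennreal C * (ennreal (norm x powr (- real (DIM('a) + 1))) * indicator (- ball 0 1) x)"
    proof (cases "norm x < 1")
      case True
      then show ?thesis using k by (auto intro!: ennreal_leI mult_left_le)
    next
      case False
      have "norm x powr (- \<eta>) \<le> norm x powr 0" using False \<eta> by (intro powr_mono) auto
      also have "\<dots> = 1" using False by auto
      finally have "norm x powr (- \<eta>) * exp (- (k * norm x powr s)) \<le> 1 * (C * norm x powr (- real (DIM('a) + 1)))"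
        using C(2)[of "norm x"] False by (intro mult_mono) auto
      then show ?thesis using False C(1) by (simp flip: ennreal_mult)
    qed
  qed
  also have "\<dots> = (\<integral>\<^sup>+(x::'a). ennreal (norm x powr (- \<eta>)) * indicator (ball 0 1) x \<partial>lborel)
     + (\<integral>\<^sup>+(x::'a). ennreal C * (ennreal (norm x powr (- real (DIM('a) + 1))) * indicator (- ball 0 1) x) \<partial>lborel)"
  proof (rule nn_integral_add)
    have [measurable]: "(\<lambda>x::'a. norm x powr r) \<in> borel_measurable borel" for r
      by (rule powr_real_measurable) auto
    show "(\<lambda>x::'a. ennreal (norm x powr (- \<eta>)) * indicator (ball 0 1) x) \<in> borel_measurable lborel"
      by (intro borel_measurable_times_ennreal borel_measurable_indicator) simp_all
    show "(\<lambda>x::'a. ennreal C * (ennreal (norm x powr (- real (DIM('a) + 1))) * indicator (- ball 0 1) x)) \<in> borel_measurable lborel"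
      by (intro borel_measurable_times_ennreal borel_measurable_indicator borel_measurable_const) simp_all
  qed
  also have "\<dots> < \<infinity>"
    using nn_integral_norm_powr_near_0[OF \<eta>] nn_integral_norm_powr_near_infinity[where 'a='a, of "DIM('a) + 1"]
    by (simp add: nn_integral_cmult ennreal_mult_less_top)
  finally show ?thesis by (simp add: integrable_iff_bounded)
qed

section \<open>Medians of a real function on a finite measure space\<close>

lemma (in finite_measure) ex_median:
  fixes f :: "'a \<Rightarrow> real"
  assumes [measurable]: "f \<in> borel_measurable M"
  obtains m where "measure M (space M) / 2 \<le> measure M {x \<in> space M. f x \<le> m}"
    and "measure M (space M) / 2 \<le> measure M {x \<in> space M. m \<le> f x}"
proof (cases "measure M (space M) = 0")
  case True
  then show ?thesis using that[of 0] by simp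
next
  case False
  define h where "h = measure M (space M) / 2"
  have h: "0 < h" "h < measure M (space M)"
    using False measure_nonneg[of M "space M"] by (simp_all add: h_def less_le)
  define L where "L t = measure M {x \<in> space M. f x \<le> t}" for t
  have Lmono: "L s \<le> L t" if "s \<le> t" for s t
    unfolding L_def using that by (intro finite_measure_mono) auto
  have "(\<lambda>n. L (real n)) \<longlonglongrightarrow> measure M (\<Union>n. {x \<in> space M. f x \<le> real n})"
    unfolding L_def by (rule finite_Lim_measure_incseq) (auto simp: incseq_def)
  also have "(\<Union>n. {x \<in> space M. f x \<le> real n}) = space M"
    using real_arch_simple by auto
  finally have "\<forall>\<^sub>F n in sequentially. h < L (real n)"
    using h by (auto dest: order_tendstoD)
  then obtain n where n: "h < L (real n)" by (auto simp: eventually_sequentially)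
  have "(\<lambda>n. L (- real n)) \<longlonglongrightarrow> measure M (\<Inter>n. {x \<in> space M. f x \<le> - real n})"
    unfolding L_def by (rule finite_Lim_measure_decseq) (auto simp: decseq_def)
  also have "(\<Inter>n. {x \<in> space M. f x \<le> - real n}) = {}"
  proof -
    have False if "\<forall>n. f x \<le> - real n" for x
      using reals_Archimedean2[of "- f x"] that by (metis add.inverse_inverse le_minus_iff not_le)
    then show ?thesis by blast
  qed
  finally have "\<forall>\<^sub>F n in sequentially. L (- real n) < h"
    using h by (auto dest: order_tendstoD)
  then obtain n' where n': "L (- real n') < h" by (auto simp: eventually_sequentially)
  \<comment> \<open>The median is the infimum of the levels whose sublevel set carries at least half
    of the mass. Continuity from above along \<open>m + 1 / Suc n\<close> gives the bound for
    \<open>f x \<le> m\<close>; along \<open>m - 1 / Suc n\<close>, where the sublevel set has less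
    than half of the mass, it gives the bound for \<open>m \<le> f x\<close>.\<close>
  define S where "S = {t. h \<le> L t}"
  define m where "m = Inf S"
  have S: "S \<noteq> {}" "bdd_below S"
  proof -
    show "S \<noteq> {}" using n by (auto simp: S_def intro: less_imp_le)
    have "- real n' \<le> t" if "t \<in> S" for t
      using that n' Lmono[of t "- real n'"] by (force simp: S_def)
    then show "bdd_below S" by (rule bdd_belowI)
  qed
  have above: "h \<le> L t" if "m < t" for t
  proof -
    from that S obtain s where "s \<in> S" "s < t" unfolding m_def by (auto simp: cInf_less_iff)
    then show ?thesis using Lmono[of s t] by (simp add: S_def)
  qed
  have below: "L t < h" if "t < m" for t
    using that S cInf_lower[of t S] by (force simp: m_def S_def)
  have "(\<lambda>n. L (m + 1 / Suc n)) \<longlonglongrightarrow> measure M (\<Inter>n. {x \<in> space M. f x \<le> m + 1 / Suc n})"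
    unfolding L_def
  proof (rule finite_Lim_measure_decseq)
    show "decseq (\<lambda>n. {x \<in> space M. f x \<le> m + 1 / Suc n})"
    proof (rule decseq_SucI, safe)
      fix n x assume "f x \<le> m + 1 / real (Suc (Suc n))"
      moreover have "1 / real (Suc (Suc n)) \<le> 1 / real (Suc n)" by (simp add: frac_le)
      ultimately show "f x \<le> m + 1 / real (Suc n)" by linarith
    qed
  qed auto
  also have "(\<Inter>n. {x \<in> space M. f x \<le> m + 1 / Suc n}) = {x \<in> space M. f x \<le> m}"
  proof -
    have "f x \<le> m" if "\<forall>n. f x \<le> m + 1 / Suc n" for x
    proof (rule ccontr)
      assume "\<not> f x \<le> m"
      then obtain n where "inverse (real (Suc n)) < f x - m" using reals_Archimedean[of "f x - m"] by auto
      with that[rule_format, of n] show False by (simp add: inverse_eq_divide)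
    qed
    moreover have "f x \<le> m + 1 / Suc n" if "f x \<le> m" for x n
      using that by (rule order_trans) simp
    ultimately show ?thesis by (auto simp del: of_nat_Suc)
  qed
  finally have 1: "h \<le> measure M {x \<in> space M. f x \<le> m}"
    by (rule LIMSEQ_le_const) (use above in auto)
  have "(\<lambda>n. measure M (space M) - L (m - 1 / Suc n)) \<longlonglongrightarrow> measure M (\<Inter>n. {x \<in> space M. m - 1 / Suc n < f x})"
  proof -
    have "measure M (space M) - L (m - 1 / Suc n) = measure M {x \<in> space M. m - 1 / Suc n < f x}" for n
    proof -
      have "measure M (space M - {x \<in> space M. f x \<le> m - 1 / Suc n}) = measure M (space M) - L (m - 1 / Suc n)"
        unfolding L_def by (rule finite_measure_compl) measurable
      moreover have "space M - {x \<in> space M. f x \<le> m - 1 / Suc n} = {x \<in> space M. m - 1 / Suc n < f x}" by auto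
      ultimately show ?thesis by simp
    qed
    moreover have "(\<lambda>n. measure M {x \<in> space M. m - 1 / Suc n < f x}) \<longlonglongrightarrow> measure M (\<Inter>n. {x \<in> space M. m - 1 / Suc n < f x})"
    proof (rule finite_Lim_measure_decseq)
      show "decseq (\<lambda>n. {x \<in> space M. m - 1 / Suc n < f x})"
      proof (rule decseq_SucI, safe)
        fix n x assume "m - 1 / real (Suc (Suc n)) < f x"
        moreover have "1 / real (Suc (Suc n)) \<le> 1 / real (Suc n)" by (simp add: frac_le)
        ultimately show "m - 1 / real (Suc n) < f x" by linarith
      qed
    qed auto
    ultimately show ?thesis by simp
  qed
  also have "(\<Inter>n. {x \<in> space M. m - 1 / Suc n < f x}) = {x \<in> space M. m \<le> f x}"
  proof -
    have "m \<le> f x" if "\<forall>n. m - 1 / Suc n < f x" for x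
    proof (rule ccontr)
      assume "\<not> m \<le> f x"
      then obtain n where "inverse (real (Suc n)) < m - f x" using reals_Archimedean[of "m - f x"] by auto
      with that[rule_format, of n] show False by (simp add: inverse_eq_divide)
    qed
    moreover have "m - 1 / Suc n < f x" if "m \<le> f x" for x n
      using that by (intro less_le_trans[OF _ that]) simp
    ultimately show ?thesis by (auto simp del: of_nat_Suc)
  qed
  finally have 2: "h \<le> measure M {x \<in> space M. m \<le> f x}"
  proof (rule LIMSEQ_le_const)
    have "h \<le> measure M (space M) - L (m - 1 / Suc n)" for n
      using below[of "m - 1 / Suc n"] by (simp add: h_def)
    then show "\<exists>N. \<forall>n\<ge>N. h \<le> measure M (space M) - L (m - 1 / Suc n)" by blast
  qed
  show ?thesis using that 1 2 by (simp add: h_def)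
qed

section \<open>A Poincare inequality on balls\<close>

lemma nn_integral_abs_deriv_ge:
  fixes \<phi> \<phi>' :: "real \<Rightarrow> real"
  assumes der: "\<And>t. DERIV \<phi> t :> \<phi>' t" and cont: "continuous_on UNIV \<phi>'" and ab: "a \<le> b"
  shows "ennreal \<bar>\<phi> b - \<phi> a\<bar> \<le> (\<integral>\<^sup>+t. ennreal \<bar>\<phi>' t\<bar> * indicator {a..b} t \<partial>lborel)"
proof -
  have ic: "isCont \<phi>' t" for t using cont by (simp add: continuous_on_eq_continuous_at)
  have int: "integrable lborel (\<lambda>t. \<phi>' t * indicator {a..b} t)"
    using borel_integrable_compact[of "{a..b}" \<phi>'] cont continuous_on_subset[of UNIV \<phi>']
    by (simp add: mult.commute)
  have "\<phi> b - \<phi> a = (\<integral>t. \<phi>' t * indicator {a..b} t \<partial>lborel)"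
    by (rule integral_FTC_Icc_real[symmetric]) (use der ic ab in auto)
  also have "ennreal \<bar>\<dots>\<bar> \<le> ennreal (\<integral>t. \<bar>\<phi>' t * indicator {a..b} t\<bar> \<partial>lborel)"
    by (intro ennreal_leI integral_abs_bound)
  also have "\<dots> = (\<integral>\<^sup>+t. ennreal \<bar>\<phi>' t * indicator {a..b} t\<bar> \<partial>lborel)"
    using int by (intro nn_integral_eq_integral[symmetric]) auto
  also have "\<dots> = (\<integral>\<^sup>+t. ennreal \<bar>\<phi>' t\<bar> * indicator {a..b} t \<partial>lborel)"
    by (intro nn_integral_cong) (auto simp: indicator_def)
  finally show ?thesis .
qed

text \<open>By the intermediate value theorem \<open>f\<close> takes the value \<open>m\<close>
  somewhere on the segment, and \<open>q\<close> is zero there; integrating the derivative of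
  \<open>q\<close> from \<open>x\<close> to that point bounds \<open>q x\<close>. Enlarging the
  integral to the whole segment makes the bound independent of the place of the crossing.\<close>

lemma segment_vanishing_bound:
  fixes q f :: "'a::euclidean_space \<Rightarrow> real" and q' :: "'a \<Rightarrow> 'a"
  assumes der: "\<And>x. GDERIV q x :> q' x" and cont: "continuous_on UNIV q'"
    and f: "continuous_on UNIV f" and vanish: "\<And>x. f x = m \<Longrightarrow> q x = 0"
    and xz: "f x \<le> m \<and> m \<le> f z \<or> f z \<le> m \<and> m \<le> f x"
  shows "ennreal \<bar>q x\<bar> \<le> ennreal (norm (z - x)) *
      (\<integral>\<^sup>+t. ennreal (norm (q' (x + t *\<^sub>R (z - x)))) * indicator {0..1} t \<partial>lborel)"
proof -
  define \<gamma> where "\<gamma> t = x + t *\<^sub>R (z - x)" for t :: real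
  have c\<gamma>: "continuous_on S \<gamma>" for S unfolding \<gamma>_def by (intro continuous_intros)
  have cf: "continuous_on {0..1} (\<lambda>t. f (\<gamma> t))"
    using continuous_on_compose2[OF f c\<gamma>] by auto
  obtain s where s: "0 \<le> s" "s \<le> 1" "f (\<gamma> s) = m"
    using xz IVT'[of "\<lambda>t. f (\<gamma> t)" 0 m 1] IVT2'[of "\<lambda>t. f (\<gamma> t)" 1 m 0] cf by (auto simp: \<gamma>_def)
  have d: "DERIV (\<lambda>t. q (\<gamma> t)) t :> (z - x) \<bullet> q' (\<gamma> t)" for t
  proof -
    have "(\<gamma> has_derivative (\<lambda>h. h *\<^sub>R (z - x))) (at t)"
      unfolding \<gamma>_def by (auto intro!: derivative_eq_intros)
    moreover have "(q has_derivative (\<lambda>h. h \<bullet> q' (\<gamma> t))) (at (\<gamma> t))"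
      using der[of "\<gamma> t"] by (simp add: gderiv_def)
    ultimately have "((\<lambda>t. q (\<gamma> t)) has_derivative (\<lambda>h. (h *\<^sub>R (z - x)) \<bullet> q' (\<gamma> t))) (at t)"
      by (rule has_derivative_compose)
    then show ?thesis by (simp add: has_field_derivative_def mult.commute[of _ "_ \<bullet> _"] fun_eq_iff)
  qed
  have c: "continuous_on UNIV (\<lambda>t. (z - x) \<bullet> q' (\<gamma> t))"
    using continuous_on_compose2[OF cont c\<gamma>, of UNIV] by (intro continuous_intros) auto
  have [measurable]: "q' \<in> borel_measurable borel" using cont by (rule borel_measurable_continuous_onI)
  have "ennreal \<bar>q x\<bar> = ennreal \<bar>q (\<gamma> s) - q (\<gamma> 0)\<bar>"
    using vanish[OF s(3)] by (simp add: \<gamma>_def)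
  also have "\<dots> \<le> (\<integral>\<^sup>+t. ennreal \<bar>(z - x) \<bullet> q' (\<gamma> t)\<bar> * indicator {0..s} t \<partial>lborel)"
    by (rule nn_integral_abs_deriv_ge[OF d c s(1)])
  also have "\<dots> \<le> (\<integral>\<^sup>+t. ennreal (norm (z - x)) * (ennreal (norm (q' (\<gamma> t))) * indicator {0..1} t) \<partial>lborel)"
    using s Cauchy_Schwarz_ineq2[of "z - x"]
    by (intro nn_integral_mono) (auto simp: indicator_def intro!: ennreal_leI simp flip: ennreal_mult)
  also have "\<dots> = ennreal (norm (z - x)) * (\<integral>\<^sup>+t. ennreal (norm (q' (\<gamma> t))) * indicator {0..1} t \<partial>lborel)"
    unfolding \<gamma>_def by (rule nn_integral_cmult) measurable
  finally show ?thesis by (simp add: \<gamma>_def)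
qed

text \<open>Substituting in \<open>z\<close> for all \<open>t\<close> would cost a factor t^(-N),
  not integrable at t = 0. Hence \<open>z\<close> is substituted when \<open>t \<ge> 1 / 2\<close>
  and \<open>x\<close> otherwise, so that the Jacobian factor never exceeds 2^N; convexity keeps the
  intermediate point in the ball.\<close>

lemma nn_integral_ball_convex_combination:
  fixes K :: "'a::euclidean_space \<Rightarrow> ennreal"
  assumes [measurable]: "K \<in> borel_measurable borel" and R: "0 < R" and t: "0 \<le> t" "t \<le> 1"
  shows "(\<integral>\<^sup>+x. (\<integral>\<^sup>+z. K (x + t *\<^sub>R (z - x)) * indicator (ball 0 R) z * indicator (ball 0 R) x \<partial>lborel) \<partial>lborel)
    \<le> emeasure lborel (ball (0::'a) R) * (2 ^ DIM('a) * (\<integral>\<^sup>+x. K x * indicator (ball 0 R) x \<partial>lborel))"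
proof -
  let ?B = "ball (0::'a) R"
  let ?I = "\<integral>\<^sup>+x. K x * indicator ?B x \<partial>lborel"
  have [measurable]: "?B \<in> sets borel" by simp
  have half: "(\<integral>\<^sup>+w. K (y + c *\<^sub>R w) * indicator ?B w * indicator ?B z \<partial>lborel)
      \<le> 2 ^ DIM('a) * ?I * indicator ?B z" if c: "1 / 2 \<le> c" "c \<le> 1" and y: "y = (1 - c) *\<^sub>R z" for y z c
  proof (cases "z \<in> ?B")
    case True
    have "(\<integral>\<^sup>+w. K (y + c *\<^sub>R w) * indicator ?B w \<partial>lborel)
        \<le> (\<integral>\<^sup>+w. K (y + c *\<^sub>R w) * indicator ?B (y + c *\<^sub>R w) \<partial>lborel)"
    proof (rule nn_integral_mono)
      fix w
      have "y + c *\<^sub>R w \<in> ?B" if "w \<in> ?B"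
        using convexD[OF convex_ball True that, of "1 - c" c] c y by simp
      then show "K (y + c *\<^sub>R w) * indicator ?B w \<le> K (y + c *\<^sub>R w) * indicator ?B (y + c *\<^sub>R w)"
        by (auto simp: indicator_def)
    qed
    also have "\<dots> \<le> (2 ^ DIM('a) * ennreal (\<bar>c\<bar> ^ DIM('a))) * \<dots>" (is "?W \<le> _")
    proof -
      have "1 \<le> (2 * c) ^ DIM('a)" using c by (intro one_le_power) auto
      then have "ennreal 1 \<le> ennreal ((2 * c) ^ DIM('a))" by (rule ennreal_leI)
      also have "\<dots> = 2 ^ DIM('a) * ennreal (\<bar>c\<bar> ^ DIM('a))"
        using c by (simp add: power_mult_distrib ennreal_mult ennreal_power[symmetric])
      finally have "1 * ?W \<le> (2 ^ DIM('a) * ennreal (\<bar>c\<bar> ^ DIM('a))) * ?W"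
        by (intro mult_right_mono) auto
      then show ?thesis by simp
    qed
    also have "\<dots> = 2 ^ DIM('a) * ?I"
      using c by (subst nn_integral_lborel_affine[of "\<lambda>x. K x * indicator ?B x" c y])
        (measurable, simp_all add: mult.assoc)
    finally show ?thesis using True by simp
  qed simp
  have const: "(\<integral>\<^sup>+x. 2 ^ DIM('a) * ?I * indicator ?B x \<partial>lborel) = emeasure lborel ?B * (2 ^ DIM('a) * ?I)"
    by (subst nn_integral_cmult_indicator) (simp_all add: mult.commute)
  show ?thesis
  proof (cases "1 / 2 \<le> t")
    case True
    have "(\<integral>\<^sup>+z. K (x + t *\<^sub>R (z - x)) * indicator ?B z * indicator ?B x \<partial>lborel)
        \<le> 2 ^ DIM('a) * ?I * indicator ?B x" for x
      using half[of t "(1 - t) *\<^sub>R x" x] True t by (simp add: algebra_simps)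
    then have "(\<integral>\<^sup>+x. (\<integral>\<^sup>+z. K (x + t *\<^sub>R (z - x)) * indicator ?B z * indicator ?B x \<partial>lborel) \<partial>lborel)
        \<le> (\<integral>\<^sup>+x. 2 ^ DIM('a) * ?I * indicator ?B x \<partial>lborel)"
      by (intro nn_integral_mono)
    then show ?thesis unfolding const .
  next
    case False
    have "(\<integral>\<^sup>+x. K (x + t *\<^sub>R (z - x)) * indicator ?B z * indicator ?B x \<partial>lborel)
        \<le> 2 ^ DIM('a) * ?I * indicator ?B z" for z
      using half[of "1 - t" "t *\<^sub>R z" z] False t by (simp add: algebra_simps)
    then have "(\<integral>\<^sup>+z. (\<integral>\<^sup>+x. K (x + t *\<^sub>R (z - x)) * indicator ?B z * indicator ?B x \<partial>lborel) \<partial>lborel)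
        \<le> (\<integral>\<^sup>+z. 2 ^ DIM('a) * ?I * indicator ?B z \<partial>lborel)"
      by (intro nn_integral_mono)
    moreover have "(\<integral>\<^sup>+x. (\<integral>\<^sup>+z. K (x + t *\<^sub>R (z - x)) * indicator ?B z * indicator ?B x \<partial>lborel) \<partial>lborel)
       = (\<integral>\<^sup>+z. (\<integral>\<^sup>+x. K (x + t *\<^sub>R (z - x)) * indicator ?B z * indicator ?B x \<partial>lborel) \<partial>lborel)"
      by (rule lborel_pair.Fubini') measurable
    ultimately show ?thesis unfolding const by simp
  qed
qed

text \<open>Each of the sets f \<le> m and f \<ge> m fills at least half of the ball. For
  \<open>x\<close> in one of them the segment bound is averaged over \<open>z\<close> in the other.
  The constant collects \<open>2 * R\<close> for the length of a segment, \<open>2 ^ DIM('a)\<close>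
  from the convex combinations, 2 for dividing by half the volume and 2 for adding the two
  sets.\<close>

lemma ball_median_poincare:
  fixes q f :: "'a::euclidean_space \<Rightarrow> real" and q' :: "'a \<Rightarrow> 'a"
  assumes der: "\<And>x. GDERIV q x :> q' x" and cont: "continuous_on UNIV q'"
    and f: "continuous_on UNIV f" and vanish: "\<And>x. f x = m \<Longrightarrow> q x = 0"
    and R: "0 < R"
    and le: "measure lborel (ball (0::'a) R) / 2 \<le> measure lborel {x \<in> ball 0 R. f x \<le> m}"
    and ge: "measure lborel (ball (0::'a) R) / 2 \<le> measure lborel {x \<in> ball 0 R. m \<le> f x}"
  shows "(\<integral>\<^sup>+x. ennreal \<bar>q x\<bar> * indicator (ball 0 R) x \<partial>lborel)
    \<le> ennreal (8 * 2 ^ DIM('a) * R) * (\<integral>\<^sup>+x. ennreal (norm (q' x)) * indicator (ball 0 R) x \<partial>lborel)"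
proof -
  let ?B = "ball (0::'a) R"
  have [measurable]: "?B \<in> sets borel" by simp
  define L where "L = {x \<in> ?B. f x \<le> m}"
  define U where "U = {x \<in> ?B. m \<le> f x}"
  define K where "K x = ennreal (norm (q' x))" for x
  define I where "I = (\<integral>\<^sup>+x. K x * indicator ?B x \<partial>lborel)"
  define J where "J x z = (\<integral>\<^sup>+t. K (x + t *\<^sub>R (z - x)) * indicator {0..1} t \<partial>lborel)" for x z
  have [measurable]: "f \<in> borel_measurable borel" "q' \<in> borel_measurable borel"
    using f cont by (auto intro: borel_measurable_continuous_onI)
  have "continuous_on UNIV q"
    using der by (auto simp: gderiv_def continuous_on_eq_continuous_at intro: has_derivative_continuous)
  then have [measurable]: "q \<in> borel_measurable borel" by (rule borel_measurable_continuous_onI)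
  have [measurable]: "K \<in> borel_measurable borel" unfolding K_def by measurable
  have Jm [measurable]: "(\<lambda>(x, z). J x z) \<in> borel_measurable (lborel \<Otimes>\<^sub>M lborel)" 
    unfolding J_def by measurable
  have LU [measurable]: "L \<in> sets borel" "U \<in> sets borel" unfolding L_def U_def by measurable
  have LUB: "L \<subseteq> ?B" "U \<subseteq> ?B" "L \<union> U = ?B" by (auto simp: L_def U_def)
  have finB: "emeasure lborel ?B < \<infinity>" by (simp add: emeasure_ball R less_imp_le)
  define b where "b = measure lborel ?B"
  have b: "0 < b" using R by (simp add: b_def)
  have B: "emeasure lborel ?B = ennreal b"
    using finB by (simp add: b_def emeasure_eq_ennreal_measure less_top)
  have em: "ennreal (b / 2) \<le> emeasure lborel S" if "b / 2 \<le> measure lborel S" "S \<subseteq> ?B" "S \<in> sets borel" for S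
  proof -
    have "emeasure lborel S \<le> emeasure lborel ?B" using that by (intro emeasure_mono) auto
    then have "emeasure lborel S = ennreal (measure lborel S)"
      using finB by (intro emeasure_eq_ennreal_measure) (auto simp: top_unique)
    then show ?thesis using that by (simp add: ennreal_leI)
  qed
  define D where "D = (\<integral>\<^sup>+x. (\<integral>\<^sup>+z. J x z * indicator ?B z * indicator ?B x \<partial>lborel) \<partial>lborel)"
  have one: "ennreal (b / 2) * (\<integral>\<^sup>+x. ennreal \<bar>q x\<bar> * indicator S x \<partial>lborel) \<le> ennreal (2 * R) * D"
    if S: "S = L \<and> T = U \<or> S = U \<and> T = L" for S T
  proof -
    have [measurable]: "S \<in> sets borel" "T \<in> sets borel" and ST: "S \<subseteq> ?B" "T \<subseteq> ?B" using S LU LUB by auto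
    have T: "ennreal (b / 2) \<le> emeasure lborel T"
      using S em[of L] em[of U] LUB LU le ge by (auto simp: b_def L_def U_def)
    have "ennreal (b / 2) * (\<integral>\<^sup>+x. ennreal \<bar>q x\<bar> * indicator S x \<partial>lborel)
        = (\<integral>\<^sup>+x. ennreal (b / 2) * (ennreal \<bar>q x\<bar> * indicator S x) \<partial>lborel)"
      by (rule nn_integral_cmult[symmetric]) measurable
    also have "\<dots> \<le> (\<integral>\<^sup>+x. ennreal (2 * R) * (\<integral>\<^sup>+z. J x z * indicator ?B z * indicator ?B x \<partial>lborel) \<partial>lborel)"
    proof (rule nn_integral_mono)
      fix x
      show "ennreal (b / 2) * (ennreal \<bar>q x\<bar> * indicator S x)
          \<le> ennreal (2 * R) * (\<integral>\<^sup>+z. J x z * indicator ?B z * indicator ?B x \<partial>lborel)"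
      proof (cases "x \<in> S")
        case True
        have "ennreal (b / 2) * ennreal \<bar>q x\<bar> \<le> ennreal \<bar>q x\<bar> * emeasure lborel T"
          using mult_left_mono[OF T, of "ennreal \<bar>q x\<bar>"] by (simp add: mult.commute)
        also have "\<dots> = (\<integral>\<^sup>+z. ennreal \<bar>q x\<bar> * indicator T z \<partial>lborel)"
          by (rule nn_integral_cmult_indicator[symmetric]) simp
        also have "\<dots> \<le> (\<integral>\<^sup>+z. ennreal (2 * R) * (J x z * indicator ?B z * indicator ?B x) \<partial>lborel)"
        proof (rule nn_integral_mono)
          fix z
          show "ennreal \<bar>q x\<bar> * indicator T z \<le> ennreal (2 * R) * (J x z * indicator ?B z * indicator ?B x)"
          proof (cases "z \<in> T")
            case zT: True
            have "ennreal \<bar>q x\<bar> \<le> ennreal (norm (z - x)) * J x z"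
              unfolding J_def K_def
              by (rule segment_vanishing_bound[OF der cont f vanish])
                 (use True zT S in \<open>auto simp: L_def U_def\<close>)
            also have "\<dots> \<le> ennreal (2 * R) * J x z"
            proof (intro mult_right_mono ennreal_leI)
              have "x \<in> ?B" "z \<in> ?B" using True zT ST by auto
              then have "norm x < R" "norm z < R" by auto
              then show "norm (z - x) \<le> 2 * R" using norm_triangle_ineq4[of z x] by linarith
            qed simp
            finally show ?thesis using True zT ST by (auto simp: indicator_def)
          qed simp
        qed
        also have "\<dots> = ennreal (2 * R) * (\<integral>\<^sup>+z. J x z * indicator ?B z * indicator ?B x \<partial>lborel)"
          by (rule nn_integral_cmult) measurable
        finally show ?thesis using True by simp
      qed simp
    qed
    also have "\<dots> = ennreal (2 * R) * D"
      unfolding D_def by (rule nn_integral_cmult) measurable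
    finally show ?thesis .
  qed
  \<comment> \<open>With \<open>t\<close> moved outermost, the bound for convex combinations applies
    for each fixed \<open>t\<close>.\<close>
  have "D = (\<integral>\<^sup>+x. (\<integral>\<^sup>+z. (\<integral>\<^sup>+t. K (x + t *\<^sub>R (z - x)) * indicator ?B z * indicator ?B x * indicator {0..1} t \<partial>lborel) \<partial>lborel) \<partial>lborel)"
  proof -
    have "J x z * indicator ?B z * indicator ?B x
      = (\<integral>\<^sup>+t. K (x + t *\<^sub>R (z - x)) * indicator ?B z * indicator ?B x * indicator {0..1} t \<partial>lborel)" for x z
      unfolding J_def by (auto simp: indicator_def)
    then show ?thesis unfolding D_def by simp
  qed
  also have "\<dots> = (\<integral>\<^sup>+x. (\<integral>\<^sup>+t. (\<integral>\<^sup>+z. K (x + t *\<^sub>R (z - x)) * indicator ?B z * indicator ?B x * indicator {0..1} t \<partial>lborel) \<partial>lborel) \<partial>lborel)"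
    by (intro nn_integral_cong lborel_pair.Fubini') measurable
  also have "\<dots> = (\<integral>\<^sup>+t. (\<integral>\<^sup>+x. (\<integral>\<^sup>+z. K (x + t *\<^sub>R (z - x)) * indicator ?B z * indicator ?B x * indicator {0..1} t \<partial>lborel) \<partial>lborel) \<partial>lborel)"
    by (rule lborel_pair.Fubini') measurable
  also have "\<dots> \<le> (\<integral>\<^sup>+t. (ennreal b * (2 ^ DIM('a) * I)) * indicator {0..1::real} t \<partial>lborel)"
  proof (rule nn_integral_mono)
    fix t :: real
    show "(\<integral>\<^sup>+x. (\<integral>\<^sup>+z. K (x + t *\<^sub>R (z - x)) * indicator ?B z * indicator ?B x * indicator {0..1} t \<partial>lborel) \<partial>lborel)
        \<le> (ennreal b * (2 ^ DIM('a) * I)) * indicator {0..1} t"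
      using nn_integral_ball_convex_combination[of K R t] R B by (cases "t \<in> {0..1}") (auto simp: I_def)
  qed
  also have "\<dots> = ennreal b * (2 ^ DIM('a) * I)"
    by (subst nn_integral_cmult_indicator) simp_all
  finally have D: "D \<le> ennreal b * (2 ^ DIM('a) * I)" .
  define Q where "Q = (\<integral>\<^sup>+x. ennreal \<bar>q x\<bar> * indicator ?B x \<partial>lborel)"
  have "ennreal (b / 2) * Q \<le> ennreal (b / 2) * ((\<integral>\<^sup>+x. ennreal \<bar>q x\<bar> * indicator L x \<partial>lborel)
      + (\<integral>\<^sup>+x. ennreal \<bar>q x\<bar> * indicator U x \<partial>lborel))"
  proof (rule mult_left_mono)
    have "Q \<le> (\<integral>\<^sup>+x. ennreal \<bar>q x\<bar> * indicator L x + ennreal \<bar>q x\<bar> * indicator U x \<partial>lborel)"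
      unfolding Q_def
    proof (rule nn_integral_mono)
      fix x
      consider "x \<in> L" | "x \<in> U" | "x \<notin> ?B" using LUB(3) by blast
      then show "ennreal \<bar>q x\<bar> * indicator ?B x \<le> ennreal \<bar>q x\<bar> * indicator L x + ennreal \<bar>q x\<bar> * indicator U x"
        by cases (simp_all add: indicator_def)
    qed
    also have "\<dots> = (\<integral>\<^sup>+x. ennreal \<bar>q x\<bar> * indicator L x \<partial>lborel) + (\<integral>\<^sup>+x. ennreal \<bar>q x\<bar> * indicator U x \<partial>lborel)"
      by (rule nn_integral_add) measurable
    finally show "Q \<le> \<dots>" .
  qed simp
  also have "\<dots> \<le> ennreal (2 * R) * D + ennreal (2 * R) * D"
    using one[of L U] one[of U L] by (auto simp: distrib_left intro: add_mono)
  also have "\<dots> \<le> ennreal (2 * R) * (ennreal b * (2 ^ DIM('a) * I)) + ennreal (2 * R) * (ennreal b * (2 ^ DIM('a) * I))"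
    using D by (intro add_mono mult_left_mono) auto
  also have "\<dots> = ennreal (b / 2) * (ennreal (8 * 2 ^ DIM('a) * R) * I)"
  proof -
    have p2: "(2 ^ DIM('a) :: ennreal) = ennreal (2 ^ DIM('a))" by (simp add: ennreal_power[symmetric])
    have "ennreal (2 * R) * (ennreal b * (2 ^ DIM('a) * I)) = ennreal (2 * R * b * 2 ^ DIM('a)) * I"
      unfolding p2 using R b by (simp add: ennreal_mult mult.assoc)
    moreover have "ennreal (b / 2) * (ennreal (8 * 2 ^ DIM('a) * R) * I) = ennreal (b / 2 * (8 * 2 ^ DIM('a) * R)) * I"
      using R b by (subst ennreal_mult[of "b / 2"]) (simp_all add: mult.assoc)
    moreover have "ennreal (2 * R * b * 2 ^ DIM('a)) + ennreal (2 * R * b * 2 ^ DIM('a)) = ennreal (b / 2 * (8 * 2 ^ DIM('a) * R))"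
      using R b by (simp flip: ennreal_plus)
    ultimately show ?thesis by (simp flip: distrib_right)
  qed
  finally have "ennreal (2 / b) * (ennreal (b / 2) * Q) \<le> ennreal (2 / b) * (ennreal (b / 2) * (ennreal (8 * 2 ^ DIM('a) * R) * I))"
    by (rule mult_left_mono) simp
  moreover have "ennreal (2 / b) * ennreal (b / 2) = 1"
    using b by (simp flip: ennreal_mult)
  ultimately have "Q \<le> ennreal (8 * 2 ^ DIM('a) * R) * I"
    by (simp flip: mult.assoc)
  then show ?thesis by (simp add: Q_def I_def K_def)
qed

section \<open>A weighted Poincare inequality\<close>

text \<open>The left-hand side has the form (n - s) \<theta>(s) + s \<theta>'(s) for \<theta>(s) =
  (1 - s) / (1 + s)^2, and it equals the cubic \<open>P\<close> divided by (1 + s)^3. The quotient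
  is n at s = 0 and tends to 1 at infinity, so it is bounded below by a positive number off a
  bounded interval. On that interval only the bound -(n + 4) is kept; \<open>n + 5\<close> leaves
  room for the 1/6.\<close>

lemma radial_multiplier_lower_bound:
  fixes n s :: real
  assumes n: "2 \<le> n" and s: "0 \<le> s"
  shows "(n - s) * ((1 - s) / (1 + s)\<^sup>2) + s * ((s - 3) / (1 + s) ^ 3)
    \<ge> 1 / 6 - (n + 5) * indicator {1 / 4..<2 * n} s"
proof -
  define P where "P = (n - s) * (1 - s\<^sup>2) + s\<^sup>2 - 3 * s"
  have pos: "0 < (1 + s) ^ 3" using s by simp
  have eq: "(n - s) * ((1 - s) / (1 + s)\<^sup>2) + s * ((s - 3) / (1 + s) ^ 3) = P / (1 + s) ^ 3"
  proof -
    have "(n - s) * ((1 - s) / (1 + s)\<^sup>2) = (n - s) * (1 - s) * (1 + s) / (1 + s) ^ 3"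
      using s by (simp add: power3_eq_cube power2_eq_square)
    moreover have "(n - s) * (1 - s) * (1 + s) + s * (s - 3) = P"
      by (simp add: P_def power2_eq_square algebra_simps)
    ultimately show ?thesis by (simp flip: add_divide_distrib)
  qed
  consider "s < 1 / 4" | "2 * n \<le> s" | "1 / 4 \<le> s" "s < 2 * n" by linarith
  then have "(1 / 6 - (n + 5) * indicator {1 / 4..<2 * n} s) * (1 + s) ^ 3 \<le> P"
  proof cases
    case 1
    have "s * s \<le> 1 / 4 * (1 / 4)" using 1 s by (intro mult_mono) auto
    then have s2: "s\<^sup>2 \<le> 1 / 16" by (simp add: power2_eq_square)
    have "(1 + s) ^ 3 \<le> (1 + 1 / 4) ^ 3" using 1 s by (intro power_mono) auto
    then have "(1 + s) ^ 3 \<le> 2" by (simp add: power3_eq_cube)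
    moreover have "3 / 2 * (15 / 16) \<le> (n - s) * (1 - s\<^sup>2)"
      using n 1 s2 by (intro mult_mono) auto
    moreover have "0 \<le> s\<^sup>2" by simp
    moreover have "z \<le> 6 * (y + x - 3 * s)" if "z \<le> 2" "3 / 2 * (15 / 16) \<le> y" "0 \<le> x" for x y z :: real
      using that 1 by argo
    ultimately have "(1 + s) ^ 3 \<le> 6 * P" unfolding P_def by (metis add_diff_eq)
    then show ?thesis using 1 by simp
  next
    case 2
    have s4: "4 \<le> s" using 2 n by linarith
    have ss: "4 * s \<le> s * s" using s4 by (intro mult_right_mono) auto
    have sss: "4 * (s * s) \<le> s * (s * s)" using s4 by (intro mult_right_mono) auto
    have "s / 2 * (s * s - 1) \<le> (s - n) * (s * s - 1)"
      using 2 ss s4 by (intro mult_right_mono) linarith+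
    then have "(s * (s * s) - s) / 2 \<le> s * (s * s) - s - n * (s * s) + n"
      by (simp add: algebra_simps)
    moreover have "(1 + s) ^ 3 = 1 + 3 * s + 3 * (s * s) + s * (s * s)"
      by (simp add: power3_eq_cube algebra_simps)
    moreover have "P = n - n * (s * s) - s + s * (s * s) + s * s - 3 * s"
      by (simp add: P_def algebra_simps power2_eq_square)
    \<comment> \<open>The monomials s^2, s^3 and n s^2 become free variables \<open>b\<close>,
      \<open>c\<close>, \<open>d\<close>, which leaves a linear problem.\<close>
    moreover have "z \<le> 6 * P" if "(c - s) / 2 \<le> c - s - d + n" "z = 1 + 3 * s + 3 * b + c"
      "P = n - d - s + c + b - 3 * s" "4 * s \<le> b" "4 * b \<le> c" for b c d z :: real
    proof -
      have "6 * P = 6 * n - 6 * d - 24 * s + 6 * c + 6 * b" using that(3) by simp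
      moreover have "c - s \<le> 2 * c - 2 * s - 2 * d + 2 * n" using that(1) by simp
      ultimately show ?thesis using that s4 by linarith
    qed
    ultimately have "(1 + s) ^ 3 \<le> 6 * P" using ss sss by blast
    then show ?thesis using 2 by simp
  next
    case 3
    have P: "P = n - n * s\<^sup>2 - s + s\<^sup>2 * s + s\<^sup>2 - 3 * s"
      by (simp add: P_def algebra_simps power2_eq_square)
    have "s + s\<^sup>2 \<le> 1 + 3 * s + 3 * s\<^sup>2 + s\<^sup>2 * s" using s by (auto intro: add_mono)
    also have "\<dots> = (1 + s) ^ 3" by (simp add: power3_eq_cube power2_eq_square algebra_simps)
    finally have "(n + 4) * (s + s\<^sup>2) \<le> (n + 4) * (1 + s) ^ 3" using n by (intro mult_left_mono) auto
    moreover have "(n + 4) * (s + s\<^sup>2) = n * s + n * s\<^sup>2 + 4 * s + 4 * s\<^sup>2"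
      by (simp add: algebra_simps)
    moreover have "0 \<le> n * s" "0 \<le> s\<^sup>2" "0 \<le> s\<^sup>2 * s" using n s by auto
    moreover have "- z \<le> P" if "e \<le> z" "e = c + h + 4 * s + 4 * b" "0 \<le> c" "0 \<le> b" "0 \<le> d"
        "P = n - h - s + d + b - 3 * s" for b c d e h z
      using that n s by linarith
    ultimately have "- ((n + 4) * (1 + s) ^ 3) \<le> P" using P by blast
    moreover have "(1 / 6 - (n + 5) * 1) * (1 + s) ^ 3 \<le> - (n + 4) * (1 + s) ^ 3"
      using pos by (intro mult_right_mono) auto
    moreover have "indicator {1 / 4..<2 * n} s = (1 :: real)" using 3 by simp
    ultimately show ?thesis by (simp only: mult_minus_left)
  qed
  then show ?thesis unfolding eq pos_le_divide_eq[OF pos] .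
qed

text \<open>The vector field is \<open>x w(x) \<theta>(k r\<^sup>\<sigma>)\<close> with \<open>\<theta> s = (1 - s) / (1 + s)\<^sup>2\<close>; the sign change of \<open>\<theta>\<close> makes
  its divergence at least \<open>\<sigma> w / 6\<close> both near the origin and near infinity, and the ball
  inequality takes care of the shell in between.\<close>
lemma weighted_median_poincare:
  fixes q f :: "'a::euclidean_space \<Rightarrow> real" and q' :: "'a \<Rightarrow> 'a" and \<sigma> \<eta> k m :: real
  defines "n \<equiv> real DIM('a)"
  defines "w \<equiv> \<lambda>x::'a. norm x powr (- \<eta>) * exp (- (k * norm x powr \<sigma>))"
  defines "R \<equiv> (2 * n / k) powr (1 / \<sigma>)"
  assumes n2: "2 \<le> DIM('a)" and \<sigma>: "0 < \<sigma>" "\<sigma> \<le> 1" and \<eta>: "0 \<le> \<eta>" "n - \<eta> = n * \<sigma>" and k: "0 < k"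
    and der: "\<And>x. GDERIV q x :> q' x" and cont: "continuous_on UNIV q'"
    and f: "continuous_on UNIV f" and vanish: "\<And>x. f x = m \<Longrightarrow> q x = 0" and q0: "\<And>x. 0 \<le> q x"
    and Q: "\<And>x. q x \<le> Q" "\<And>x. norm x * norm (q' x) \<le> Q"
    and le: "measure lborel (ball (0::'a) R) / 2 \<le> measure lborel {x \<in> ball 0 R. f x \<le> m}"
    and ge: "measure lborel (ball (0::'a) R) / 2 \<le> measure lborel {x \<in> ball 0 R. m \<le> f x}"
  shows "integrable lborel (\<lambda>x. q x * w x)"
    and "integrable lborel (\<lambda>x. norm x powr (1 - \<sigma>) * norm (q' x) * w x)"
    and "(\<integral>x. q x * w x \<partial>lborel)
      \<le> (6 / \<sigma> + 6 * (n + 5) * (8 * 2 ^ DIM('a)) * exp (2 * n) * (8 * n) powr (\<eta> / \<sigma>) * (2 * n)) / k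
        * (\<integral>x. norm x powr (1 - \<sigma>) * norm (q' x) * w x \<partial>lborel)"
proof -
  have n: "2 \<le> n" using n2 by (simp add: n_def)
  have R: "0 < R" using n k by (simp add: R_def)
  have Q0: "0 \<le> Q" using q0 Q(1) order_trans by blast
  have \<eta>n: "\<eta> < n" using \<eta> \<sigma> n mult_pos_pos[of n \<sigma>] by linarith
  \<comment> \<open>The bound on \<open>norm x * norm (q' x)\<close> dominates the gradient
    integrand by a weight with singularity \<open>norm x powr (- (\<sigma> + \<eta>))\<close>, which
    is integrable because of this strict inequality.\<close>
  have "n * \<sigma> - \<sigma> = (n - 1) * \<sigma>" by (simp add: algebra_simps)
  moreover have "0 < (n - 1) * \<sigma>" using n \<sigma> by simp
  ultimately have \<sigma>\<eta>n: "\<sigma> + \<eta> < n" using \<eta> by linarith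
  have [measurable]: "(\<lambda>x::'a. norm x powr r) \<in> borel_measurable borel" for r
    by (rule powr_real_measurable) auto
  have [measurable]: "q' \<in> borel_measurable borel" using cont by (rule borel_measurable_continuous_onI)
  have cq: "continuous_on UNIV q"
    using der by (auto simp: gderiv_def continuous_on_eq_continuous_at intro: has_derivative_continuous)
  then have [measurable]: "q \<in> borel_measurable borel" by (rule borel_measurable_continuous_onI)
  have wm [measurable]: "w \<in> borel_measurable borel" unfolding w_def by measurable
  have w0: "0 \<le> w x" for x by (simp add: w_def)
  have iw: "integrable lborel w"
    unfolding w_def by (rule integrable_norm_powr_exp) (use \<eta> \<eta>n k \<sigma> in \<open>auto simp: n_def\<close>)
  have bdd_int: "integrable lborel (\<lambda>x. h x * w x)"
    if [measurable]: "h \<in> borel_measurable borel" and "\<And>x. \<bar>h x\<bar> \<le> c" for h :: "'a \<Rightarrow> real" and c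
  proof (rule Bochner_Integration.integrable_bound)
    show "integrable lborel (\<lambda>x. c * w x)" using iw by simp
    have "\<bar>h x\<bar> * w x \<le> c * w x" for x using that(2) w0 by (intro mult_right_mono) auto
    moreover have "0 \<le> c * w x" for x using that(2)[of x] w0[of x] by (intro mult_nonneg_nonneg) auto
    ultimately show "AE x in lborel. norm (h x * w x) \<le> norm (c * w x)"
      using w0 by (intro AE_I2) (metis abs_mult abs_of_nonneg real_norm_def)
  qed measurable
  show iqw: "integrable lborel (\<lambda>x. q x * w x)"
    by (rule bdd_int[where c = Q]) (use Q q0 in auto)
  show iE: "integrable lborel (\<lambda>x. norm x powr (1 - \<sigma>) * norm (q' x) * w x)"
  proof (rule Bochner_Integration.integrable_bound)
    show "integrable lborel (\<lambda>x::'a. Q * (norm x powr (- (\<sigma> + \<eta>)) * exp (- (k * norm x powr \<sigma>))))"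
      by (intro integrable_mult_right integrable_norm_powr_exp) (use \<sigma>\<eta>n k \<sigma> \<eta> in \<open>auto simp: n_def\<close>)
    have "norm x powr (1 - \<sigma>) * norm (q' x) * w x \<le> Q * (norm x powr (- (\<sigma> + \<eta>)) * exp (- (k * norm x powr \<sigma>)))" for x
    proof (cases "x = 0")
      case False
      have "norm x powr (1 - \<sigma>) * norm (q' x) * w x
          = norm x * norm (q' x) * (norm x powr (- (\<sigma> + \<eta>)) * exp (- (k * norm x powr \<sigma>)))"
        using False by (simp add: w_def powr_diff powr_add powr_minus field_simps)
      also have "\<dots> \<le> Q * (norm x powr (- (\<sigma> + \<eta>)) * exp (- (k * norm x powr \<sigma>)))"
        using Q(2) by (intro mult_right_mono) auto
      finally show ?thesis .
    qed (use Q0 in auto)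
    then show "AE x in lborel. norm (norm x powr (1 - \<sigma>) * norm (q' x) * w x)
        \<le> norm (Q * (norm x powr (- (\<sigma> + \<eta>)) * exp (- (k * norm x powr \<sigma>))))"
      using Q0 w0 by (intro AE_I2) (simp add: abs_mult)
  qed measurable
  define E where "E = (\<integral>x. norm x powr (1 - \<sigma>) * norm (q' x) * w x \<partial>lborel)"
  have E0: "0 \<le> E" unfolding E_def using w0 by (intro integral_nonneg_AE) auto

  define s where "s r = k * r powr \<sigma>" for r
  define \<theta> where "\<theta> t = (1 - t) / (1 + t)\<^sup>2" for t :: real
  define \<theta>' where "\<theta>' t = (t - 3) / (1 + t) ^ 3" for t :: real
  define M where "M t = (n - t) * \<theta> t + t * \<theta>' t" for t
  define \<psi> where "\<psi> r = r powr (- \<eta>) * exp (- s r) * \<theta> (s r)" for r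
  define \<psi>' where "\<psi>' r = r powr (- \<eta>) * exp (- s r) * (- \<eta> * \<theta> (s r) - \<sigma> * s r * \<theta> (s r) + \<sigma> * s r * \<theta>' (s r)) / r" for r
  have s0: "0 \<le> s r" for r using k by (simp add: s_def)
  have \<theta>_le: "\<bar>\<theta> t\<bar> \<le> 1" "\<bar>t * \<theta> t\<bar> \<le> 1" "\<bar>t * \<theta>' t\<bar> \<le> 3" if "0 \<le> t" for t
  proof -
    have "\<bar>1 - t\<bar> \<le> 1 * (1 + t)\<^sup>2" "\<bar>t * (1 - t)\<bar> \<le> 1 * (1 + t)\<^sup>2"
      using that by (auto simp: abs_if power2_eq_square algebra_simps add_increasing)
    then show "\<bar>\<theta> t\<bar> \<le> 1" "\<bar>t * \<theta> t\<bar> \<le> 1"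
      using that by (simp_all add: \<theta>_def abs_mult pos_divide_le_eq)
    have "0 \<le> t * t" "0 \<le> t * (t * t)" using that by auto
    then have "\<bar>t * (t - 3)\<bar> \<le> 3 * (1 + t) ^ 3"
      using that by (auto simp: abs_le_iff power3_eq_cube algebra_simps)
    then show "\<bar>t * \<theta>' t\<bar> \<le> 3"
      using that by (simp add: \<theta>'_def abs_mult pos_divide_le_eq)
  qed
  have M_le: "\<bar>M t\<bar> \<le> n + 4" if "0 \<le> t" for t
  proof -
    have "\<bar>n * \<theta> t\<bar> \<le> n" using \<theta>_le(1)[OF that] n by (simp add: abs_mult mult_left_le)
    then show ?thesis using \<theta>_le[OF that] by (simp add: M_def algebra_simps)
  qed
  have d\<psi>: "DERIV \<psi> r :> \<psi>' r" if r: "0 < r" for r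
  proof -
    have ds: "DERIV s r :> \<sigma> * s r / r"
      unfolding s_def using r by (auto intro!: derivative_eq_intros simp: powr_diff)
    have d\<theta>: "DERIV \<theta> t :> \<theta>' t" if "0 \<le> t" for t
    proof -
      have t1: "1 + t \<noteq> 0" using that by linarith
      have "DERIV \<theta> t :> (- 1 * (1 + t)\<^sup>2 - (1 - t) * (2 * (1 + t))) / ((1 + t)\<^sup>2 * (1 + t)\<^sup>2)"
        unfolding \<theta>_def using t1 by (auto intro!: derivative_eq_intros simp: power2_eq_square)
      also have "- 1 * (1 + t)\<^sup>2 - (1 - t) * (2 * (1 + t)) = (1 + t) * (t - 3)"
        by (simp add: power2_eq_square algebra_simps)
      also have "(1 + t) * (t - 3) / ((1 + t)\<^sup>2 * (1 + t)\<^sup>2) = \<theta>' t"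
        using t1 by (simp add: \<theta>'_def power2_eq_square power3_eq_cube)
      finally show ?thesis .
    qed
    have "DERIV (\<lambda>r. \<theta> (s r)) r :> \<theta>' (s r) * (\<sigma> * s r / r)"
      using DERIV_chain2[OF d\<theta>[OF s0] ds] .
    moreover have "DERIV (\<lambda>r. r powr (- \<eta>)) r :> - \<eta> * r powr (- \<eta>) / r"
      using r by (auto intro!: derivative_eq_intros simp: powr_diff)
    moreover have "DERIV (\<lambda>r. exp (- s r)) r :> exp (- s r) * - (\<sigma> * s r / r)"
      by (intro DERIV_fun_exp DERIV_minus ds)
    ultimately have "DERIV (\<lambda>r. (r powr (- \<eta>) * exp (- s r)) * \<theta> (s r)) r :>
        (- \<eta> * r powr (- \<eta>) / r * exp (- s r) + exp (- s r) * - (\<sigma> * s r / r) * r powr (- \<eta>)) * \<theta> (s r)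
        + \<theta>' (s r) * (\<sigma> * s r / r) * (r powr (- \<eta>) * exp (- s r))"
      by (intro DERIV_mult)
    then show ?thesis
      unfolding \<psi>_def[abs_def] \<psi>'_def
      by (rule DERIV_cong) (simp add: add_divide_distrib diff_divide_distrib algebra_simps)
  qed
  define F where "F x = q x * \<psi> (norm x)" for x
  define F' where "F' x = q x *\<^sub>R (\<psi>' (norm x) *\<^sub>R sgn x) + \<psi> (norm x) *\<^sub>R q' x" for x
  have dF: "GDERIV F x :> F' x" if "x \<noteq> 0" for x
    unfolding F_def F'_def
    using that by (intro GDERIV_mult der GDERIV_DERIV_compose[OF GDERIV_norm d\<psi>]) auto
  have cs: "continuous_on (- {0}) (\<lambda>x::'a. s (norm x))"
    unfolding s_def by (intro continuous_intros) auto
  have nz: "1 + s r \<noteq> 0" for r using s0[of r] by linarith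
  have "continuous_on (- {0}) (\<lambda>x::'a. \<psi> (norm x))" "continuous_on (- {0}) (\<lambda>x::'a. \<psi>' (norm x))"
    unfolding \<psi>_def \<psi>'_def \<theta>_def \<theta>'_def using nz
    by (intro continuous_intros cs; simp)+
  then have cF': "continuous_on (- {0}) F'"
    unfolding F'_def sgn_div_norm
    using continuous_on_subset[OF cq] continuous_on_subset[OF cont] by (intro continuous_intros) auto
  have [measurable]: "s \<in> borel_measurable borel" unfolding s_def[abs_def] by measurable
  have [measurable]: "\<theta> \<in> borel_measurable borel" "\<theta>' \<in> borel_measurable borel"
    unfolding \<theta>_def[abs_def] \<theta>'_def[abs_def] by measurable
  have [measurable]: "M \<in> borel_measurable borel" unfolding M_def[abs_def] by measurable
  have Feq: "F x = (q x * \<theta> (s (norm x))) * w x" for x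
    by (simp add: F_def \<psi>_def w_def s_def)
  have iF: "integrable lborel F"
    unfolding Feq[abs_def]
  proof (rule bdd_int[where c = Q])
    fix x
    have "\<bar>q x\<bar> * \<bar>\<theta> (s (norm x))\<bar> \<le> Q * 1"
      using \<theta>_le(1)[OF s0] Q q0 Q0 by (intro mult_mono) auto
    then show "\<bar>q x * \<theta> (s (norm x))\<bar> \<le> Q" by (simp add: abs_mult)
  qed measurable
  \<comment> \<open>Here \<open>n - \<eta> = n * \<sigma>\<close> matters: the dimension and the
    power in the weight together contribute \<open>n * \<sigma>\<close> times
    \<open>\<theta>\<close>, so \<sigma> factors out of all terms containing \<open>q x\<close> and
    leaves the multiplier \<open>M\<close>.\<close>
  have div_eq: "DIM('a) * F x + x \<bullet> F' x
      = (\<sigma> * q x * M (s (norm x))) * w x + \<theta> (s (norm x)) * (x \<bullet> q' x) * w x" for x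
  proof (cases "x = 0")
    case False
    have "x \<bullet> sgn x = norm x"
      using False by (simp add: sgn_div_norm power2_norm_eq_inner[symmetric] power2_eq_square)
    then have "x \<bullet> F' x = q x * (norm x * \<psi>' (norm x)) + \<psi> (norm x) * (x \<bullet> q' x)"
      by (simp add: F'_def inner_add_right)
    moreover have "norm x * \<psi>' (norm x) = w x * (- \<eta> * \<theta> (s (norm x)) - \<sigma> * s (norm x) * \<theta> (s (norm x)) + \<sigma> * s (norm x) * \<theta>' (s (norm x)))"
      using False by (simp add: \<psi>'_def w_def s_def)
    moreover have "\<psi> (norm x) = w x * \<theta> (s (norm x))" by (simp add: \<psi>_def w_def s_def)
    moreover have "\<eta> = n - n * \<sigma>" using \<eta> by simp
    ultimately show ?thesis
      by (simp add: F_def M_def n_def algebra_simps)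
  qed (simp add: F_def F'_def \<psi>_def w_def)
  have i1: "integrable lborel (\<lambda>x. (\<sigma> * q x * M (s (norm x))) * w x)"
  proof (rule bdd_int[where c = "Q * (n + 4)"])
    fix x
    have "\<sigma> * q x \<le> 1 * Q" using \<sigma> q0 Q by (intro mult_mono) auto
    then show "\<bar>\<sigma> * q x * M (s (norm x))\<bar> \<le> Q * (n + 4)"
      using M_le[OF s0] \<sigma> q0[of x] Q0 by (auto simp: abs_mult intro!: mult_mono)
  qed measurable
  have i2: "integrable lborel (\<lambda>x. \<theta> (s (norm x)) * (x \<bullet> q' x) * w x)"
  proof (rule bdd_int[where c = Q])
    fix x
    have "\<bar>\<theta> (s (norm x))\<bar> * \<bar>x \<bullet> q' x\<bar> \<le> 1 * Q"
      using \<theta>_le(1)[OF s0] Cauchy_Schwarz_ineq2[of x "q' x"] Q(2)[of x] by (intro mult_mono) auto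
    then show "\<bar>\<theta> (s (norm x)) * (x \<bullet> q' x)\<bar> \<le> Q" by (simp add: abs_mult)
  qed measurable
  have "(\<integral>x. DIM('a) * F x + x \<bullet> F' x \<partial>lborel) = 0"
  proof (rule integral_radial_divergence_eq_0[OF dF cF' iF])
    show "integrable lborel (\<lambda>x. DIM('a) * F x + x \<bullet> F' x)"
      unfolding div_eq using i1 i2 by (rule Bochner_Integration.integrable_add)
  qed auto
  then have ibp: "(\<integral>x. (\<sigma> * q x * M (s (norm x))) * w x \<partial>lborel) = - (\<integral>x. \<theta> (s (norm x)) * (x \<bullet> q' x) * w x \<partial>lborel)"
    unfolding div_eq using i1 i2 by (simp add: Bochner_Integration.integral_add)
  have "- (\<integral>x. \<theta> (s (norm x)) * (x \<bullet> q' x) * w x \<partial>lborel) = (\<integral>x. - (\<theta> (s (norm x)) * (x \<bullet> q' x) * w x) \<partial>lborel)"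
    by simp
  \<comment> \<open>Writing \<open>norm x\<close> as
    \<open>norm x powr (1 - \<sigma>) * (s (norm x) / k)\<close> and using
    \<open>\<bar>t * \<theta> t\<bar> \<le> 1\<close> trades the growth of the field for the factor
    \<open>1 / k\<close>.\<close>
  also have "\<dots> \<le> (\<integral>x. 1 / k * (norm x powr (1 - \<sigma>) * norm (q' x) * w x) \<partial>lborel)"
  proof (rule integral_mono)
    fix x :: 'a
    show "- (\<theta> (s (norm x)) * (x \<bullet> q' x) * w x) \<le> 1 / k * (norm x powr (1 - \<sigma>) * norm (q' x) * w x)"
    proof (cases "x = 0")
      case False
      have "- (\<theta> (s (norm x)) * (x \<bullet> q' x)) \<le> \<bar>\<theta> (s (norm x))\<bar> * (norm x * norm (q' x))"
      proof -
        have "- (\<theta> (s (norm x)) * (x \<bullet> q' x)) \<le> \<bar>\<theta> (s (norm x))\<bar> * \<bar>x \<bullet> q' x\<bar>"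
          unfolding abs_mult[symmetric] by (rule abs_ge_minus_self)
        also have "\<dots> \<le> \<bar>\<theta> (s (norm x))\<bar> * (norm x * norm (q' x))"
          using Cauchy_Schwarz_ineq2[of x "q' x"] by (intro mult_left_mono) auto
        finally show ?thesis .
      qed
      also have "\<bar>\<theta> (s (norm x))\<bar> * (norm x * norm (q' x))
        = \<bar>\<theta> (s (norm x))\<bar> * (norm x powr (1 - \<sigma>) * (s (norm x) / k) * norm (q' x))"
        using False k by (simp add: s_def flip: powr_add)
      also have "\<dots> = \<bar>s (norm x) * \<theta> (s (norm x))\<bar> * (1 / k * (norm x powr (1 - \<sigma>) * norm (q' x)))"
        using s0[of "norm x"] by (simp add: abs_mult)
      also have "\<dots> \<le> 1 * (1 / k * (norm x powr (1 - \<sigma>) * norm (q' x)))"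
        using \<theta>_le(2)[OF s0] k by (intro mult_right_mono) auto
      finally have "- (\<theta> (s (norm x)) * (x \<bullet> q' x)) \<le> 1 * (1 / k * (norm x powr (1 - \<sigma>) * norm (q' x)))" .
      from mult_right_mono[OF this w0[of x]] show ?thesis
        by (simp only: mult_minus_left mult.assoc mult_1_left)
    qed (simp add: w_def)
  qed (use i2 iE in auto)
  also have "\<dots> = E / k" by (simp add: E_def)
  finally have upper: "(\<integral>x. (\<sigma> * q x * M (s (norm x))) * w x \<partial>lborel) \<le> E / k"
    using ibp by simp

  define S where "S x = indicat_real {1 / 4..<2 * n} (s (norm x))" for x :: 'a
  have [measurable]: "S \<in> borel_measurable borel" unfolding S_def[abs_def] by measurable
  have iS: "integrable lborel (\<lambda>x. (q x * S x) * w x)"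
    by (rule bdd_int[where c = Q]) (measurable, use Q q0 Q0 in \<open>auto simp: S_def indicator_def\<close>)
  have "\<sigma> / 6 * (\<integral>x. q x * w x \<partial>lborel) - \<sigma> * (n + 5) * (\<integral>x. (q x * S x) * w x \<partial>lborel)
      = (\<integral>x. \<sigma> / 6 * (q x * w x) - \<sigma> * (n + 5) * ((q x * S x) * w x) \<partial>lborel)"
    using iqw iS by simp
  also have "\<dots> \<le> (\<integral>x. (\<sigma> * q x * M (s (norm x))) * w x \<partial>lborel)"
  proof (rule integral_mono)
    fix x :: 'a
    have "1 / 6 - (n + 5) * S x \<le> M (s (norm x))"
      unfolding S_def M_def \<theta>_def \<theta>'_def by (rule radial_multiplier_lower_bound[OF n s0])
    then have "(\<sigma> * q x * w x) * (1 / 6 - (n + 5) * S x) \<le> (\<sigma> * q x * w x) * M (s (norm x))"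
      using \<sigma> q0 w0 by (intro mult_left_mono) auto
    then show "\<sigma> / 6 * (q x * w x) - \<sigma> * (n + 5) * ((q x * S x) * w x) \<le> (\<sigma> * q x * M (s (norm x))) * w x"
      by (simp add: algebra_simps)
  qed (use iqw iS i1 in auto)
  finally have lower: "\<sigma> / 6 * (\<integral>x. q x * w x \<partial>lborel) - \<sigma> * (n + 5) * (\<integral>x. (q x * S x) * w x \<partial>lborel) \<le> E / k"
    using upper by linarith

  \<comment> \<open>\<open>\<rho>\<close> and \<open>R\<close> are the radii at which
    \<open>s r\<close> equals 1/4 and 2n, the ends of the interval on which the multiplier may be
    negative. The bad region is thus a shell that lies in the ball of the median and stays away from
    the origin.\<close>
  define \<rho> where "\<rho> = (1 / (4 * k)) powr (1 / \<sigma>)"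
  have \<rho>: "0 < \<rho>" using k by (simp add: \<rho>_def)
  have \<rho>s: "\<rho> powr \<sigma> = 1 / (4 * k)" and Rs: "R powr \<sigma> = 2 * n / k"
    using k \<sigma> n by (simp_all add: \<rho>_def R_def powr_powr)
  have bridge: "r < R \<longleftrightarrow> s r < 2 * n" "\<rho> \<le> r \<longleftrightarrow> 1 / 4 \<le> s r" if "0 \<le> r" for r
  proof -
    have "r < R \<longleftrightarrow> r powr \<sigma> < R powr \<sigma>"
      using that R \<sigma> by (metis less_eq_real_def not_le powr_less_mono2 powr_mono2)
    then show "r < R \<longleftrightarrow> s r < 2 * n" using k by (simp add: Rs s_def field_simps)
    have "\<rho> \<le> r \<longleftrightarrow> \<rho> powr \<sigma> \<le> r powr \<sigma>"
      using that \<rho> \<sigma> by (metis less_eq_real_def not_le powr_less_mono2 powr_mono2)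
    then show "\<rho> \<le> r \<longleftrightarrow> 1 / 4 \<le> s r" using k by (simp add: \<rho>s s_def field_simps)
  qed
  \<comment> \<open>A bound on the ball for \<open>norm x powr (\<sigma> - 1) / w x\<close>, which
    is \<open>norm x powr (\<sigma> - 1 + \<eta>) * exp (s (norm x))\<close>. The exponent equals
    \<open>(n - 1) * (1 - \<sigma>)\<close> and is nonnegative, so the unweighted gradient is
    dominated up to the origin.\<close>
  define c where "c = R powr (\<sigma> - 1 + \<eta>) * exp (2 * n)"
  have c0: "0 \<le> c" by (simp add: c_def)
  have e1: "0 \<le> \<sigma> - 1 + \<eta>"
  proof -
    have "\<sigma> - 1 + \<eta> = (n - 1) * (1 - \<sigma>)" using \<eta> by (simp add: algebra_simps)
    then show ?thesis using n \<sigma> by simp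
  qed
  have "(\<integral>\<^sup>+x. ennreal (norm (q' x)) * indicator (ball 0 R) x \<partial>lborel)
      \<le> (\<integral>\<^sup>+x. ennreal (c * (norm x powr (1 - \<sigma>) * norm (q' x) * w x)) \<partial>lborel)"
  proof (rule nn_integral_mono_AE)
    have "AE x in lborel. x \<noteq> (0::'a)" by (rule AE_lborel_singleton)
    then show "AE x in lborel. ennreal (norm (q' x)) * indicator (ball 0 R) x
        \<le> ennreal (c * (norm x powr (1 - \<sigma>) * norm (q' x) * w x))"
    proof eventually_elim
      case (elim x)
      show ?case
      proof (cases "norm x < R")
        case True
        have x0: "0 < norm x" using elim by simp
        have "1 = norm x powr (\<sigma> - 1 + \<eta>) * exp (s (norm x)) * (norm x powr (1 - \<sigma>) * w x)"
        proof -
          have "norm x powr (\<sigma> - 1 + \<eta>) * (norm x powr (1 - \<sigma>) * norm x powr (- \<eta>)) = 1"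
            using x0 by (simp flip: powr_add)
          moreover have "exp (s (norm x)) * exp (- s (norm x)) = 1" by (simp flip: exp_add)
          moreover have "a * b * (c * (d * e)) = (a * (c * d)) * (b * e)" for a b c d e :: real
            by simp
          ultimately show ?thesis unfolding w_def s_def by (metis mult_1)
        qed
        also have "\<dots> \<le> c * (norm x powr (1 - \<sigma>) * w x)"
          unfolding c_def
        proof (intro mult_right_mono mult_mono)
          show "norm x powr (\<sigma> - 1 + \<eta>) \<le> R powr (\<sigma> - 1 + \<eta>)"
            using True e1 by (intro powr_mono2) auto
          show "exp (s (norm x)) \<le> exp (2 * n)" using bridge(1)[of "norm x"] True by simp
        qed (use w0 in auto)
        finally have "1 * norm (q' x) \<le> c * (norm x powr (1 - \<sigma>) * w x) * norm (q' x)"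
          by (intro mult_right_mono) auto
        then show ?thesis using True by (auto intro!: ennreal_leI simp: mult_ac)
      qed simp
    qed
  qed
  also have "\<dots> = ennreal (c * E)"
    unfolding E_def using iE c0 w0
    by (subst nn_integral_eq_integral) (auto intro!: mult_nonneg_nonneg)
  finally have gb: "(\<integral>\<^sup>+x. ennreal (norm (q' x)) * indicator (ball 0 R) x \<partial>lborel) \<le> ennreal (c * E)" .
  have "ennreal (\<integral>x. (q x * S x) * w x \<partial>lborel) = (\<integral>\<^sup>+x. ennreal ((q x * S x) * w x) \<partial>lborel)"
    using iS q0 w0 by (intro nn_integral_eq_integral[symmetric]) (auto simp: S_def)
  also have "\<dots> \<le> (\<integral>\<^sup>+x. ennreal (\<rho> powr (- \<eta>)) * (ennreal \<bar>q x\<bar> * indicator (ball 0 R) x) \<partial>lborel)"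
  proof (rule nn_integral_mono)
    fix x :: 'a
    show "ennreal ((q x * S x) * w x) \<le> ennreal (\<rho> powr (- \<eta>)) * (ennreal \<bar>q x\<bar> * indicator (ball 0 R) x)"
    proof (cases "1 / 4 \<le> s (norm x) \<and> s (norm x) < 2 * n")
      case True
      then have r: "\<rho> \<le> norm x" "norm x < R" using bridge[of "norm x"] by auto
      have "norm x powr (- \<eta>) \<le> \<rho> powr (- \<eta>)" using r \<rho> \<eta> by (intro powr_mono2') auto
      moreover have "exp (- s (norm x)) \<le> 1" using s0 by simp
      ultimately have "w x \<le> \<rho> powr (- \<eta>) * 1"
        unfolding w_def s_def by (intro mult_mono) auto
      then have "q x * w x \<le> q x * \<rho> powr (- \<eta>)" using q0 by (intro mult_left_mono) auto
      then show ?thesis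
        using True r q0[of x] by (auto simp: S_def mult.commute intro!: ennreal_leI simp flip: ennreal_mult)
    qed (auto simp: S_def)
  qed
  also have "\<dots> = ennreal (\<rho> powr (- \<eta>)) * (\<integral>\<^sup>+x. ennreal \<bar>q x\<bar> * indicator (ball 0 R) x \<partial>lborel)"
    by (rule nn_integral_cmult) (intro borel_measurable_times_ennreal borel_measurable_indicator, simp_all)
  also have "\<dots> \<le> ennreal (\<rho> powr (- \<eta>)) * (ennreal (8 * 2 ^ DIM('a) * R)
      * (\<integral>\<^sup>+x. ennreal (norm (q' x)) * indicator (ball 0 R) x \<partial>lborel))"
    by (intro mult_left_mono ball_median_poincare[OF der cont f vanish R le ge]) auto
  also have "\<dots> \<le> ennreal (\<rho> powr (- \<eta>)) * (ennreal (8 * 2 ^ DIM('a) * R) * ennreal (c * E))"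
    using gb by (intro mult_left_mono) auto
  also have "\<dots>
      = ennreal (\<rho> powr (- \<eta>) * (8 * 2 ^ DIM('a) * R * (c * E)))"
    using R c0 E0 by (subst ennreal_mult[symmetric]; simp)+
  finally have "(\<integral>x. (q x * S x) * w x \<partial>lborel) \<le> \<rho> powr (- \<eta>) * (8 * 2 ^ DIM('a) * R * (c * E))"
    using R c0 E0 by (subst (asm) ennreal_le_iff) auto
  also have "\<dots> = 8 * 2 ^ DIM('a) * exp (2 * n) * (\<rho> powr (- \<eta>) * (R * R powr (\<sigma> - 1 + \<eta>))) * E"
    by (simp add: c_def)
  \<comment> \<open>The factors \<open>(4 * k) powr (\<eta> / \<sigma>)\<close> and
    \<open>(2 * n / k) powr (\<eta> / \<sigma>)\<close> cancel in \<open>k\<close>. Only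
    \<open>1 / k\<close> survives, exactly as in the divergence estimate; this makes the constant
    scale correctly.\<close>
  also have "\<rho> powr (- \<eta>) * (R * R powr (\<sigma> - 1 + \<eta>)) = (8 * n) powr (\<eta> / \<sigma>) * (2 * n / k)"
  proof -
    have "R * R powr (\<sigma> - 1 + \<eta>) = R powr \<eta> * R powr \<sigma>"
      using R by (simp add: powr_add powr_diff)
    moreover have "\<rho> powr (- \<eta>) = (4 * k) powr (\<eta> / \<sigma>)"
      using k by (simp add: \<rho>_def powr_powr powr_divide powr_minus_divide)
    moreover have "R powr \<eta> = (2 * n / k) powr (\<eta> / \<sigma>)"
      by (simp add: R_def powr_powr)
    moreover have "(4 * k) powr (\<eta> / \<sigma>) * (2 * n / k) powr (\<eta> / \<sigma>) = (8 * n) powr (\<eta> / \<sigma>)"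
      using k n by (simp flip: powr_mult)
    ultimately show ?thesis by (simp add: Rs mult.assoc[symmetric])
  qed
  finally have shell: "(\<integral>x. (q x * S x) * w x \<partial>lborel)
      \<le> 8 * 2 ^ DIM('a) * exp (2 * n) * ((8 * n) powr (\<eta> / \<sigma>) * (2 * n / k)) * E" .
  have "\<sigma> * (n + 5) * (\<integral>x. (q x * S x) * w x \<partial>lborel)
     \<le> \<sigma> * (n + 5) * (8 * 2 ^ DIM('a) * exp (2 * n) * ((8 * n) powr (\<eta> / \<sigma>) * (2 * n / k)) * E)"
    using shell \<sigma> n by (intro mult_left_mono) auto
  with lower have "\<sigma> / 6 * (\<integral>x. q x * w x \<partial>lborel)
     \<le> E / k + \<sigma> * (n + 5) * (8 * 2 ^ DIM('a) * exp (2 * n) * ((8 * n) powr (\<eta> / \<sigma>) * (2 * n / k)) * E)"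
    by linarith
  then have "6 / \<sigma> * (\<sigma> / 6 * (\<integral>x. q x * w x \<partial>lborel))
     \<le> 6 / \<sigma> * (E / k + \<sigma> * (n + 5) * (8 * 2 ^ DIM('a) * exp (2 * n) * ((8 * n) powr (\<eta> / \<sigma>) * (2 * n / k)) * E))"
    using \<sigma> by (intro mult_left_mono) auto
  also have "\<dots> = (6 / \<sigma> + 6 * (n + 5) * (8 * 2 ^ DIM('a)) * exp (2 * n) * (8 * n) powr (\<eta> / \<sigma>) * (2 * n)) / k * E"
    using \<sigma> k by (simp add: field_simps)
  finally show "(\<integral>x. q x * w x \<partial>lborel)
      \<le> (6 / \<sigma> + 6 * (n + 5) * (8 * 2 ^ DIM('a)) * exp (2 * n) * (8 * n) powr (\<eta> / \<sigma>) * (2 * n)) / k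
        * (\<integral>x. norm x powr (1 - \<sigma>) * norm (q' x) * w x \<partial>lborel)"
    using \<sigma> by (simp add: E_def)
qed

section \<open>Test functions\<close>

text \<open>All that the estimates use of a test function: a gradient that is continuous on the
  whole space, and vanishing of \<open>u\<close> and of the gradient near the origin and near
  infinity. Since \<open>grad\<close> is built from partial derivatives, differentiability is needed
  to identify it with the full derivative.\<close>

lemma C0_infty_gradient:
  fixes u :: "real ^ 'n \<Rightarrow> real"
  assumes u: "u \<in> C0_infty (- {0})"
  obtains \<rho> R where "0 < \<rho>"
    and "\<And>x. norm x < \<rho> \<or> R < norm x \<Longrightarrow> u x = 0"
    and "\<And>x. norm x < \<rho> \<or> R < norm x \<Longrightarrow> grad u x = 0"
    and "\<And>x. GDERIV u x :> grad u x"
    and "continuous_on UNIV (grad u)"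
proof -
  define K where "K = closure (support_on UNIV u)"
  have K: "compact K" "0 \<notin> K" and sm: "smooth_on u (- {0})"
    using u by (auto simp: C0_infty_def K_def)
  have oK: "open (- K)" using K(1) by (simp add: open_Compl compact_imp_closed)
  have uK: "u x = 0" if "x \<in> - K" for x
    using that closure_subset[of "support_on UNIV u"] by (auto simp: K_def in_support_on)
  have dK: "(u has_derivative (\<lambda>_. 0)) (at x)" if "x \<in> - K" for x
    by (rule has_derivative_transform_within_open[OF has_derivative_const[of 0] oK that])
       (simp add: uK)
  have gK: "grad u x = 0" if "x \<in> - K" for x
    using frechet_derivative_at[OF dK[OF that]] by (simp add: grad_def vec_eq_iff fun_eq_iff)
  have diff: "u differentiable (at x)" if "x \<noteq> 0" for x
    using sm that Ck_on.simps(2)[of 0 u "- {0}"] unfolding smooth_on_def by blast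
  have gd: "GDERIV u x :> grad u x" for x
  proof (cases "x = 0")
    case True
    then show ?thesis using dK[of x] gK[of x] K by (simp add: gderiv_def)
  next
    case False
    let ?D = "frechet_derivative u (at x)"
    have D: "(u has_derivative ?D) (at x)"
      using diff[OF False] by (simp add: frechet_derivative_works)
    then have lin: "linear ?D" by (rule has_derivative_linear)
    have "?D v = v \<bullet> grad u x" for v
    proof -
      have "?D v = ?D (\<Sum>i\<in>UNIV. (v $ i) *\<^sub>R axis i 1)"
        using basis_expansion[of v] by (simp add: scalar_mult_eq_scaleR)
      also have "\<dots> = (\<Sum>i\<in>UNIV. v $ i * ?D (axis i 1))"
        using lin by (simp add: linear_sum linear_scale)
      also have "\<dots> = v \<bullet> grad u x" by (simp add: grad_def inner_vec_def)
      finally show ?thesis .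
    qed
    then have "?D = (\<lambda>v. v \<bullet> grad u x)" by blast
    with D show ?thesis by (simp add: gderiv_def)
  qed
  have "continuous_on (- {0}) (grad u)"
    unfolding grad_def
  proof (rule continuous_on_vec_lambda)
    fix i :: 'n
    have "Ck_on (Suc 0) u (- {0})" using sm by (simp only: smooth_on_def)
    then show "continuous_on (- {0}) (\<lambda>x. frechet_derivative u (at x) (axis i 1))" by simp
  qed
  moreover have "continuous_on (- K) (grad u)"
    using continuous_on_eq[of "- K" "\<lambda>_. 0" "grad u"] gK by simp
  moreover have "open (- {0 :: real ^ 'n})" by (simp add: open_Compl)
  \<comment> \<open>Smoothness gives continuity off the origin, vanishing gives it off the support;
    as the origin is not in the support, the two open sets cover the space.\<close>
  ultimately have "continuous_on (- {0} \<union> - K) (grad u)"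
    using oK by (intro continuous_on_open_Un)
  moreover have "- {0} \<union> - K = UNIV" using K by auto
  ultimately have cont: "continuous_on UNIV (grad u)" by simp
  obtain \<rho> where \<rho>: "0 < \<rho>" "ball 0 \<rho> \<subseteq> - K" using oK K(2) by (auto simp: open_contains_ball)
  obtain R where R: "\<And>x. x \<in> K \<Longrightarrow> norm x \<le> R" using compact_imp_bounded[OF K(1)] by (auto simp: bounded_iff)
  have out: "x \<in> - K" if "norm x < \<rho> \<or> R < norm x" for x
    using that \<rho>(2) R[of x] by (auto simp: subset_iff)
  show ?thesis
    by (rule that[of \<rho> R]) (use \<rho> out uK gK gd cont in auto)
qed

lemma integrable_annulus_support:
  fixes h :: "'a::euclidean_space \<Rightarrow> real"
  assumes h: "continuous_on (- {0}) h" and \<rho>: "0 < \<rho>"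
    and zero: "\<And>x. norm x < \<rho> \<or> R < norm x \<Longrightarrow> h x = 0"
  shows "integrable lborel h"
proof -
  let ?S = "cball (0::'a) R - ball 0 \<rho>"
  have S: "compact ?S" by (intro compact_diff) auto
  have "continuous_on ?S h" using h \<rho> by (rule_tac continuous_on_subset) auto
  then have "integrable lborel (\<lambda>x. indicator ?S x *\<^sub>R h x)"
    by (rule borel_integrable_compact[OF S])
  moreover have "(\<lambda>x. indicator ?S x *\<^sub>R h x) = h"
  proof
    fix x
    have "\<rho> \<le> norm x \<and> norm x \<le> R \<or> h x = 0" using zero by (meson not_le)
    then show "indicator ?S x *\<^sub>R h x = h x" by (auto simp: indicator_def)
  qed
  ultimately show ?thesis by simp
qed

text \<open>A nonempty open set is not negligible, so the function cannot differ from 0 at a point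
  of \<open>S\<close>. Continuity is asked for on an open set only, because the weighted integrands
  may be singular at the origin.\<close>

lemma continuous_eq_0_of_integral_eq_0:
  fixes h :: "'a::euclidean_space \<Rightarrow> real"
  assumes i: "integrable lborel h" and "(\<integral>x. h x \<partial>lborel) = 0" and pos: "\<And>x. 0 \<le> h x"
    and S: "open S" "continuous_on S h" "x \<in> S"
  shows "h x = 0"
proof (rule ccontr)
  assume "h x \<noteq> 0"
  define T where "T = {y \<in> S. h y \<in> - {0}}"
  have oT: "open T" unfolding T_def
    using S by (intro continuous_open_preimage[unfolded vimage_def Int_def mem_Collect_eq]) (auto simp: open_Compl)
  have "x \<in> T" using \<open>h x \<noteq> 0\<close> S by (simp add: T_def)
  then have "\<not> negligible T" using open_not_negligible[OF oT] by blast
  moreover have "AE y in lborel. h y = 0"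
    using integral_nonneg_eq_0_iff_AE[OF i] pos assms(2) by simp
  then obtain Z where "{y \<in> space lborel. h y \<noteq> 0} \<subseteq> Z" "Z \<in> null_sets lborel"
    by (auto simp: eventually_ae_filter)
  moreover from this have "negligible Z"
    by (simp add: negligible_iff_null_sets null_sets_completionI)
  ultimately show False
    using negligible_subset[of Z T] by (auto simp: T_def)
qed

text \<open>The signed power is a difference of powers, with positive exponent \<open>e + 1\<close>,
  of the positive and negative parts. This removes the singular factor at zeros of \<open>f\<close>
  for negative \<open>e\<close> such as \<open>p - 2\<close>.\<close>

lemma continuous_on_signed_powr:
  fixes f :: "'a::topological_space \<Rightarrow> real"
  assumes "continuous_on S f" and "-1 < e"
  shows "continuous_on S (\<lambda>x. \<bar>f x\<bar> powr e * f x)"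
proof -
  have eq: "\<bar>t\<bar> powr e * t = max t 0 powr (e + 1) - max (- t) 0 powr (e + 1)" for t :: real
    by (cases "0 < t"; cases "t = 0") (auto simp: powr_add max_def)
  show ?thesis
    unfolding eq using assms by (intro continuous_on_diff continuous_on_powr' continuous_intros) auto
qed

section \<open>Stability\<close>

context
  fixes u :: "'a::euclidean_space \<Rightarrow> real" and u' :: "'a \<Rightarrow> 'a" and \<rho> R p :: real
  assumes gu: "\<And>x. GDERIV u x :> u' x" and continuous_on_base': "continuous_on UNIV u'" and \<rho>: "0 < \<rho>"
    and u0: "\<And>x. norm x < \<rho> \<or> R < norm x \<Longrightarrow> u x = 0"
    and u'0: "\<And>x. norm x < \<rho> \<or> R < norm x \<Longrightarrow> u' x = 0"
    and p: "1 < p" "p < 2"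
begin

lemma continuous_on_base: "continuous_on S u"
proof -
  have "continuous_on UNIV u"
    using gu by (auto simp: gderiv_def continuous_on_eq_continuous_at intro: has_derivative_continuous)
  then show ?thesis by (rule continuous_on_subset) simp
qed

lemma continuous_on_weighted_powr:
  fixes c :: real
  shows "continuous_on (- {0}) (\<lambda>x. \<bar>u x\<bar> powr p / norm x powr c)"
    and "continuous_on (- {0}) (\<lambda>x. norm (u' x) powr p / norm x powr c)"
proof -
  have 1: "continuous_on (- {0}) (\<lambda>x. \<bar>u x\<bar> powr p)" "continuous_on (- {0}) (\<lambda>x. norm (u' x) powr p)"
    by (rule continuous_on_powr'; use p continuous_on_subset[OF continuous_on_base'] in \<open>auto intro!: continuous_intros continuous_on_base\<close>)+
  have 2: "continuous_on (- {0}) (\<lambda>x::'a. norm x powr c)" by (intro continuous_intros) auto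
  show "continuous_on (- {0}) (\<lambda>x. \<bar>u x\<bar> powr p / norm x powr c)"
    "continuous_on (- {0}) (\<lambda>x. norm (u' x) powr p / norm x powr c)"
    by (intro continuous_on_divide 1 2; simp)+
qed

lemma integrable_weighted_powr:
  fixes c :: real
  shows "integrable lborel (\<lambda>x. \<bar>u x\<bar> powr p / norm x powr c)"
    and "integrable lborel (\<lambda>x. norm (u' x) powr p / norm x powr c)"
    and "integrable lborel (\<lambda>x. \<bar>u x\<bar> powr (p - 2) * u x * (x \<bullet> u' x) / norm x powr c)"
proof -
  show "integrable lborel (\<lambda>x. \<bar>u x\<bar> powr p / norm x powr c)"
    using u0 by (intro integrable_annulus_support[OF _ \<rho>, of _ R] continuous_on_weighted_powr) auto
  show "integrable lborel (\<lambda>x. norm (u' x) powr p / norm x powr c)"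
    using u'0 by (intro integrable_annulus_support[OF _ \<rho>, of _ R] continuous_on_weighted_powr) auto
  have 1: "continuous_on (- {0}) (\<lambda>x. \<bar>u x\<bar> powr (p - 2) * u x)"
    using p by (intro continuous_on_signed_powr continuous_on_base) auto
  have 2: "continuous_on (- {0}) (\<lambda>x::'a. norm x powr c)" by (intro continuous_intros) auto
  have 3: "continuous_on (- {0}) (\<lambda>x. x \<bullet> u' x)"
    using continuous_on_subset[OF continuous_on_base'] by (intro continuous_intros) auto
  show "integrable lborel (\<lambda>x. \<bar>u x\<bar> powr (p - 2) * u x * (x \<bullet> u' x) / norm x powr c)"
    using u0 by (intro integrable_annulus_support[OF _ \<rho>, of _ R] continuous_on_divide continuous_on_mult[OF 1 3] 2) auto
qed

text \<open>The radial divergence identity for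
  \<open>F x = \<bar>u x\<bar> powr p * norm x powr (- c)\<close>. For
  \<open>c = (p - 1) * a + b + 1\<close> it turns the mixed term of Young's inequality into the
  subtracted integral of the theorem, with its coefficient.\<close>

lemma radial_derivative_identity:
  fixes c :: real
  shows "(\<integral>x. \<bar>u x\<bar> powr (p - 2) * u x * (x \<bullet> u' x) / norm x powr c \<partial>lborel)
   = - ((DIM('a) - c) / p * (\<integral>x. \<bar>u x\<bar> powr p / norm x powr c \<partial>lborel))"
proof -
  define F where "F x = \<bar>u x\<bar> powr p * norm x powr (- c)" for x
  define F' where "F' x = \<bar>u x\<bar> powr p *\<^sub>R ((- c * norm x powr (- c - 1)) *\<^sub>R sgn x)
      + norm x powr (- c) *\<^sub>R ((p * (\<bar>u x\<bar> powr (p - 2) * u x)) *\<^sub>R u' x)" for x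
  have dF: "GDERIV F x :> F' x" if "x \<noteq> 0" for x
    unfolding F_def F'_def
  proof (intro GDERIV_mult)
    show "GDERIV (\<lambda>x. \<bar>u x\<bar> powr p) x :> (p * (\<bar>u x\<bar> powr (p - 2) * u x)) *\<^sub>R u' x"
      by (rule GDERIV_DERIV_compose[OF gu has_real_derivative_abs_powr]) (use p in simp)
    show "GDERIV (\<lambda>x. norm x powr (- c)) x :> (- c * norm x powr (- c - 1)) *\<^sub>R sgn x"
    proof (rule GDERIV_DERIV_compose[OF GDERIV_norm[OF that]])
      show "DERIV (\<lambda>r. r powr (- c)) (norm x) :> - c * norm x powr (- c - 1)"
        using that by (auto intro!: derivative_eq_intros)
    qed
  qed
  have cF': "continuous_on (- {0}) F'"
  proof -
    have "continuous_on (- {0}) (\<lambda>x. \<bar>u x\<bar> powr p)"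
      by (rule continuous_on_powr') (use p in \<open>auto intro!: continuous_intros continuous_on_base\<close>)
    moreover have "continuous_on (- {0}) (\<lambda>x. p * (\<bar>u x\<bar> powr (p - 2) * u x))"
      using p by (intro continuous_on_mult_left continuous_on_signed_powr continuous_on_base) auto
    moreover have "continuous_on (- {0}) (\<lambda>x::'a. norm x powr (- c))"
      "continuous_on (- {0}) (\<lambda>x::'a. - c * norm x powr (- c - 1))"
      by (intro continuous_intros; simp)+
    moreover have "continuous_on (- {0}) (sgn :: 'a \<Rightarrow> 'a)"
      unfolding sgn_div_norm[abs_def] by (intro continuous_intros) auto
    ultimately show ?thesis
      unfolding F'_def
      by (intro continuous_on_add continuous_on_scaleR continuous_on_subset[OF continuous_on_base'])
         auto
  qed
  have Feq: "F x = \<bar>u x\<bar> powr p / norm x powr c" for x by (simp add: F_def powr_minus_divide)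
  have div_eq: "DIM('a) * F x + x \<bullet> F' x = (DIM('a) - c) * (\<bar>u x\<bar> powr p / norm x powr c)
      + p * (\<bar>u x\<bar> powr (p - 2) * u x * (x \<bullet> u' x) / norm x powr c)" for x
  proof (cases "x = 0")
    case False
    have 1: "x \<bullet> sgn x = norm x"
      using False by (simp add: sgn_div_norm power2_norm_eq_inner[symmetric] power2_eq_square)
    have 2: "norm x powr (- c - 1) * norm x = norm x powr (- c)"
      using False by (simp add: powr_diff)
    have "x \<bullet> F' x = \<bar>u x\<bar> powr p * (- c * (norm x powr (- c - 1) * norm x))
        + norm x powr (- c) * (p * (\<bar>u x\<bar> powr (p - 2) * u x) * (x \<bullet> u' x))"
      by (simp add: F'_def inner_add_right inner_diff_right 1)
    then show ?thesis unfolding 2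
      by (simp add: F_def powr_minus_divide algebra_simps diff_divide_distrib)
  qed (simp add: F_def F'_def)
  note i = integrable_weighted_powr(1)[of c] integrable_weighted_powr(3)[of c]
  have "(\<integral>x. DIM('a) * F x + x \<bullet> F' x \<partial>lborel) = 0"
  proof (rule integral_radial_divergence_eq_0[OF dF cF'])
    show "integrable lborel F" unfolding Feq[abs_def] by (rule i)
    show "integrable lborel (\<lambda>x. DIM('a) * F x + x \<bullet> F' x)" unfolding div_eq
      by (intro Bochner_Integration.integrable_add integrable_mult_right i)
  qed auto
  then have "(DIM('a) - c) * (\<integral>x. \<bar>u x\<bar> powr p / norm x powr c \<partial>lborel)
      + p * (\<integral>x. \<bar>u x\<bar> powr (p - 2) * u x * (x \<bullet> u' x) / norm x powr c \<partial>lborel) = 0"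
    unfolding div_eq
    by (simp only: Bochner_Integration.integral_add integrable_mult_right integral_mult_right_zero i)
  then show ?thesis using p by (simp add: field_simps)
qed

text \<open>The left-hand side is the remainder in Young's inequality for \<open>X = |x| powr (-b) *\<^sub>R \<nabla>u\<close> and
  \<open>Y = (\<kappa> * u * |x| powr (-a-1)) *\<^sub>R x\<close>, and \<open>X + Y\<close> is a multiple of the gradient of
  \<open>f = u * exp (\<kappa> * |x| powr \<sigma> / \<sigma>)\<close>; \<open>G\<close> is that gradient, rescaled.\<close>
lemma young_remainder_pointwise:
  fixes a b \<kappa> :: real and x :: 'a
  defines "\<sigma> \<equiv> b - a + 1"
  defines "f \<equiv> \<lambda>x. exp (\<kappa> * norm x powr \<sigma> / \<sigma>) * u x"
  defines "f' \<equiv> \<lambda>x. exp (\<kappa> * norm x powr \<sigma> / \<sigma>) *\<^sub>R (u' x + (\<kappa> * norm x powr (\<sigma> - 2) * u x) *\<^sub>R x)"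
  defines "G \<equiv> \<lambda>x. norm x powr (1 - \<sigma>) * norm (f' x) / \<kappa>"
  assumes \<kappa>: "0 < \<kappa>"
  shows "norm (u' x) powr p / norm x powr (p * b) / p + (p - 1) / p * (\<kappa> powr p * (\<bar>u x\<bar> powr p / norm x powr (p * a)))
      + \<kappa> powr (p - 1) * (\<bar>u x\<bar> powr (p - 2) * u x * (x \<bullet> u' x) / norm x powr ((p - 1) * a + b + 1))
    \<ge> (p - 1) / 32 * \<kappa> powr p * ((G x + \<bar>f x\<bar>) powr (p - 2) * (G x)\<^sup>2
        * (norm x powr (- (p * a)) * exp (- (p * \<kappa> / \<sigma> * norm x powr \<sigma>))))"
proof (cases "x = 0")
  \<comment> \<open>At the origin both sides are 0, by the conventions for \<open>0 powr c\<close>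
    and for division by 0.\<close>
  case True
  then show ?thesis by simp
next
  case False
  define r where "r = norm x"
  have r: "0 < r" using False by (simp add: r_def)
  define X where "X = r powr (- b) *\<^sub>R u' x"
  define Y where "Y = (\<kappa> * u x * r powr (- a - 1)) *\<^sub>R x"
  \<comment> \<open>The common scale: \<open>norm Y = \<omega> * \<bar>f x\<bar>\<close> and
    \<open>norm (X + Y) = \<omega> * G x\<close>. The Young lower bound is homogeneous of degree
    \<open>p\<close>, so \<omega> leaves it as \<open>\<omega> powr p\<close>, which is
    \<open>\<kappa> powr p\<close> times the weight of the Poincare inequality.\<close>
  define \<omega> where "\<omega> = \<kappa> * r powr (- a) * exp (- (\<kappa> * r powr \<sigma> / \<sigma>))"
  have \<omega>: "0 < \<omega>" using \<kappa> r by (simp add: \<omega>_def)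
  have ra: "r powr (- a - 1) * r = r powr (- a)" using r by (simp add: powr_diff)
  have nX: "norm X = r powr (- b) * norm (u' x)" by (simp add: X_def)
  have nY: "norm Y = \<kappa> * r powr (- a) * \<bar>u x\<bar>"
  proof -
    have "norm Y = \<kappa> * \<bar>u x\<bar> * (r powr (- a - 1) * r)"
      using \<kappa> by (simp add: Y_def abs_mult r_def)
    then show ?thesis unfolding ra by simp
  qed
  have e1: "exp (- (\<kappa> * r powr \<sigma> / \<sigma>)) * exp (\<kappa> * r powr \<sigma> / \<sigma>) = 1" by (simp flip: exp_add)
  have nYf: "norm Y = \<omega> * \<bar>f x\<bar>"
  proof -
    have "\<omega> * \<bar>f x\<bar> = \<kappa> * r powr (- a) * \<bar>u x\<bar> * (exp (- (\<kappa> * r powr \<sigma> / \<sigma>)) * exp (\<kappa> * r powr \<sigma> / \<sigma>))"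
      by (simp add: \<omega>_def f_def abs_mult r_def)
    then show ?thesis unfolding e1 nY by simp
  qed
  have nXY: "norm (X + Y) = \<omega> * G x"
  proof -
    have "X + Y = r powr (- b) *\<^sub>R (u' x + (\<kappa> * r powr (\<sigma> - 2) * u x) *\<^sub>R x)"
    proof -
      have "r powr (- b) * r powr (\<sigma> - 2) = r powr (- a - 1)"
        by (simp add: \<sigma>_def flip: powr_add)
      then have "r powr (- b) * (\<kappa> * r powr (\<sigma> - 2) * u x) = \<kappa> * u x * r powr (- a - 1)"
        by (metis mult.assoc mult.commute)
      then show ?thesis by (simp only: X_def Y_def scaleR_add_right scaleR_scaleR)
    qed
    then have 1: "norm (X + Y) = r powr (- b) * norm (u' x + (\<kappa> * r powr (\<sigma> - 2) * u x) *\<^sub>R x)" by simp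
    have "r powr (- a) * r powr (1 - \<sigma>) = r powr (- b)"
      by (simp add: \<sigma>_def flip: powr_add)
    then have 2: "\<omega> * G x = (exp (- (\<kappa> * r powr \<sigma> / \<sigma>)) * exp (\<kappa> * r powr \<sigma> / \<sigma>)) * (r powr (- b) * norm (u' x + (\<kappa> * r powr (\<sigma> - 2) * u x) *\<^sub>R x))"
      using \<kappa> by (simp add: \<omega>_def G_def f'_def r_def[symmetric] flip: \<open>r powr (- a) * r powr (1 - \<sigma>) = r powr (- b)\<close>)
    show ?thesis unfolding 1 2 e1 by simp
  qed
  have G0: "0 \<le> G x" using \<kappa> by (simp add: G_def)
  \<comment> \<open>As \<open>p - 2\<close> is negative, an upper bound for the sum of the norms is
    what is needed. Its factor 2 costs \<open>2 powr (p - 2) \<ge> 1 / 4\<close>, which turns 1/8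
    into 1/32.\<close>
  have X_le: "norm X + norm Y \<le> 2 * \<omega> * (G x + \<bar>f x\<bar>)"
  proof -
    have "norm X \<le> norm (X + Y) + norm Y" using norm_triangle_ineq4[of "X + Y" Y] by simp
    moreover have "0 \<le> \<omega> * G x" using \<omega> G0 by simp
    ultimately show ?thesis unfolding nXY nYf by (simp add: algebra_simps)
  qed
  have wp: "\<omega> powr (p - 2) * \<omega>\<^sup>2 = \<kappa> powr p * (r powr (- (p * a)) * exp (- (p * \<kappa> / \<sigma> * r powr \<sigma>)))"
  proof -
    have "\<omega> powr (p - 2) * \<omega>\<^sup>2 = \<omega> powr p"
      using \<omega> by (simp add: powr_diff powr_realpow flip: powr_numeral)
    also have "\<dots> = \<kappa> powr p * (r powr (- a)) powr p * exp (- (\<kappa> * r powr \<sigma> / \<sigma>)) powr p"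
      using \<kappa> r by (simp add: \<omega>_def powr_mult)
    also have "(r powr (- a)) powr p = r powr (- (p * a))" by (simp add: powr_powr mult.commute)
    also have "exp (- (\<kappa> * r powr \<sigma> / \<sigma>)) powr p = exp (- (p * \<kappa> / \<sigma> * r powr \<sigma>))"
      by (simp add: powr_def mult.assoc)
    finally show ?thesis by simp
  qed
  have main: "(p - 1) / 32 * ((G x + \<bar>f x\<bar>) powr (p - 2) * (G x)\<^sup>2 * (\<omega> powr (p - 2) * \<omega>\<^sup>2))
     \<le> (p - 1) / 8 * (norm X + norm Y) powr (p - 2) * (norm (X + Y))\<^sup>2"
  proof (cases "G x = 0")
    case True
    then show ?thesis using p by simp
  next
    case False
    have "0 < \<omega> * G x" using False G0 \<omega> by simp
    then have XY: "0 < norm X + norm Y" using norm_triangle_ineq[of X Y] unfolding nXY by linarith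
    have "1 / 4 * (\<omega> * (G x + \<bar>f x\<bar>)) powr (p - 2) \<le> 2 powr (p - 2) * (\<omega> * (G x + \<bar>f x\<bar>)) powr (p - 2)"
    proof (rule mult_right_mono)
      show "1 / 4 \<le> (2 :: real) powr (p - 2)"
        using powr_mono[of "-2" "p - 2" "2::real"] p by (simp add: powr_minus)
    qed simp
    also have "\<dots> = (2 * \<omega> * (G x + \<bar>f x\<bar>)) powr (p - 2)"
      using \<omega> G0 by (simp add: powr_mult)
    also have "\<dots> \<le> (norm X + norm Y) powr (p - 2)"
      using XY X_le p by (intro powr_mono2') auto
    finally have "(p - 1) / 8 * (1 / 4 * (\<omega> * (G x + \<bar>f x\<bar>)) powr (p - 2)) * (norm (X + Y))\<^sup>2
       \<le> (p - 1) / 8 * (norm X + norm Y) powr (p - 2) * (norm (X + Y))\<^sup>2"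
      using p by (intro mult_right_mono mult_left_mono) auto
    moreover have "(\<omega> * (G x + \<bar>f x\<bar>)) powr (p - 2) = \<omega> powr (p - 2) * (G x + \<bar>f x\<bar>) powr (p - 2)"
      using \<omega> G0 by (simp add: powr_mult)
    ultimately show ?thesis unfolding nXY by (simp add: power_mult_distrib mult_ac)
  qed
  also have "\<dots> \<le> norm X powr p / p + (p - 1) / p * norm Y powr p + norm Y powr (p - 2) * (Y \<bullet> X)"
    by (rule young_remainder_lower_bound[OF p])
  also have "norm X powr p = norm (u' x) powr p / norm x powr (p * b)"
    using r by (simp add: nX powr_mult powr_powr powr_minus_divide powr_divide r_def mult.commute)
  also have "norm Y powr p = \<kappa> powr p * (\<bar>u x\<bar> powr p / norm x powr (p * a))"
    using r \<kappa> by (simp add: nY powr_mult powr_powr powr_minus_divide powr_divide r_def mult.commute)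
  also have "norm Y powr (p - 2) * (Y \<bullet> X)
     = \<kappa> powr (p - 1) * (\<bar>u x\<bar> powr (p - 2) * u x * (x \<bullet> u' x) / norm x powr ((p - 1) * a + b + 1))"
  proof -
    have "norm Y powr (p - 2) * (Y \<bullet> X)
      = (\<kappa> powr (p - 2) * \<kappa>) * (\<bar>u x\<bar> powr (p - 2) * u x * (x \<bullet> u' x)) * (r powr (- a * (p - 2)) * r powr (- a - 1) * r powr (- b))"
    proof -
      have "Y \<bullet> X = \<kappa> * u x * r powr (- a - 1) * (r powr (- b) * (x \<bullet> u' x))"
        by (simp add: X_def Y_def)
      then show ?thesis unfolding nY using r \<kappa> by (simp add: powr_mult powr_powr mult_ac)
    qed
    also have "\<kappa> powr (p - 2) * \<kappa> = \<kappa> powr (p - 1)"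
      using \<kappa> by (simp add: powr_diff power2_eq_square)
    also have "r powr (- a * (p - 2)) * r powr (- a - 1) * r powr (- b) = r powr (- ((p - 1) * a + b + 1))"
      by (simp add: algebra_simps flip: powr_add)
    finally show ?thesis by (simp only: powr_minus_divide r_def times_divide_eq_right mult_1_right)
  qed
  finally show ?thesis unfolding wp r_def by (simp add: mult_ac)
qed

text \<open>Away from the origin this is the product rule; near it \<open>u\<close> and its gradient
  vanish, so the singular factor \<open>norm x powr (\<sigma> - 2)\<close> does no harm.\<close>

lemma gderiv_exp_weighted:
  fixes \<kappa> \<sigma> :: real
  defines "f \<equiv> \<lambda>x. exp (\<kappa> * norm x powr \<sigma> / \<sigma>) * u x"
  defines "f' \<equiv> \<lambda>x. exp (\<kappa> * norm x powr \<sigma> / \<sigma>) *\<^sub>R (u' x + (\<kappa> * norm x powr (\<sigma> - 2) * u x) *\<^sub>R x)"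
  assumes \<sigma>: "0 < \<sigma>"
  shows "GDERIV f x :> f' x" and "continuous_on UNIV f'"
proof -
  have near0: "f x = 0" "f' x = 0" if "x \<in> ball 0 \<rho>" for x
    using that u0[of x] u'0[of x] by (simp_all add: f_def f'_def)
  show "GDERIV f x :> f' x"
  proof (cases "x = 0")
    case True
    have "(f has_derivative (\<lambda>_. 0)) (at x)"
      by (rule has_derivative_transform_within_open[OF has_derivative_const[of 0], of "ball 0 \<rho>"])
         (use near0 True \<rho> in auto)
    then show ?thesis using near0(2)[of x] True \<rho> by (simp add: gderiv_def)
  next
    case False
    have "DERIV (\<lambda>r. exp (\<kappa> * r powr \<sigma> / \<sigma>)) (norm x) :> exp (\<kappa> * norm x powr \<sigma> / \<sigma>) * (\<kappa> * norm x powr (\<sigma> - 1))"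
      using False \<sigma> by (auto intro!: derivative_eq_intros)
    from GDERIV_DERIV_compose[OF GDERIV_norm[OF False] this]
    have "GDERIV (\<lambda>x. exp (\<kappa> * norm x powr \<sigma> / \<sigma>)) x :> (exp (\<kappa> * norm x powr \<sigma> / \<sigma>) * (\<kappa> * norm x powr (\<sigma> - 1))) *\<^sub>R sgn x" .
    from GDERIV_mult[OF this gu[of x]] show ?thesis
      unfolding f_def
    proof (rule GDERIV_subst)
      have "norm x powr (\<sigma> - 1) *\<^sub>R sgn x = norm x powr (\<sigma> - 2) *\<^sub>R x"
        using False by (simp add: sgn_div_norm powr_diff power2_eq_square divide_inverse)
      then have "u x *\<^sub>R (exp (\<kappa> * norm x powr \<sigma> / \<sigma>) * (\<kappa> * norm x powr (\<sigma> - 1))) *\<^sub>R sgn x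
        = (u x * exp (\<kappa> * norm x powr \<sigma> / \<sigma>) * \<kappa>) *\<^sub>R norm x powr (\<sigma> - 2) *\<^sub>R x"
        by (metis (no_types, lifting) mult.assoc scaleR_scaleR)
      then show "exp (\<kappa> * norm x powr \<sigma> / \<sigma>) *\<^sub>R u' x
          + u x *\<^sub>R (exp (\<kappa> * norm x powr \<sigma> / \<sigma>) * (\<kappa> * norm x powr (\<sigma> - 1))) *\<^sub>R sgn x = f' x"
        by (simp add: f'_def scaleR_add_right mult_ac)
    qed
  qed
  have "continuous_on (- {0}) f'"
    unfolding f'_def using continuous_on_subset[OF continuous_on_base'] \<sigma>
    by (intro continuous_intros continuous_on_base) auto
  moreover have "continuous_on (ball 0 \<rho>) f'"
    by (rule continuous_on_eq[of _ "\<lambda>_. 0"]) (use near0 in auto)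
  ultimately have "continuous_on (- {0} \<union> ball 0 \<rho>) f'"
    by (intro continuous_on_open_Un) (auto simp: open_Compl)
  moreover have "- {0 :: 'a} \<union> ball 0 \<rho> = UNIV" using \<rho> by auto
  ultimately show "continuous_on UNIV f'" by (simp only:)
qed

lemma bounded_outside_compact:
  fixes g :: "'a \<Rightarrow> real"
  assumes "continuous_on UNIV g" and "\<And>x. R < norm x \<Longrightarrow> g x = c"
  obtains Q where "\<And>x. g x \<le> Q"
proof -
  have "bounded (g ` cball 0 R)"
    using assms(1) by (intro compact_imp_bounded compact_continuous_image) (auto intro: continuous_on_subset)
  then obtain B where "\<forall>y \<in> g ` cball 0 R. \<bar>y\<bar> \<le> B" by (auto simp: bounded_iff)
  then have B: "\<bar>g x\<bar> \<le> B" if "norm x \<le> R" for x using that by simp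
  have "g x \<le> max B c" for x
    using B[of x] assms(2)[of x] by (cases "norm x \<le> R") auto
  then show ?thesis using that by blast
qed

text \<open>Valid for every positive \<kappa>; the optimal value enters only in the theorem. Three
  losses make up the constant: the Young remainder controls \<open>Z\<close> (first
  \<open>(p - 1) / 32\<close>), the Poincare inequality with absorption controls the divergence
  (\<open>p / (2 * C1 * \<sigma> * C2)\<close>), and the divergence controls the squared distance
  (last \<open>(p - 1) / 32\<close>).\<close>

lemma young_remainder_ge_weighted_distance:
  fixes a b \<kappa> :: real
  defines "\<sigma> \<equiv> b - a + 1" and "n \<equiv> real DIM('a)"
  defines "C1 \<equiv> 6 / \<sigma> + 6 * (n + 5) * (8 * 2 ^ DIM('a)) * exp (2 * n) * (8 * n) powr (p * a / \<sigma>) * (2 * n)"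
  defines "C2 \<equiv> (2 + 32 / (p / (2 * C1 * \<sigma>) * (p - 1))) * 4"
  assumes n2: "2 \<le> DIM('a)" and \<sigma>: "0 < \<sigma>" "\<sigma> \<le> 1" and a: "0 \<le> a" "n - p * a = n * \<sigma>" and \<kappa>: "0 < \<kappa>"
  obtains m where "\<kappa> powr p * ((p - 1) / 32 * (p / (2 * C1 * \<sigma> * C2)) * ((p - 1) / 32)
       * (\<integral>x. (\<bar>u x\<bar> powr ((p - 2) / 2) * u x
            - \<bar>m\<bar> powr ((p - 2) / 2) * m * exp (- (p / 2 * \<kappa> * norm x powr \<sigma> / \<sigma>)))\<^sup>2 / norm x powr (p * a) \<partial>lborel))
    \<le> (\<integral>x. norm (u' x) powr p / norm x powr (p * b) \<partial>lborel) / p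
      + (p - 1) / p * (\<kappa> powr p * (\<integral>x. \<bar>u x\<bar> powr p / norm x powr (p * a) \<partial>lborel))
      - \<kappa> powr (p - 1) * ((n - ((p - 1) * a + b + 1)) / p
          * (\<integral>x. \<bar>u x\<bar> powr p / norm x powr ((p - 1) * a + b + 1) \<partial>lborel))"
proof -
  define f where "f x = exp (\<kappa> * norm x powr \<sigma> / \<sigma>) * u x" for x
  define f' where "f' x = exp (\<kappa> * norm x powr \<sigma> / \<sigma>) *\<^sub>R (u' x + (\<kappa> * norm x powr (\<sigma> - 2) * u x) *\<^sub>R x)" for x
  define G where "G x = norm x powr (1 - \<sigma>) * norm (f' x) / \<kappa>" for x
  \<comment> \<open>With this \<open>k\<close>, \<open>\<bar>f x\<bar> powr p * w x\<close> equals
    \<open>\<bar>u x\<bar> powr p / norm x powr (p * a)\<close>.\<close>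
  define k where "k = p * \<kappa> / \<sigma>"
  define w where "w x = norm x powr (- (p * a)) * exp (- (k * norm x powr \<sigma>))" for x :: 'a
  define \<psi> where "\<psi> t = \<bar>t\<bar> powr (p - 2) * t" for t :: real
  have n: "2 \<le> n" using n2 by (simp add: n_def)
  have k: "0 < k" using \<kappa> p \<sigma> by (simp add: k_def)
  have gf: "GDERIV f x :> f' x" for x
    unfolding f_def[abs_def] f'_def[abs_def] by (rule gderiv_exp_weighted(1)[OF \<sigma>(1)])
  have cf': "continuous_on UNIV f'"
    unfolding f'_def[abs_def] by (rule gderiv_exp_weighted(2)[OF \<sigma>(1)])
  have cf: "continuous_on UNIV f"
    using gf by (auto simp: gderiv_def continuous_on_eq_continuous_at intro: has_derivative_continuous)
  have G0: "0 \<le> G x" for x using \<kappa> by (simp add: G_def)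
  have w0: "0 \<le> w x" for x by (simp add: w_def)
  define r where "r = (2 * n / k) powr (1 / \<sigma>)"
  interpret B: finite_measure "restrict_space lborel (ball (0::'a) r)"
    using emeasure_lborel_ball_finite[of "0::'a" r]
    by (intro finite_measureI) (simp add: emeasure_restrict_space space_restrict_space)
  have "f \<in> borel_measurable (restrict_space lborel (ball 0 r))"
    using cf by (intro measurable_restrict_space1) (simp add: borel_measurable_continuous_onI)
  then obtain m where
    m1: "measure (restrict_space lborel (ball 0 r)) (space (restrict_space lborel (ball (0::'a) r))) / 2
      \<le> measure (restrict_space lborel (ball 0 r)) {x \<in> space (restrict_space lborel (ball 0 r)). f x \<le> m}" and
    m2: "measure (restrict_space lborel (ball 0 r)) (space (restrict_space lborel (ball (0::'a) r))) / 2
      \<le> measure (restrict_space lborel (ball 0 r)) {x \<in> space (restrict_space lborel (ball 0 r)). m \<le> f x}"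
    by (rule B.ex_median)
  have le: "measure lborel (ball (0::'a) r) / 2 \<le> measure lborel {x \<in> ball 0 r. f x \<le> m}"
    and ge: "measure lborel (ball (0::'a) r) / 2 \<le> measure lborel {x \<in> ball 0 r. m \<le> f x}"
    using m1 m2 by (simp_all add: space_restrict_space measure_restrict_space subset_eq)
  define q where "q x = bregman p (f x) m" for x
  define q' where "q' x = (\<psi> (f x) - \<psi> m) *\<^sub>R f' x" for x
  have gq: "GDERIV q x :> q' x" for x
    unfolding q_def q'_def \<psi>_def
    by (rule GDERIV_DERIV_compose[OF gf has_real_derivative_bregman]) (use p in simp)
  have cq': "continuous_on UNIV q'"
    unfolding q'_def \<psi>_def using p by (intro continuous_intros continuous_on_signed_powr cf cf') auto
  have cq: "continuous_on UNIV q"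
    using gq by (auto simp: gderiv_def continuous_on_eq_continuous_at intro: has_derivative_continuous)
  have far: "f x = 0" "f' x = 0" if "R < norm x" for x
    using that u0[of x] u'0[of x] by (simp_all add: f_def f'_def)
  obtain Q1 where Q1: "\<And>x. q x \<le> Q1"
    by (rule bounded_outside_compact[OF cq, of "bregman p 0 m"]) (use far in \<open>auto simp: q_def\<close>)
  obtain Q2 where Q2: "\<And>x. norm x * norm (q' x) \<le> Q2"
  proof (rule bounded_outside_compact[of "\<lambda>x. norm x * norm (q' x)" 0])
    show "continuous_on UNIV (\<lambda>x. norm x * norm (q' x))" by (intro continuous_intros cq')
    show "norm x * norm (q' x) = 0" if "R < norm x" for x using far[OF that] by (simp add: q'_def)
  qed (rule that)
  have q0: "0 \<le> q x" for x unfolding q_def by (rule bregman_nonneg[OF p])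
  have Q: "q x \<le> max Q1 Q2" "norm x * norm (q' x) \<le> max Q1 Q2" for x
    using Q1[of x] Q2[of x] by auto
  have pa: "0 \<le> p * a" using p a by simp
  have vanish: "q x = 0" if "f x = m" for x using that by (simp add: q_def)
  note poincare = weighted_median_poincare[OF n2 \<sigma> pa a(2)[unfolded n_def] k gq cq' cf vanish q0 Q
      le[unfolded r_def n_def] ge[unfolded r_def n_def], folded w_def n_def]
  have wmp: "integrable lborel (\<lambda>x. q x * w x)"
    "integrable lborel (\<lambda>x. norm x powr (1 - \<sigma>) * norm (q' x) * w x)"
    "(\<integral>x. q x * w x \<partial>lborel) \<le> C1 / k * (\<integral>x. norm x powr (1 - \<sigma>) * norm (q' x) * w x \<partial>lborel)"
    unfolding C1_def by (rule poincare; assumption)+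
  have C1: "0 < C1" unfolding C1_def using \<sigma> n by (intro add_pos_nonneg) auto
  \<comment> \<open>Chosen so that \<open>C1 / k * \<kappa> * \<epsilon> = 1 / 2\<close>: the
    divergence on the right is then half of that on the left and can be subtracted.\<close>
  define \<epsilon> where "\<epsilon> = p / (2 * C1 * \<sigma>)"
  have \<epsilon>: "0 < \<epsilon>" using p C1 \<sigma> by (simp add: \<epsilon>_def)
  have C2: "0 < C2" unfolding C2_def \<epsilon>_def[symmetric] using \<epsilon> p by (intro mult_pos_pos add_pos_pos) auto
  define Z where "Z x = (G x + \<bar>f x\<bar>) powr (p - 2) * (G x)\<^sup>2" for x
  have Z0: "0 \<le> Z x" for x by (simp add: Z_def)
  define Y where "Y x = norm (u' x) powr p / norm x powr (p * b) / p + (p - 1) / p * (\<kappa> powr p * (\<bar>u x\<bar> powr p / norm x powr (p * a)))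
      + \<kappa> powr (p - 1) * (\<bar>u x\<bar> powr (p - 2) * u x * (x \<bullet> u' x) / norm x powr ((p - 1) * a + b + 1))" for x
  have YZ: "(p - 1) / 32 * \<kappa> powr p * (Z x * w x) \<le> Y x" for x
    unfolding Y_def Z_def G_def f_def f'_def w_def k_def \<sigma>_def by (rule young_remainder_pointwise[OF \<kappa>])
  note int = integrable_weighted_powr(2)[of "p * b"] integrable_weighted_powr(1)[of "p * a"]
    integrable_weighted_powr(3)[of "(p - 1) * a + b + 1"]
  have iY: "integrable lborel Y"
    unfolding Y_def[abs_def]
    by (intro Bochner_Integration.integrable_add integrable_divide_zero integrable_mult_right int)
  have intY: "(\<integral>x. Y x \<partial>lborel) = (\<integral>x. norm (u' x) powr p / norm x powr (p * b) \<partial>lborel) / p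
      + (p - 1) / p * (\<kappa> powr p * (\<integral>x. \<bar>u x\<bar> powr p / norm x powr (p * a) \<partial>lborel))
      - \<kappa> powr (p - 1) * ((n - ((p - 1) * a + b + 1)) / p
          * (\<integral>x. \<bar>u x\<bar> powr p / norm x powr ((p - 1) * a + b + 1) \<partial>lborel))"
    unfolding Y_def
    by (simp only: Bochner_Integration.integral_add integral_divide_zero integral_mult_right_zero
        Bochner_Integration.integrable_add integrable_divide_zero integrable_mult_right int radial_derivative_identity n_def
        mult_minus_right minus_add_distrib add_uminus_conv_diff)
  have [measurable]: "f \<in> borel_measurable borel" "f' \<in> borel_measurable borel" "q \<in> borel_measurable borel"
    using cf cf' cq by (auto intro: borel_measurable_continuous_onI)
  have [measurable]: "(\<lambda>x::'a. norm x powr c) \<in> borel_measurable borel" for c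
    by (rule powr_real_measurable) auto
  have [measurable]: "G \<in> borel_measurable borel" "w \<in> borel_measurable borel"
    unfolding G_def[abs_def] w_def[abs_def] by measurable
  have [measurable]: "Z \<in> borel_measurable borel" unfolding Z_def[abs_def]
    by (intro borel_measurable_times powr_real_measurable) measurable
  \<comment> \<open>Integrability is inherited from the Young remainder, which dominates
    \<open>Z x * w x\<close> pointwise.\<close>
  have iZ: "integrable lborel (\<lambda>x. Z x * w x)"
  proof (rule Bochner_Integration.integrable_bound)
    define c where "c = (p - 1) / 32 * \<kappa> powr p"
    have c: "0 < c" using p \<kappa> by (simp add: c_def)
    show "integrable lborel (\<lambda>x. Y x / c)" using iY by simp
    have "\<bar>Z x * w x\<bar> \<le> \<bar>Y x / c\<bar>" for x
    proof -
      have "c * (Z x * w x) \<le> Y x" unfolding c_def by (rule YZ)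
      then have "Z x * w x \<le> Y x / c" using c by (simp add: pos_le_divide_eq mult.commute)
      moreover have "0 \<le> Z x * w x" using Z0 w0 by simp
      ultimately show ?thesis by linarith
    qed
    then show "AE x in lborel. norm (Z x * w x) \<le> norm (Y x / c)" by simp
  qed measurable
  define Iq where "Iq = (\<integral>x. q x * w x \<partial>lborel)"
  define IZ where "IZ = (\<integral>x. Z x * w x \<partial>lborel)"
  have "(\<integral>x. norm x powr (1 - \<sigma>) * norm (q' x) * w x \<partial>lborel) \<le> (\<integral>x. \<kappa> * (\<epsilon> * (q x * w x) + C2 * (Z x * w x)) \<partial>lborel)"
  proof (rule integral_mono)
    fix x :: 'a
    have "norm x powr (1 - \<sigma>) * norm (q' x) = \<kappa> * (\<bar>\<psi> (f x) - \<psi> m\<bar> * G x)"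
      using \<kappa> by (simp add: q'_def G_def)
    also have "\<dots> \<le> \<kappa> * (\<epsilon> * q x + C2 * Z x)"
      using bregman_absorption[OF p G0 \<epsilon>, of "f x" m x] \<kappa>
      by (intro mult_left_mono) (auto simp: \<psi>_def q_def Z_def C2_def \<epsilon>_def)
    finally have "norm x powr (1 - \<sigma>) * norm (q' x) * w x \<le> \<kappa> * (\<epsilon> * q x + C2 * Z x) * w x"
      using w0 by (rule mult_right_mono)
    then show "norm x powr (1 - \<sigma>) * norm (q' x) * w x \<le> \<kappa> * (\<epsilon> * (q x * w x) + C2 * (Z x * w x))"
      by (simp add: algebra_simps)
  qed (use wmp(1,2) iZ in auto)
  also have "\<dots> = \<kappa> * (\<epsilon> * Iq + C2 * IZ)"
    using wmp(1) iZ by (simp add: Iq_def IZ_def)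
  finally have "C1 / k * (\<integral>x. norm x powr (1 - \<sigma>) * norm (q' x) * w x \<partial>lborel) \<le> C1 / k * (\<kappa> * (\<epsilon> * Iq + C2 * IZ))"
    using C1 k by (intro mult_left_mono) auto
  from order_trans[OF wmp(3) this] have "Iq \<le> C1 / k * (\<kappa> * (\<epsilon> * Iq + C2 * IZ))"
    by (simp only: Iq_def)
  also have "\<dots> = Iq / 2 + C1 * \<sigma> * C2 / p * IZ"
    using C1 \<sigma> p \<kappa> by (simp add: k_def \<epsilon>_def field_simps)
  finally have "Iq \<le> 2 * C1 * \<sigma> * C2 / p * IZ" by simp
  then have "p / (2 * C1 * \<sigma> * C2) * Iq \<le> p / (2 * C1 * \<sigma> * C2) * (2 * C1 * \<sigma> * C2 / p * IZ)"
    using p C1 C2 \<sigma> by (intro mult_left_mono) auto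
  then have IqIZ: "p / (2 * C1 * \<sigma> * C2) * Iq \<le> IZ"
    using p C1 C2 \<sigma> by simp

  define J where "J x = (\<bar>u x\<bar> powr ((p - 2) / 2) * u x
            - \<bar>m\<bar> powr ((p - 2) / 2) * m * exp (- (p / 2 * \<kappa> * norm x powr \<sigma> / \<sigma>)))\<^sup>2 / norm x powr (p * a)" for x
  have "(p - 1) / 32 * (\<integral>x. J x \<partial>lborel) = (\<integral>x. (p - 1) / 32 * J x \<partial>lborel)" by simp
  also have "\<dots> \<le> Iq"
    unfolding Iq_def
  \<comment> \<open>This rule asks for integrability of the majorant only, so none has to be shown
    for \<open>J\<close>.\<close>
  proof (rule integral_mono')
    fix x :: 'a
    define \<phi> where "\<phi> = \<kappa> * norm x powr \<sigma> / \<sigma>"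
    \<comment> \<open>The signed power is homogeneous of degree p/2, so the factor exp \<phi> of
      \<open>f\<close> comes out with exponent p/2. The constant \<open>m\<close> compared with
      \<open>f\<close> thereby becomes the exponential profile compared with
      \<open>u\<close>.\<close>
    have "\<bar>f x\<bar> powr ((p - 2) / 2) * f x = exp (p / 2 * \<phi>) * (\<bar>u x\<bar> powr ((p - 2) / 2) * u x)"
    proof -
      have "exp \<phi> powr ((p - 2) / 2) * exp \<phi> = exp (p / 2 * \<phi>)"
        by (simp add: powr_def diff_divide_distrib algebra_simps flip: exp_add)
      then show ?thesis by (simp add: f_def \<phi>_def[symmetric] abs_mult powr_mult mult_ac)
    qed
    moreover have "exp (- (p / 2 * \<phi>)) * exp (p / 2 * \<phi>) = 1" by (simp flip: exp_add)
    ultimately have "\<bar>u x\<bar> powr ((p - 2) / 2) * u x - \<bar>m\<bar> powr ((p - 2) / 2) * m * exp (- (p / 2 * \<phi>))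
      = exp (- (p / 2 * \<phi>)) * (\<bar>f x\<bar> powr ((p - 2) / 2) * f x - \<bar>m\<bar> powr ((p - 2) / 2) * m)"
      by (simp add: right_diff_distrib mult.assoc[symmetric])
    moreover have "(exp (- (p / 2 * \<phi>)))\<^sup>2 = exp (- (k * norm x powr \<sigma>))"
      by (simp add: power2_eq_square k_def \<phi>_def field_simps flip: exp_add)
    moreover have "p / 2 * \<kappa> * norm x powr \<sigma> / \<sigma> = p / 2 * \<phi>" by (simp add: \<phi>_def)
    ultimately have "J x = (\<bar>f x\<bar> powr ((p - 2) / 2) * f x - \<bar>m\<bar> powr ((p - 2) / 2) * m)\<^sup>2 * w x"
      by (simp only: J_def w_def power_mult_distrib powr_minus_divide) simp
    then have "(p - 1) / 32 * J x = (p - 1) / 32 * (\<bar>f x\<bar> powr ((p - 2) / 2) * f x - \<bar>m\<bar> powr ((p - 2) / 2) * m)\<^sup>2 * w x"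
      by simp
    also have "\<dots> \<le> q x * w x"
      unfolding q_def by (intro mult_right_mono signed_powr_diff_le_bregman[OF p] w0)
    finally show "(p - 1) / 32 * J x \<le> q x * w x" .
    show "0 \<le> q x * w x" using q0 w0 by simp
  qed (rule wmp(1))
  finally have "(p - 1) / 32 * (p / (2 * C1 * \<sigma> * C2)) * ((p - 1) / 32 * (\<integral>x. J x \<partial>lborel))
      \<le> (p - 1) / 32 * (p / (2 * C1 * \<sigma> * C2)) * Iq"
    using p C1 C2 \<sigma> by (intro mult_left_mono) auto
  also have "\<dots> \<le> (p - 1) / 32 * IZ"
    using IqIZ p by (simp only: mult.assoc) (intro mult_left_mono, auto)
  finally have "\<kappa> powr p * ((p - 1) / 32 * (p / (2 * C1 * \<sigma> * C2)) * ((p - 1) / 32 * (\<integral>x. J x \<partial>lborel)))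
      \<le> \<kappa> powr p * ((p - 1) / 32 * IZ)"
    by (intro mult_left_mono) auto
  also have "\<dots> = (\<integral>x. (p - 1) / 32 * \<kappa> powr p * (Z x * w x) \<partial>lborel)"
    by (simp add: IZ_def)
  also have "\<dots> \<le> (\<integral>x. Y x \<partial>lborel)"
    by (rule integral_mono) (use iZ iY YZ in auto)
  finally show ?thesis
    unfolding intY by (intro that[of m]) (simp only: J_def mult.assoc)
qed

end

text \<open>Both inequalities are the single estimate
  \<open>C * \<kappa> * J m \<le> \<kappa> * B - T\<close>, once as it stands and once divided by
  \<open>\<kappa> * B\<close>, so one constant serves both. Each infimum is bounded above by one
  competitor, and the two competitors have the same profile.\<close>

theorem theorem1p2:
  fixes N :: nat and p a b :: real
  assumes "N = CARD('n::finite)" and "N > 2"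
    and "1 < p" and "p < 2"
    and "0 \<le> b" and "b < (real N - p) / p"
    and "a = real N * b / (real N - p)"
  shows "\<exists>C>0. \<forall>u \<in> C0_infty (- {0 :: real ^ 'n}) - {\<lambda>_. 0}.
    (\<integral>x. norm (grad u x) powr p / norm x powr (p * b) \<partial>lborel) powr (1 / p)
      * (\<integral>x. \<bar>u x\<bar> powr p / norm x powr (p * a) \<partial>lborel) powr ((p - 1) / p)
      - (real N - (p - 1) * a - b - 1) / p
        * (\<integral>x. \<bar>u x\<bar> powr p / norm x powr ((p - 1) * a + b + 1) \<partial>lborel)
    \<ge> C * ((\<integral>x. norm (grad u x) powr p / norm x powr (p * b) \<partial>lborel)
            / (\<integral>x. \<bar>u x\<bar> powr p / norm x powr (p * a) \<partial>lborel)) powr (1 / p)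
        * (INF (c, l) \<in> (UNIV :: real set) \<times> {0 :: real<..}.
             \<integral>x. \<bar>\<bar>u x\<bar> powr ((p - 2) / 2) * u x
                  - \<bar>c\<bar> powr ((p - 2) / 2) * c
                    * exp (- (p / 2 * norm x powr (b - a + 1))
                             / ((b - a + 1) * l powr (b - a + 1)))\<bar>\<^sup>2
                 / norm x powr (p * a) \<partial>lborel)
    \<and>
    1 - ((real N - (p - 1) * a - b - 1) / p
          * (\<integral>x. \<bar>u x\<bar> powr p / norm x powr ((p - 1) * a + b + 1) \<partial>lborel))
        / ((\<integral>x. norm (grad u x) powr p / norm x powr (p * b) \<partial>lborel) powr (1 / p)
           * (\<integral>x. \<bar>u x\<bar> powr p / norm x powr (p * a) \<partial>lborel) powr ((p - 1) / p))
    \<ge> C * (INF v \<in> M_set a b.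
             (\<integral>x. \<bar>\<bar>u x\<bar> powr ((p - 2) / 2) * u x
                   - \<bar>v x\<bar> powr ((p - 2) / 2) * v x\<bar>\<^sup>2
                  / norm x powr (p * a) \<partial>lborel)
             / (\<integral>x. \<bar>u x\<bar> powr p / norm x powr (p * a) \<partial>lborel))"
proof -
  define \<sigma> where "\<sigma> = b - a + 1"
  define n where "n = real DIM(real ^ 'n)"
  have nN: "n = real N" "2 \<le> DIM(real ^ 'n)" using assms(1,2) by (simp_all add: n_def)
  have n: "2 < n" using nN assms(2) by simp
  have np: "0 < n - p" using n assms(4) by simp
  have pb: "p * b < n - p" using assms(3,6) by (simp add: nN(1) pos_less_divide_eq mult.commute)
  have ab: "a = n * b / (n - p)" using assms(7) by (simp add: nN(1))
  \<comment> \<open>Substituting \<open>a\<close> gives \<open>b - a = - (p * b) / (n - p)\<close>.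
    So \<open>b < (N - p) / p\<close> amounts to \<open>0 < \<sigma>\<close>, and
    \<open>0 \<le> b\<close> gives \<open>\<sigma> \<le> 1\<close>; the same substitution yields
    \<open>n - p * a = n * \<sigma>\<close>.\<close>
  have \<sigma>_eq: "\<sigma> = 1 - p * b / (n - p)" unfolding \<sigma>_def ab using np by (simp add: field_simps)
  have \<sigma>: "0 < \<sigma>" "\<sigma> \<le> 1"
    unfolding \<sigma>_eq using pb np assms(3,5) by (simp_all add: pos_divide_less_eq)
  have a0: "0 \<le> a" unfolding ab using np n assms(5) by simp
  have n\<sigma>: "n - p * a = n * \<sigma>" unfolding \<sigma>_eq unfolding ab using np by (simp add: field_simps)
  define C1 where "C1 = 6 / \<sigma> + 6 * (n + 5) * (8 * 2 ^ DIM(real ^ 'n)) * exp (2 * n) * (8 * n) powr (p * a / \<sigma>) * (2 * n)"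
  define C2 where "C2 = (2 + 32 / (p / (2 * C1 * \<sigma>) * (p - 1))) * 4"
  define C where "C = (p - 1) / 32 * (p / (2 * C1 * \<sigma> * C2)) * ((p - 1) / 32)"
  have C1: "0 < C1" unfolding C1_def using \<sigma> n by (intro add_pos_nonneg) auto
  have "0 < p / (2 * C1 * \<sigma>) * (p - 1)" using C1 \<sigma> assms(3) by simp
  then have "0 < 32 / (p / (2 * C1 * \<sigma>) * (p - 1))" by (rule divide_pos_pos[rotated]) simp
  then have "0 < C2" unfolding C2_def by (intro mult_pos_pos add_pos_pos) simp_all
  then have C: "0 < C" unfolding C_def using C1 \<sigma> assms(3) by simp
  show ?thesis
  proof (intro exI[of _ C] conjI ballI)
    show "0 < C" by (rule C)
  next
    fix u :: "real ^ 'n \<Rightarrow> real"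
    assume u: "u \<in> C0_infty (- {0}) - {\<lambda>_. 0}"
    then obtain \<rho> R where \<rho>: "0 < \<rho>"
      and u0: "\<And>x. norm x < \<rho> \<or> R < norm x \<Longrightarrow> u x = 0"
      and g0: "\<And>x. norm x < \<rho> \<or> R < norm x \<Longrightarrow> grad u x = 0"
      and gu: "\<And>x. GDERIV u x :> grad u x" and cg: "continuous_on UNIV (grad u)"
      using C0_infty_gradient[of u] by (metis DiffD1)
    note setting = gu cg \<rho> u0 g0 assms(3,4)
    define A where "A = (\<integral>x. norm (grad u x) powr p / norm x powr (p * b) \<partial>lborel)"
    define B where "B = (\<integral>x. \<bar>u x\<bar> powr p / norm x powr (p * a) \<partial>lborel)"
    define D where "D = (\<integral>x. \<bar>u x\<bar> powr p / norm x powr ((p - 1) * a + b + 1) \<partial>lborel)"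
    have o: "open (- {0 :: real ^ 'n})" by (simp add: open_Compl)
    obtain x0 where x0: "u x0 \<noteq> 0" using u by (auto simp: fun_eq_iff)
    then have x00: "x0 \<noteq> 0" using u0[of x0] \<rho> by auto
    have B: "0 < B"
    proof -
      have "B \<noteq> 0"
      proof
        assume "B = 0"
        then have "\<bar>u x0\<bar> powr p / norm x0 powr (p * a) = 0"
          by (intro continuous_eq_0_of_integral_eq_0[OF integrable_weighted_powr(1)[OF setting] _ _ o
                continuous_on_weighted_powr(1)[OF setting]])
             (use x00 in \<open>simp_all add: B_def\<close>)
        then show False using x0 x00 by simp
      qed
      moreover have "0 \<le> B" unfolding B_def by (intro integral_nonneg_AE) auto
      ultimately show ?thesis by simp
    qed
    have A: "0 < A"
    proof -
      have "A \<noteq> 0"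
      proof
        assume A0: "A = 0"
        have "grad u x = 0" for x
        proof (cases "x = 0")
          case True
          then show ?thesis using g0[of x] \<rho> by simp
        next
          case False
          then have "norm (grad u x) powr p / norm x powr (p * b) = 0"
            by (intro continuous_eq_0_of_integral_eq_0[OF integrable_weighted_powr(2)[OF setting] _ _ o
                  continuous_on_weighted_powr(2)[OF setting]])
               (use A0 in \<open>simp_all add: A_def\<close>)
          then show ?thesis using False by simp
        qed
        then have "(u has_derivative (\<lambda>_. 0)) (at x within UNIV)" for x
          using gu[of x] by (simp add: gderiv_def)
        then obtain c where c: "\<And>x. u x = c"
          using has_derivative_zero_constant[of UNIV u] by auto
        obtain y :: "real ^ 'n" where "norm y = \<bar>R\<bar> + 1"
          using vector_choose_size[of "\<bar>R\<bar> + 1"] by auto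
        then have "u y = 0" by (intro u0) auto
        with c x0 show False by metis
      qed
      moreover have "0 \<le> A" unfolding A_def by (intro integral_nonneg_AE) auto
      ultimately show ?thesis by simp
    qed
    \<comment> \<open>As \<open>\<kappa> powr p * B = A\<close>, the two positive Young terms add up
      to \<open>\<kappa> powr p * B\<close>, and the product of powers of \<open>A\<close> and
      \<open>B\<close> in the theorem is \<open>\<kappa> * B\<close>.\<close>
    define \<kappa> where "\<kappa> = (A / B) powr (1 / p)"
    have \<kappa>: "0 < \<kappa>" using A B by (simp add: \<kappa>_def)
    have \<kappa>B: "\<kappa> powr p * B = A" using A B assms(3) by (simp add: \<kappa>_def powr_powr)
    have AB: "A powr (1 / p) * B powr ((p - 1) / p) = \<kappa> * B"
    proof -
      have "A powr (1 / p) = \<kappa> * B powr (1 / p)"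
        using A B by (simp add: \<kappa>_def powr_divide)
      moreover have "B powr (1 / p) * B powr ((p - 1) / p) = B"
        using B assms(3) by (simp flip: powr_add add_divide_distrib)
      ultimately show ?thesis by simp
    qed
    define T where "T = (real N - (p - 1) * a - b - 1) / p * D"
    define J where "J m = (\<integral>x. (\<bar>u x\<bar> powr ((p - 2) / 2) * u x
            - \<bar>m\<bar> powr ((p - 2) / 2) * m * exp (- (p / 2 * \<kappa> * norm x powr \<sigma> / \<sigma>)))\<^sup>2 / norm x powr (p * a) \<partial>lborel)" for m
    obtain m where "\<kappa> powr p * (C * J m) \<le> A / p + (p - 1) / p * (\<kappa> powr p * B)
        - \<kappa> powr (p - 1) * ((n - ((p - 1) * a + b + 1)) / p * D)"
      unfolding A_def B_def D_def J_def C_def C2_def C1_def n_def \<sigma>_def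
      by (rule young_remainder_ge_weighted_distance[OF setting nN(2) \<sigma>[unfolded \<sigma>_def] a0 n\<sigma>[unfolded \<sigma>_def n_def] \<kappa>])
    also have "(n - ((p - 1) * a + b + 1)) / p * D = T" by (simp add: T_def nN(1) algebra_simps)
    also have "A / p + (p - 1) / p * (\<kappa> powr p * B) = \<kappa> powr p * B"
      unfolding \<kappa>B using assms(3) by (simp add: field_simps)
    also have "\<kappa> powr p = \<kappa> powr (p - 1) * \<kappa>" using \<kappa> by (simp add: powr_diff)
    finally have "\<kappa> powr (p - 1) * (C * \<kappa> * J m) \<le> \<kappa> powr (p - 1) * (\<kappa> * B - T)"
      by (simp add: algebra_simps)
    then have main: "C * \<kappa> * J m \<le> \<kappa> * B - T" using \<kappa> by simp

    define h1 where "h1 = (\<lambda>(c, l). \<integral>x. \<bar>\<bar>u x\<bar> powr ((p - 2) / 2) * u x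
                  - \<bar>c\<bar> powr ((p - 2) / 2) * c
                    * exp (- (p / 2 * norm x powr (b - a + 1))
                             / ((b - a + 1) * l powr (b - a + 1)))\<bar>\<^sup>2
                 / norm x powr (p * a) \<partial>lborel)"
    \<comment> \<open>The scale is chosen so that its \<sigma>-th power is
      \<open>1 / \<kappa>\<close>, which produces the exponent in \<open>J\<close>. Nonnegativity of
      the integrals gives the lower bound that a real infimum requires.\<close>
    have "(INF z \<in> (UNIV :: real set) \<times> {0 :: real<..}. h1 z) \<le> h1 (m, \<kappa> powr (- (1 / \<sigma>)))"
    proof (rule cINF_lower)
      have "0 \<le> h1 z" for z
        by (cases z) (auto simp: h1_def intro!: integral_nonneg_AE)
      then show "bdd_below (h1 ` (UNIV \<times> {0<..}))" by (rule bdd_belowI2[of _ 0])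
    qed (use \<kappa> in auto)
    also have "h1 (m, \<kappa> powr (- (1 / \<sigma>))) = J m"
    proof -
      have "(\<kappa> powr (- (1 / \<sigma>))) powr \<sigma> = \<kappa> powr (- 1)"
        using \<sigma> by (simp add: powr_powr)
      then have "(\<kappa> powr (- (1 / \<sigma>))) powr \<sigma> = 1 / \<kappa>"
        using \<kappa> by (simp add: powr_minus_divide)
      then show ?thesis unfolding h1_def J_def by (simp add: \<sigma>_def[symmetric] mult_ac)
    qed
    finally have "C * \<kappa> * (INF z \<in> (UNIV :: real set) \<times> {0 :: real<..}. h1 z) \<le> \<kappa> * B - T"
      using main C \<kappa> by (meson mult_left_mono mult_nonneg_nonneg less_imp_le order_trans)
    then have first: "A powr (1 / p) * B powr ((p - 1) / p) - T
        \<ge> C * (A / B) powr (1 / p) * (INF z \<in> (UNIV :: real set) \<times> {0 :: real<..}. h1 z)"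
      unfolding AB \<kappa>_def .

    define h2 where "h2 v = (\<integral>x. \<bar>\<bar>u x\<bar> powr ((p - 2) / 2) * u x
                   - \<bar>v x\<bar> powr ((p - 2) / 2) * v x\<bar>\<^sup>2 / norm x powr (p * a) \<partial>lborel) / B" for v :: "real ^ 'n \<Rightarrow> real"
    \<comment> \<open>The member of the family with \<alpha> = m and \<beta> = -\<kappa>; the signed
      power multiplies its exponent by p/2 and so reproduces the profile in
      \<open>J\<close>.\<close>
    define v where "v x = m * exp (- \<kappa> / (b - a + 1) * norm x powr (b - a + 1))" for x :: "real ^ 'n"
    have "(INF v \<in> M_set a b. h2 v) \<le> h2 v"
    proof (rule cINF_lower)
      have "0 \<le> h2 v" for v
        unfolding h2_def using B by (intro divide_nonneg_nonneg integral_nonneg_AE) auto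
      then show "bdd_below (h2 ` M_set a b)" by (rule bdd_belowI2[of _ 0])
      show "v \<in> M_set a b"
        unfolding M_set_def v_def[abs_def] mem_Collect_eq
        by (rule exI[of _ m], rule exI[of _ "- \<kappa>"]) (use \<kappa> \<sigma> in \<open>simp add: \<sigma>_def\<close>)
    qed
    also have "h2 v = J m / B"
    proof -
      have "\<bar>v x\<bar> powr ((p - 2) / 2) * v x = \<bar>m\<bar> powr ((p - 2) / 2) * m * exp (- (p / 2 * \<kappa> * norm x powr \<sigma> / \<sigma>))" for x
      proof -
        define \<phi> where "\<phi> = - \<kappa> / \<sigma> * norm x powr \<sigma>"
        have "exp \<phi> powr ((p - 2) / 2) * exp \<phi> = exp (p / 2 * \<phi>)"
          by (simp add: powr_def diff_divide_distrib algebra_simps flip: exp_add)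
        moreover have "v x = m * exp \<phi>" by (simp add: v_def \<phi>_def \<sigma>_def)
        moreover have "p / 2 * \<phi> = - (p / 2 * \<kappa> * norm x powr \<sigma> / \<sigma>)" by (simp add: \<phi>_def)
        ultimately show ?thesis by (simp add: abs_mult powr_mult mult_ac)
      qed
      then show ?thesis unfolding h2_def J_def by simp
    qed
    finally have "C * (INF v \<in> M_set a b. h2 v) \<le> C * (J m / B)"
      using C by (intro mult_left_mono) auto
    also have "\<dots> = C * \<kappa> * J m / (\<kappa> * B)" using \<kappa> by simp
    also have "\<dots> \<le> (\<kappa> * B - T) / (\<kappa> * B)"
      using main \<kappa> B by (intro divide_right_mono) auto
    also have "\<dots> = 1 - T / (\<kappa> * B)" using \<kappa> B by (simp add: diff_divide_distrib)
    finally have second: "1 - T / (A powr (1 / p) * B powr ((p - 1) / p)) \<ge> C * (INF v \<in> M_set a b. h2 v)"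
      unfolding AB .
    show "(\<integral>x. norm (grad u x) powr p / norm x powr (p * b) \<partial>lborel) powr (1 / p)
      * (\<integral>x. \<bar>u x\<bar> powr p / norm x powr (p * a) \<partial>lborel) powr ((p - 1) / p)
      - (real N - (p - 1) * a - b - 1) / p
        * (\<integral>x. \<bar>u x\<bar> powr p / norm x powr ((p - 1) * a + b + 1) \<partial>lborel)
    \<ge> C * ((\<integral>x. norm (grad u x) powr p / norm x powr (p * b) \<partial>lborel)
            / (\<integral>x. \<bar>u x\<bar> powr p / norm x powr (p * a) \<partial>lborel)) powr (1 / p)
        * (INF (c, l) \<in> (UNIV :: real set) \<times> {0 :: real<..}.
             \<integral>x. \<bar>\<bar>u x\<bar> powr ((p - 2) / 2) * u x
                  - \<bar>c\<bar> powr ((p - 2) / 2) * c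
                    * exp (- (p / 2 * norm x powr (b - a + 1))
                             / ((b - a + 1) * l powr (b - a + 1)))\<bar>\<^sup>2
                 / norm x powr (p * a) \<partial>lborel)"
      using first unfolding A_def B_def D_def T_def h1_def .
    show "1 - ((real N - (p - 1) * a - b - 1) / p
          * (\<integral>x. \<bar>u x\<bar> powr p / norm x powr ((p - 1) * a + b + 1) \<partial>lborel))
        / ((\<integral>x. norm (grad u x) powr p / norm x powr (p * b) \<partial>lborel) powr (1 / p)
           * (\<integral>x. \<bar>u x\<bar> powr p / norm x powr (p * a) \<partial>lborel) powr ((p - 1) / p))
    \<ge> C * (INF v \<in> M_set a b.
             (\<integral>x. \<bar>\<bar>u x\<bar> powr ((p - 2) / 2) * u x
                   - \<bar>v x\<bar> powr ((p - 2) / 2) * v x\<bar>\<^sup>2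
                  / norm x powr (p * a) \<partial>lborel)
             / (\<integral>x. \<bar>u x\<bar> powr p / norm x powr (p * a) \<partial>lborel))"
      using second unfolding A_def B_def D_def T_def h2_def .
  qed
qed

end
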